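(* Let $m\ge3$ be an odd integer and $n=2m$. Let $f:[0,\infty)\to[0,\infty)$ be continuous with $\log(1+f(t))=O(t^\lambda)$ as $t\to\infty$, where $0<\lambda<1$. Let $v$ be a $C^{2m}$ nonnegative solution of $$0\le-\Delta^m v\le f(v)\quad\text{in }\mathbb{R}^n\setminus B_{1/2}(0).$$ Then $v(y)=o\left(|y|^{\frac{n-2}{1-\lambda}}\right)$ as $|y|\to\infty$.
   Context: $\Delta^m$ is the $m$-fold iterated Laplacian; $B_{1/2}(0)$ is the open ball of radius $1/2$ about the origin. *)

theory Defs
  imports "HOL-Analysis.Analysis" "HOL-Library.Landau_Symbols"
begin

definition partial :: "'n::finite \<Rightarrow> (real^'n \<Rightarrow> real) \<Rightarrow> real^'n \<Rightarrow> real" where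
  "partial i g x = deriv (\<lambda>t. g (x + t *\<^sub>R axis i 1)) 0"

definition laplacian :: "(real^'n::finite \<Rightarrow> real) \<Rightarrow> real^'n \<Rightarrow> real" where
  "laplacian g x = (\<Sum>i\<in>UNIV. partial i (partial i g) x)"

definition iter_laplacian :: "nat \<Rightarrow> (real^'n::finite \<Rightarrow> real) \<Rightarrow> real^'n \<Rightarrow> real" where
  "iter_laplacian m g = (laplacian ^^ m) g"

fun Ck_on :: "nat \<Rightarrow> (real^'n::finite) set \<Rightarrow> (real^'n \<Rightarrow> real) \<Rightarrow> bool" where
  "Ck_on 0 U g = continuous_on U g"
| "Ck_on (Suc k) U g = (continuous_on U g \<and>
     (\<forall>i. (\<forall>x\<in>U. (\<lambda>t. g (x + t *\<^sub>R axis i 1)) differentiable (at 0)) \<and> Ck_on k U (partial i g)))"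

end

(* Put g = - Delta^m v >= 0. Integrating against a compactly supported radial function that behaves
   like |x|^(2 - n) and has nonnegative m-fold Laplacian shows that g |x|^(2 - n) is integrable at
   infinity and that v has mean O(R^(n - 2)) at distance R. Testing with a truncated, regularised
   logarithm, whose m-fold Laplacian is minus a bubble up to a bounded term (m is odd and n = 2m),
   gives v(y) <= C (integral of g log(R / |x - y|) over B(y, R) + R^(n - 2)) for R = |y| / 2.
   There the mass M of g is o(R^(n - 2)). At a suitably chosen point near y, g is at most
   exp(C V^lam) with V = v(y) on a ball of radius exp(- C V^lam), so the logarithm contributes
   about M V^lam; hence V <= C R^(n - 2) (1 + log R) + C M V^lam, which is the claim. *)
theory Submission
  imports Defs
begin

section \<open>Partial derivatives and the classes \<open>C\<^sup>k\<close>\<close>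

text \<open>Apart from \<open>v\<close> and its m-fold Laplacian, no power of the Laplacian of
  \<open>v\<close> has a known sign, so maximum principles for intermediate powers are out of reach.
  Everything is drawn from pairing \<open>v\<close> with explicit test functions whose m-fold
  Laplacian has a sign up to bounded terms. They must be of class C^(2m) across the boundary of
  their support: otherwise Green's identity would leave boundary terms with derivatives of
  \<open>v\<close>, which nothing controls. This forces the factor (1 - s)^(2m) in the derivative of
  both kernels. Regularising the logarithm by \<open>e\<close> keeps the test function smooth at its
  centre, so no distributions appear. The nonlinearity bounds g by v alone, so g is under control
  only near points where v is almost maximal; hence the estimate is applied at a chosen neighbour z
  of y. The exponent (n - 2) / (1 - lam) is the one at which R^(n - 2) V^lam balances V. Boundedness
  of the weighted mass alone would give a big-O; that its tail is small lets the term be absorbed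
  for every prescribed coefficient.\<close>

definition has_partial :: "'n::finite \<Rightarrow> (real^'n \<Rightarrow> real) \<Rightarrow> real \<Rightarrow> real^'n \<Rightarrow> bool" where
  "has_partial i g d x \<longleftrightarrow> ((\<lambda>t. g (x + t *\<^sub>R axis i 1)) has_real_derivative d) (at 0)"

lemma has_partial_imp_partial: "has_partial i g d x \<Longrightarrow> partial i g x = d"
  unfolding has_partial_def partial_def by (rule DERIV_imp_deriv)

lemma has_partial_partial:
  "(\<lambda>t. g (x + t *\<^sub>R axis i 1)) differentiable (at 0) \<Longrightarrow> has_partial i g (partial i g x) x"
  unfolding has_partial_def partial_def
  using DERIV_deriv_iff_real_differentiable by blast

lemma has_partial_differentiable:
  "has_partial i g d x \<Longrightarrow> (\<lambda>t. g (x + t *\<^sub>R axis i 1)) differentiable (at 0)"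
  unfolding has_partial_def real_differentiable_def by blast

lemma eventually_line_in_open:
  fixes x :: "real^'n::finite"
  assumes "open U" "x \<in> U"
  shows "\<forall>\<^sub>F t in nhds 0. x + t *\<^sub>R axis i 1 \<in> U"
proof -
  have "isCont (\<lambda>t. x + t *\<^sub>R axis i (1::real)) 0" by (intro continuous_intros)
  then have "\<forall>\<^sub>F t in at 0. x + t *\<^sub>R axis i 1 \<in> U"
    using assms unfolding isCont_def by (auto dest: topological_tendstoD)
  then show ?thesis using assms(2) by (simp add: eventually_nhds_conv_at)
qed

lemma has_partial_cong:
  assumes "open U" "x \<in> U" "\<And>z. z \<in> U \<Longrightarrow> g z = h z" "has_partial i g d x"
  shows "has_partial i h d x"
proof -
  have "\<forall>\<^sub>F t in nhds 0. g (x + t *\<^sub>R axis i 1) = h (x + t *\<^sub>R axis i 1)"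
    using eventually_line_in_open[OF assms(1,2), of i] by eventually_elim (rule assms(3))
  then show ?thesis
    using assms(4) unfolding has_partial_def by (subst DERIV_cong_ev[symmetric]) auto
qed

lemma partial_cong:
  assumes "open U" "x \<in> U" "\<And>z. z \<in> U \<Longrightarrow> g z = h z"
  shows "partial i g x = partial i h x"
proof -
  have "\<forall>\<^sub>F t in nhds 0. g (x + t *\<^sub>R axis i 1) = h (x + t *\<^sub>R axis i 1)"
    using eventually_line_in_open[OF assms(1,2), of i] by eventually_elim (rule assms(3))
  then show ?thesis
    unfolding partial_def by (intro deriv_cong_ev) auto
qed

lemma laplacian_cong:
  assumes "open U" "x \<in> U" "\<And>z. z \<in> U \<Longrightarrow> g z = h z"
  shows "laplacian g x = laplacian h x"
  unfolding laplacian_def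
  by (intro sum.cong refl partial_cong[OF assms(1,2)]) (auto intro!: partial_cong[OF assms(1)] assms(3))

lemma iter_laplacian_0 [simp]: "iter_laplacian 0 g = g"
  by (simp add: iter_laplacian_def)

lemma iter_laplacian_Suc: "iter_laplacian (Suc k) g = laplacian (iter_laplacian k g)"
  by (simp add: iter_laplacian_def)

lemma iter_laplacian_Suc': "iter_laplacian (Suc k) g = iter_laplacian k (laplacian g)"
  by (simp add: iter_laplacian_def funpow_Suc_right del: funpow.simps)

lemma iter_laplacian_cong:
  assumes "open U" "\<And>z. z \<in> U \<Longrightarrow> g z = h z" "x \<in> U"
  shows "iter_laplacian k g x = iter_laplacian k h x"
  using assms(3)
proof (induction k arbitrary: x)
  case (Suc k)
  then show ?case unfolding iter_laplacian_Suc by (intro laplacian_cong[OF assms(1)]) auto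
qed (use assms in auto)

lemma has_partial_const [intro]: "has_partial i (\<lambda>x. c) 0 x"
  unfolding has_partial_def by simp

lemma has_partial_add:
  "has_partial i g d x \<Longrightarrow> has_partial i h e x \<Longrightarrow> has_partial i (\<lambda>x. g x + h x) (d + e) x"
  unfolding has_partial_def by (rule DERIV_add)

lemma has_partial_diff:
  "has_partial i g d x \<Longrightarrow> has_partial i h e x \<Longrightarrow> has_partial i (\<lambda>x. g x - h x) (d - e) x"
  unfolding has_partial_def by (rule DERIV_diff)

lemma has_partial_mult:
  "has_partial i g d x \<Longrightarrow> has_partial i h e x \<Longrightarrow>
    has_partial i (\<lambda>x. g x * h x) (d * h x + g x * e) x"
  unfolding has_partial_def by (drule (1) DERIV_mult) (simp add: algebra_simps)

lemma has_partial_chain: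
  assumes "(f has_real_derivative f') (at (g x))" "has_partial i g d x"
  shows "has_partial i (\<lambda>x. f (g x)) (f' * d) x"
  using assms unfolding has_partial_def
  by (intro DERIV_chain2[of f]) auto

lemma has_partial_coord: "has_partial i (\<lambda>x. x $ j) (if i = j then 1 else 0) x"
  unfolding has_partial_def by (auto intro!: derivative_eq_intros simp: axis_def)

lemma laplacian_zero [simp]: "laplacian (\<lambda>x. 0) = (\<lambda>x::real^'n::finite. 0)"
proof -
  have "partial i (\<lambda>x. 0) = (\<lambda>x::real^'n::finite. 0)" for i
    using has_partial_imp_partial[OF has_partial_const] by (intro ext)
  then show ?thesis unfolding laplacian_def by simp
qed

lemma iter_laplacian_zero [simp]: "iter_laplacian k (\<lambda>x. 0) = (\<lambda>x::real^'n::finite. 0)"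
  by (induction k) (auto simp: iter_laplacian_Suc)

section \<open>Closure properties of the classes \<open>Ck_on\<close>\<close>

lemma Ck_on_imp_continuous_on: "Ck_on k U g \<Longrightarrow> continuous_on U g"
  by (cases k) auto

lemma Ck_on_has_partial:
  "Ck_on (Suc k) U g \<Longrightarrow> x \<in> U \<Longrightarrow> has_partial i g (partial i g x) x"
  by (auto intro: has_partial_partial)

lemma Ck_on_Suc_D: "Ck_on (Suc k) U g \<Longrightarrow> Ck_on k U g"
proof (induction k arbitrary: g)
  case (Suc k)
  then show ?case by (metis Ck_on.simps(2))
qed auto

lemma Ck_on_mono: "Ck_on k U g \<Longrightarrow> j \<le> k \<Longrightarrow> Ck_on j U g"
proof (induction k)
  case (Suc k)
  then show ?case by (cases "j = Suc k") (auto dest: Ck_on_Suc_D simp del: Ck_on.simps)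
qed simp

lemma Ck_on_cong:
  assumes "open U" "\<And>x. x \<in> U \<Longrightarrow> g x = h x" "Ck_on k U g"
  shows "Ck_on k U h"
  using assms(2,3)
proof (induction k arbitrary: g h)
  case 0
  then show ?case by (simp cong: continuous_on_cong)
next
  case (Suc k)
  have "continuous_on U h" using Suc.prems by (simp cong: continuous_on_cong)
  moreover have "has_partial i h (partial i g x) x" if "x \<in> U" for i x
    by (rule has_partial_cong[where g = g and U = U])
       (fact assms(1) that Suc.prems(1) Ck_on_has_partial[OF Suc.prems(2) that])+
  moreover have "Ck_on k U (partial i h)" for i
  proof (rule Suc.IH[of "partial i g"])
    show "partial i g x = partial i h x" if "x \<in> U" for x
      by (rule partial_cong[where U = U]) (fact assms(1) that Suc.prems(1))+
  qed (use Suc.prems(2) in simp)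
  ultimately show ?case by (simp; blast intro: has_partial_differentiable)
qed

text \<open>Since \<open>partial\<close> is a total function built on \<open>deriv\<close>, it is
  awkward to compute with. Any family \<open>g'\<close> certified by \<open>has_partial\<close> may
  replace it, because \<open>Ck_on\<close> on an open set sees only the values there.\<close>

lemma Ck_on_SucI:
  assumes "open U" "continuous_on U g"
    and "\<And>i x. x \<in> U \<Longrightarrow> has_partial i g (g' i x) x" "\<And>i. Ck_on k U (g' i)"
  shows "Ck_on (Suc k) U g"
proof -
  have "Ck_on k U (partial i g)" for i
    by (rule Ck_on_cong[OF assms(1) _ assms(4)[of i]])
       (rule has_partial_imp_partial[OF assms(3), symmetric])
  then show ?thesis using assms(2) has_partial_differentiable[OF assms(3)] by simp
qed

lemma Ck_on_const: "open U \<Longrightarrow> Ck_on k U (\<lambda>x. c)"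
proof (induction k arbitrary: c)
  case (Suc k)
  then show ?case
    by (intro Ck_on_SucI[where g' = "\<lambda>_ _. 0"] has_partial_const continuous_intros)
qed simp

lemma Ck_on_coord: "open U \<Longrightarrow> Ck_on k U (\<lambda>x. x $ j)"
proof (cases k)
  case (Suc k)
  assume "open U"
  then have "Ck_on k U (\<lambda>x. if i = j then 1 else 0)" for i by (rule Ck_on_const)
  then show ?thesis unfolding Suc
    by (intro Ck_on_SucI[OF \<open>open U\<close> _ has_partial_coord]) (intro continuous_intros)
qed (auto intro: continuous_intros)

lemma Ck_on_add:
  assumes "open U"
  shows "Ck_on k U g \<Longrightarrow> Ck_on k U h \<Longrightarrow> Ck_on k U (\<lambda>x. g x + h x)"
proof (induction k arbitrary: g h)
  case (Suc k)
  have p: "has_partial i (\<lambda>x. g x + h x) (partial i g x + partial i h x) x" if "x \<in> U" for i x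
    by (intro has_partial_add Ck_on_has_partial[OF Suc.prems(1) that] Ck_on_has_partial[OF Suc.prems(2) that])
  have c: "Ck_on k U (\<lambda>x. partial i g x + partial i h x)" for i
    using Suc.prems by (intro Suc.IH) simp_all
  show ?case
    by (intro Ck_on_SucI[OF assms _ p c] continuous_intros Ck_on_imp_continuous_on[OF Suc.prems(1)]
        Ck_on_imp_continuous_on[OF Suc.prems(2)])
qed (auto intro: continuous_intros)

lemma Ck_on_mult:
  assumes "open U"
  shows "Ck_on k U g \<Longrightarrow> Ck_on k U h \<Longrightarrow> Ck_on k U (\<lambda>x. g x * h x)"
proof (induction k arbitrary: g h)
  case (Suc k)
  note D = Ck_on_Suc_D[OF Suc.prems(1)] Ck_on_Suc_D[OF Suc.prems(2)]
  have p: "has_partial i (\<lambda>x. g x * h x) (partial i g x * h x + g x * partial i h x) x"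
    if "x \<in> U" for i x
    by (intro has_partial_mult Ck_on_has_partial[OF Suc.prems(1) that] Ck_on_has_partial[OF Suc.prems(2) that])
  have c: "Ck_on k U (\<lambda>x. partial i g x * h x + g x * partial i h x)" for i
    using Suc.prems by (intro Ck_on_add assms Suc.IH D) simp_all
  show ?case
    by (intro Ck_on_SucI[OF assms _ p c] continuous_intros Ck_on_imp_continuous_on[OF Suc.prems(1)]
        Ck_on_imp_continuous_on[OF Suc.prems(2)])
qed (auto intro: continuous_intros)

lemma Ck_on_cmult: "open U \<Longrightarrow> Ck_on k U g \<Longrightarrow> Ck_on k U (\<lambda>x. c * g x)"
  by (intro Ck_on_mult Ck_on_const)

lemma Ck_on_diff: "open U \<Longrightarrow> Ck_on k U g \<Longrightarrow> Ck_on k U h \<Longrightarrow> Ck_on k U (\<lambda>x. g x - h x)"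
  using Ck_on_add[of U k g "\<lambda>x. (- 1) * h x"] Ck_on_cmult[of U k h "- 1"]
  by (simp del: Ck_on.simps)

lemma Ck_on_sum:
  assumes "open U" "finite I" "\<And>i. i \<in> I \<Longrightarrow> Ck_on k U (g i)"
  shows "Ck_on k U (\<lambda>x. \<Sum>i\<in>I. g i x)"
  using assms(2,3)
proof (induction I rule: finite_induct)
  case (insert i I)
  have "Ck_on k U (\<lambda>x. g i x + (\<Sum>i\<in>I. g i x))"
    by (intro Ck_on_add assms(1) insert) auto
  then show ?case using insert by (simp del: Ck_on.simps)
qed (simp add: Ck_on_const assms(1))

lemma Ck_on_power: "open U \<Longrightarrow> Ck_on k U g \<Longrightarrow> Ck_on k U (\<lambda>x. g x ^ p)"
proof (induction p)
  case (Suc p)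
  have "Ck_on k U (\<lambda>x. g x * g x ^ p)"
    by (intro Ck_on_mult Suc)
  then show ?case by simp
qed (simp add: Ck_on_const)

lemma Ck_on_inverse:
  assumes "open U"
  shows "Ck_on k U g \<Longrightarrow> (\<And>x. x \<in> U \<Longrightarrow> g x \<noteq> 0) \<Longrightarrow> Ck_on k U (\<lambda>x. inverse (g x))"
proof (induction k)
  case (Suc k)
  have "Ck_on k U (\<lambda>x. inverse (g x))"
    by (rule Suc.IH[OF Ck_on_Suc_D[OF Suc.prems(1)] Suc.prems(2)])
  then have c: "Ck_on k U (\<lambda>x. (- (inverse (g x) ^ 2)) * partial i g x)" for i
    using Suc.prems(1) Ck_on_cmult[OF assms Ck_on_power[OF assms], of k "\<lambda>x. inverse (g x)" "-1" 2]
    by (intro Ck_on_mult assms) simp_all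
  have p: "has_partial i (\<lambda>x. inverse (g x)) ((- (inverse (g x) ^ 2)) * partial i g x) x" if "x \<in> U" for i x
  proof (rule has_partial_chain[of inverse])
    show "(inverse has_real_derivative - (inverse (g x) ^ 2)) (at (g x))"
      using DERIV_inverse[OF Suc.prems(2)[OF that]] by (simp add: numeral_2_eq_2)
  qed (rule Ck_on_has_partial[OF Suc.prems(1) that])
  show ?case
    using Suc.prems(2) by (intro Ck_on_SucI[OF assms _ p c] continuous_intros
      Ck_on_imp_continuous_on[OF Suc.prems(1)]) auto
qed (auto intro: continuous_intros)

text \<open>An exponent of at least 2 makes the difference quotient at the kink \<open>0\<close>
  tend to \<open>0\<close> from both sides.\<close>

lemma has_real_derivative_pos_power:
  "((\<lambda>t. max 0 t ^ (k + 2)) has_real_derivative real (k + 2) * max 0 t ^ (k + 1)) (at t)"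
proof -
  consider "t > 0" | "t < 0" | "t = 0" by linarith
  then show ?thesis
  proof cases
    case 1
    have "((\<lambda>t. t ^ (k + 2)) has_real_derivative real (k + 2) * t ^ (k + 1)) (at t)"
      using DERIV_pow[of "k + 2" t] by simp
    moreover have "\<forall>\<^sub>F s in nhds t. s ^ (k + 2) = max 0 s ^ (k + 2)"
      using eventually_nhds_in_open[of "{0<..}" t] 1 by (auto elim!: eventually_mono simp: max_def)
    ultimately show ?thesis using 1 by (subst DERIV_cong_ev[symmetric]) (auto simp: max_def)
  next
    case 2
    have "((\<lambda>t. 0) has_real_derivative real (k + 2) * max 0 t ^ (k + 1)) (at t)"
      using 2 by (auto intro!: derivative_eq_intros)
    moreover have "\<forall>\<^sub>F s in nhds t. 0 = max 0 s ^ (k + 2)"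
      using eventually_nhds_in_open[of "{..<0}" t] 2 by (auto elim!: eventually_mono simp: max_def)
    ultimately show ?thesis by (subst DERIV_cong_ev[symmetric]) auto
  next
    case 3
    have "((\<lambda>h. max 0 h ^ (k + 1)) \<longlongrightarrow> max 0 0 ^ (k + 1)) (at (0::real))"
      by (intro tendsto_intros)
    moreover have "\<bar>max 0 h ^ (k + 2) / h\<bar> \<le> max 0 h ^ (k + 1)" for h :: real
      by (cases "h > 0") (auto simp: max_def field_simps)
    ultimately have "((\<lambda>h. max 0 h ^ (k + 2) / h) \<longlongrightarrow> 0) (at (0::real))"
      by (intro Lim_null_comparison[of "\<lambda>h. max 0 h ^ (k + 2) / h"]) auto
    then show ?thesis unfolding 3 DERIV_def by simp
  qed
qed

text \<open>Each derivative lowers the exponent by one, and the last one must still be continuous at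
  the kink; hence the strict inequality \<open>j < k\<close>. It is the source of the exponents
  \<open>2 * m\<close> in \<open>kern\<close> and \<open>2 * m + 1\<close> in the cutoff.\<close>

lemma Ck_on_pos_power:
  assumes "open U"
  shows "Ck_on j U g \<Longrightarrow> j < k \<Longrightarrow> Ck_on j U (\<lambda>x. max 0 (g x) ^ k)"
proof (induction j arbitrary: k)
  case (Suc j)
  define l where "l = k - 2"
  have k: "k = l + 2" using Suc.prems(2) by (simp add: l_def)
  have c: "Ck_on j U (\<lambda>x. (real (l + 2) * max 0 (g x) ^ (l + 1)) * partial i g x)" for i
    using Suc.prems(1) Suc.prems(2)[unfolded k]
    by (intro Ck_on_mult Ck_on_cmult assms Suc.IH Ck_on_Suc_D[OF Suc.prems(1)]) simp_all
  have p: "has_partial i (\<lambda>x. max 0 (g x) ^ (l + 2))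
      ((real (l + 2) * max 0 (g x) ^ (l + 1)) * partial i g x) x" if "x \<in> U" for i x
    by (rule has_partial_chain[OF has_real_derivative_pos_power Ck_on_has_partial[OF Suc.prems(1) that]])
  show ?case unfolding k
    by (intro Ck_on_SucI[OF assms _ p c] continuous_intros Ck_on_imp_continuous_on[OF Suc.prems(1)])
qed (auto intro!: continuous_intros)

lemma Ck_on_laplacian: "open U \<Longrightarrow> Ck_on (k + 2) U g \<Longrightarrow> Ck_on k U (laplacian g)"
  unfolding laplacian_def [abs_def] by (intro Ck_on_sum) auto

lemma Ck_on_iter_laplacian: "open U \<Longrightarrow> Ck_on (k + 2 * j) U g \<Longrightarrow> Ck_on k U (iter_laplacian j g)"
proof (induction j arbitrary: g)
  case (Suc j)
  have "Ck_on (k + 2 * j) U (laplacian g)"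
    by (rule Ck_on_laplacian) (use Suc.prems in \<open>simp_all add: add.assoc del: Ck_on.simps\<close>)
  with Suc show ?case by (simp add: iter_laplacian_Suc' del: Ck_on.simps)
qed simp

section \<open>Integration by parts\<close>

lemma has_partial_shift:
  assumes "has_partial i g d (x + s *\<^sub>R axis i 1)"
  shows "((\<lambda>t. g (x + t *\<^sub>R axis i 1)) has_real_derivative d) (at s)"
proof -
  have "((\<lambda>t. g (x + s *\<^sub>R axis i 1 + (t - s) *\<^sub>R axis i 1)) has_real_derivative d * 1) (at s)"
    using assms unfolding has_partial_def
    by (intro DERIV_chain2[of "\<lambda>t. g (x + s *\<^sub>R axis i 1 + t *\<^sub>R axis i 1)"]) (auto intro!: derivative_eq_intros)
  then show ?thesis by (simp add: scaleR_left_diff_distrib)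
qed

lemma integral_translation_real_vec:
  fixes F :: "'a::euclidean_space \<Rightarrow> real"
  assumes "F \<in> borel_measurable borel"
  shows "(LINT x|lborel. F (x + c)) = (LINT x|lborel. F x)"
proof -
  have "(LINT x|lborel. F x) = (LINT x|distr lborel borel ((+) c). F x)"
    by (simp add: lborel_distr_plus)
  also have "\<dots> = (LINT x|lborel. F (c + x))"
    using assms by (subst integral_distr) auto
  finally show ?thesis by (simp add: add.commute)
qed

lemma integrable_continuous_compact_support:
  fixes F :: "'a::euclidean_space \<Rightarrow> real"
  assumes "continuous_on K F" "compact K" "\<And>x. x \<notin> K \<Longrightarrow> F x = 0"
  shows "integrable lborel F"
proof -
  have "(\<lambda>x. indicator K x *\<^sub>R F x) = F" using assms(3) by (simp add: fun_eq_iff indicator_def of_bool_def)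
  then show ?thesis using borel_integrable_compact[OF assms(2,1)] by simp
qed

text \<open>Translation invariance of Lebesgue measure makes the difference quotients of
  \<open>F\<close> integrate to zero, and dominated convergence passes this to the derivative. No
  iterated integrals are involved.\<close>

lemma integral_partial_compact_support:
  fixes F :: "real^'n::finite \<Rightarrow> real"
  assumes c: "continuous_on UNIV F" "continuous_on UNIV F'"
    and d: "\<And>x. has_partial i F (F' x) x"
    and K: "compact K" and F0: "\<And>x. x \<notin> K \<Longrightarrow> F x = 0" and F'0: "\<And>x. x \<notin> K \<Longrightarrow> F' x = 0"
  shows "integrable lborel F'" "(LINT x|lborel. F' x) = 0"
proof -
  have m[measurable]: "F \<in> borel_measurable borel" "F' \<in> borel_measurable borel"
    using c by (auto intro: borel_measurable_continuous_onI)
  have int: "integrable lborel F" "integrable lborel F'"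
    using c K F0 F'0 by (auto intro!: integrable_continuous_compact_support[of K] intro: continuous_on_subset)
  then show "integrable lborel F'" by simp
  obtain B where B: "\<And>x. \<bar>F' x\<bar> \<le> B" "B \<ge> 0"
  proof -
    have "compact (F' ` K)" using c(2) K continuous_on_subset by (blast intro: compact_continuous_image)
    then obtain B where "\<And>x. x \<in> K \<Longrightarrow> \<bar>F' x\<bar> \<le> B"
      by (force dest: compact_imp_bounded simp: bounded_iff)
    then have "\<bar>F' x\<bar> \<le> max B 0" for x using F'0 by (cases "x \<in> K") (auto intro: max.coboundedI1)
    then show ?thesis using that by (metis max.cobounded2)
  qed
  obtain r where r: "\<And>x. x \<in> K \<Longrightarrow> norm x \<le> r"
    using K by (meson bounded_iff compact_imp_bounded)
  define e where "e = (axis i 1 :: real^'n)"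
  have ne: "norm e = 1" by (simp add: e_def)
  define h where "h k = inverse (real (Suc k))" for k
  have h: "0 < h k" "h k \<le> 1" for k by (auto simp: h_def field_simps)
  define q where "q k x = (F (x + h k *\<^sub>R e) - F x) / h k" for k x
  have qm[measurable]: "q k \<in> borel_measurable borel" for k
    unfolding q_def by measurable
  have qi: "(LINT x|lborel. q k x) = 0" for k
  proof -
    have "integrable lborel (\<lambda>x. F (x + h k *\<^sub>R e))"
    proof (rule integrable_continuous_compact_support[of "(\<lambda>x. x - h k *\<^sub>R e) ` K"])
      show "compact ((\<lambda>x. x - h k *\<^sub>R e) ` K)"
        using K by (intro compact_continuous_image continuous_intros)
      show "continuous_on ((\<lambda>x. x - h k *\<^sub>R e) ` K) (\<lambda>x. F (x + h k *\<^sub>R e))"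
        by (intro continuous_on_compose2[OF c(1)] continuous_intros) auto
      show "F (x + h k *\<^sub>R e) = 0" if "x \<notin> (\<lambda>x. x - h k *\<^sub>R e) ` K" for x
        using that by (intro F0) (metis add_diff_cancel imageI)
    qed
    then show ?thesis unfolding q_def
      using int(1) integral_translation_real_vec[of F "h k *\<^sub>R e"] m by simp
  qed
  have lim: "(\<lambda>k. q k x) \<longlonglongrightarrow> F' x" for x
  proof -
    have "((\<lambda>t. (F (x + t *\<^sub>R e) - F x) / t) \<longlongrightarrow> F' x) (at 0)"
      using d[of x] unfolding has_partial_def e_def DERIV_def by simp
    moreover have "filterlim h (at 0) sequentially"
    proof -
      have "h \<longlonglongrightarrow> 0" unfolding h_def by (rule LIMSEQ_inverse_real_of_nat)
      then show ?thesis using h(1) by (intro filterlim_atI) (auto simp: less_imp_neq[THEN not_sym])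
    qed
    ultimately show ?thesis unfolding q_def by (rule filterlim_compose)
  qed
  \<comment> \<open>The mean value theorem along the axis bounds the quotients by \<open>B\<close>;
    as the steps are at most 1, they all vanish outside the ball of radius
    \<open>r + 1\<close>.\<close>
  have bound: "norm (q k x) \<le> B * indicator (cball 0 (r + 1)) x" for k x
  proof (cases "x \<in> cball 0 (r + 1)")
    case True
    have dd: "((\<lambda>t. F (x + t *\<^sub>R axis i 1)) has_real_derivative F' (x + t *\<^sub>R axis i 1)) (at t)" for t
      by (intro has_partial_shift d)
    obtain z where "F (x + h k *\<^sub>R e) - F (x + 0 *\<^sub>R e) = (h k - 0) * F' (x + z *\<^sub>R e)"
      using MVT2[of 0 "h k" "\<lambda>t. F (x + t *\<^sub>R e)" "\<lambda>t. F' (x + t *\<^sub>R e)"] h[of k] dd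
      unfolding e_def by blast
    then have "q k x = F' (x + z *\<^sub>R e)" using h[of k] by (simp add: q_def)
    then show ?thesis using B True by simp
  next
    case False
    then have "norm x > r + 1" by simp
    moreover have "norm x \<le> norm (x + h k *\<^sub>R e) + h k"
      using norm_triangle_ineq4[of "x + h k *\<^sub>R e" "h k *\<^sub>R e"] ne h[of k] by simp
    ultimately have "x \<notin> K" "x + h k *\<^sub>R e \<notin> K" using r h[of k] by fastforce+
    then show ?thesis using False by (simp add: q_def F0)
  qed
  have "(\<lambda>k. LINT x|lborel. q k x) \<longlonglongrightarrow> (LINT x|lborel. F' x)"
  proof (rule integral_dominated_convergence)
    show "integrable lborel (\<lambda>x. B * indicator (cball (0::real^'n) (r + 1)) x)"
      using emeasure_lborel_cball_finite[of "0::real^'n" "r + 1"]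
      by (intro integrable_mult_right integrable_real_indicator) auto
  qed (use lim bound in \<open>auto simp: m\<close>)
  then have "(\<lambda>k. 0) \<longlonglongrightarrow> (LINT x|lborel. F' x)" by (simp only: qi)
  then show "(LINT x|lborel. F' x) = 0" by (simp only: LIMSEQ_const_iff)
qed

text \<open>The open sets \<open>U\<close> and \<open>- K\<close> cover the space, and the extension
  is smooth on each: it equals \<open>g\<close> on the first and zero on the second.\<close>

lemma Ck_on_zero_outside:
  assumes "open U" "closed K" "K \<subseteq> U" "Ck_on k U g" "\<And>x. x \<in> U - K \<Longrightarrow> g x = 0"
  shows "Ck_on k UNIV (\<lambda>x. if x \<in> K then g x else 0)"
  using assms(4,5)
proof (induction k arbitrary: g)
  case 0
  have "continuous_on (U \<union> - K) (\<lambda>x. if x \<in> K then g x else 0)"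
  proof (rule continuous_on_open_Un)
    have "continuous_on U (\<lambda>x. if x \<in> K then g x else 0) \<longleftrightarrow> continuous_on U g"
      using 0 by (intro continuous_on_cong) auto
    then show "continuous_on U (\<lambda>x. if x \<in> K then g x else 0)" using 0 by simp
    show "continuous_on (- K) (\<lambda>x. if x \<in> K then g x else 0)"
      by (rule continuous_on_eq[of _ "\<lambda>x. 0"]) auto
  qed (use assms in auto)
  moreover have "U \<union> - K = UNIV" using assms by auto
  ultimately show ?case by simp
next
  case (Suc k)
  let ?g = "\<lambda>x. if x \<in> K then g x else 0"
  have oK: "open (- K)" using assms by auto
  have p0: "partial i g x = 0" if "x \<in> U - K" for i x
  proof -
    have "has_partial i g 0 x"
      by (rule has_partial_cong[of "U - K" _ "\<lambda>x. 0"]) (use that assms Suc.prems in \<open>auto intro: has_partial_const\<close>)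
    then show ?thesis by (rule has_partial_imp_partial)
  qed
  have "Ck_on 0 U g" using Suc.prems by simp
  then have c0: "Ck_on 0 UNIV ?g"
  proof -
    have "continuous_on (U \<union> - K) ?g"
    proof (rule continuous_on_open_Un)
      have "continuous_on U ?g \<longleftrightarrow> continuous_on U g"
        using Suc.prems by (intro continuous_on_cong) auto
      then show "continuous_on U ?g" using Suc.prems by simp
      show "continuous_on (- K) ?g"
        by (rule continuous_on_eq[of _ "\<lambda>x. 0"]) auto
    qed (use assms in auto)
    moreover have "U \<union> - K = UNIV" using assms by auto
    ultimately show ?thesis by simp
  qed
  have p: "has_partial i ?g (if x \<in> K then partial i g x else 0) x" for i x
  proof (cases "x \<in> U")
    case True
    have "has_partial i ?g (partial i g x) x"
      by (rule has_partial_cong[where U = U and g = g])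
         (use assms(1) True Suc.prems(2) Ck_on_has_partial[OF Suc.prems(1) True] in auto)
    then show ?thesis using p0 True by auto
  next
    case False
    then have "x \<in> - K" using assms by auto
    have "has_partial i ?g 0 x"
      by (rule has_partial_cong[OF oK \<open>x \<in> - K\<close>, of "\<lambda>x. 0"]) (auto intro: has_partial_const)
    then show ?thesis using \<open>x \<in> - K\<close> by auto
  qed
  show ?case
    by (rule Ck_on_SucI[OF _ _ p Suc.IH]) (use Suc.prems p0 c0 in auto)
qed

lemma iter_laplacian_zero_outside:
  assumes "open U" "closed K" "\<And>x. x \<in> U - K \<Longrightarrow> g x = 0" "x \<in> U - K"
  shows "iter_laplacian j g x = 0"
  using iter_laplacian_cong[of "U - K" g "\<lambda>x. 0" x j] assms by (simp add: open_Diff)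

text \<open>Green's second identity. Two closed sets are used because neither factor needs compact
  support by itself: a cutoff solution vanishes only near the hole and a kernel only far out.
  Compactness is asked of the intersection.\<close>

lemma integral_mult_laplacian:
  fixes a b :: "real^'n::finite \<Rightarrow> real"
  assumes U: "open U" and K: "closed K1" "closed K2" "compact (K1 \<inter> K2)" "K1 \<inter> K2 \<subseteq> U"
    and a: "Ck_on 2 U a" "\<And>x. x \<in> U - K1 \<Longrightarrow> a x = 0"
    and b: "Ck_on 2 U b" "\<And>x. x \<in> U - K2 \<Longrightarrow> b x = 0"
  shows "(LINT x:(K1 \<inter> K2)|lborel. b x * laplacian a x) = (LINT x:(K1 \<inter> K2)|lborel. a x * laplacian b x)"
proof -
  let ?K = "K1 \<inter> K2"
  define ext where "ext h x = (if x \<in> ?K then h x else 0)" for h :: "real^'n \<Rightarrow> real" and x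
  \<comment> \<open>The field with components \<open>w i\<close> has divergence
    \<open>b * laplacian a - a * laplacian b\<close>; extended by zero, each of its partial
    derivatives integrates to zero.\<close>
  define w where "w i x = b x * partial i a x - a x * partial i b x" for i x
  define w' where "w' i x = b x * partial i (partial i a) x - a x * partial i (partial i b) x" for i x
  have D: "Ck_on 1 U a" "Ck_on 1 U b" "Ck_on 1 U (partial i a)" "Ck_on 1 U (partial i b)" for i
    using a(1) b(1) by (auto simp: numeral_2_eq_2)
  have pz: "partial i g x = 0" if "x \<in> U - K'" "closed K'" "\<And>x. x \<in> U - K' \<Longrightarrow> g x = 0"
    for g K' i and x :: "real^'n"
    by (rule has_partial_imp_partial, rule has_partial_cong[of "U - K'" _ "\<lambda>x. 0"])
       (use that U in \<open>auto intro: has_partial_const\<close>)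
  have w1: "Ck_on 1 U (w i)" for i
    unfolding w_def by (intro Ck_on_diff Ck_on_mult U D)
  have pw: "partial i (w i) x = w' i x" if "x \<in> U" for i x
  proof (rule has_partial_imp_partial)
    have "has_partial i g (partial i g x) x" if "Ck_on 1 U g" for g
      using that \<open>x \<in> U\<close> by (metis Ck_on_has_partial One_nat_def)
    note h = this[OF D(1)] this[OF D(2)] this[OF D(3), of i] this[OF D(4), of i]
    have "has_partial i (w i) ((partial i b x * partial i a x + b x * partial i (partial i a) x) -
        (partial i a x * partial i b x + a x * partial i (partial i b) x)) x"
      unfolding w_def by (intro has_partial_diff has_partial_mult h)
    then show "has_partial i (w i) (w' i x) x" by (simp add: w'_def algebra_simps)
  qed
  have w0: "w i x = 0" if "x \<in> U - ?K" for i x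
    using that pz[of x K1 a i] pz[of x K2 b i] a(2) b(2) K unfolding w_def by (cases "x \<in> K1") auto
  have ext1: "Ck_on 1 UNIV (ext (w i))" for i
    unfolding ext_def
    by (rule Ck_on_zero_outside[OF U _ K(4) w1]) (use K w0 in auto)
  have pext: "has_partial i (ext (w i)) (ext (w' i) x) x" for i x
  proof -
    have *: "has_partial i (ext (w i)) (partial i (ext (w i)) x) x"
      using ext1[of i] Ck_on_has_partial[of 0 UNIV] by simp
    have "partial i (ext (w i)) x = ext (w' i) x"
    proof (cases "x \<in> U")
      case True
      have "partial i (ext (w i)) x = partial i (w i) x"
        by (rule partial_cong[OF U True]) (auto simp: ext_def w0)
      also have "\<dots> = ext (w' i) x"
        using pz[of x ?K "w i" i] w0 K True pw[OF True] by (auto simp: ext_def)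
      finally show ?thesis .
    next
      case False
      have "has_partial i (ext (w i)) 0 x"
        by (rule has_partial_cong[of "- ?K" _ "\<lambda>x. 0"])
           (use False K in \<open>auto simp: ext_def intro: has_partial_const\<close>)
      then show ?thesis using False K has_partial_imp_partial by (auto simp: ext_def)
    qed
    with * show ?thesis by simp
  qed
  have c': "continuous_on UNIV (ext (w' i))" for i
  proof -
    have "partial i (ext (w i)) = ext (w' i)"
      using has_partial_imp_partial[OF pext] by blast
    moreover have "Ck_on 1 UNIV (ext (w i))" by (rule ext1)
    ultimately show ?thesis by (metis Ck_on.simps One_nat_def)
  qed
  have ext0: "ext h x = 0" if "x \<notin> ?K" for h x using that by (auto simp: ext_def)
  have ext2: "ext h x = h x" if "x \<in> ?K" for h x using that by (auto simp: ext_def)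
  have I: "integrable lborel (ext (w' i))" "(LINT x|lborel. ext (w' i) x) = 0" for i
    by (rule integral_partial_compact_support[OF Ck_on_imp_continuous_on[OF ext1] c' pext K(3)];
        simp add: ext0)+
  have cont: "continuous_on ?K a" "continuous_on ?K b" "continuous_on ?K (laplacian a)" "continuous_on ?K (laplacian b)"
    using Ck_on_imp_continuous_on[OF a(1)] Ck_on_imp_continuous_on[OF b(1)]
      Ck_on_imp_continuous_on[OF Ck_on_laplacian[OF U, of 0 a]] Ck_on_imp_continuous_on[OF Ck_on_laplacian[OF U, of 0 b]]
      a(1) b(1) by (simp_all add: continuous_on_subset[OF _ K(4)] numeral_2_eq_2 del: Ck_on.simps)
  have S: "set_integrable lborel ?K (\<lambda>x. b x * laplacian a x)" "set_integrable lborel ?K (\<lambda>x. a x * laplacian b x)"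
    unfolding set_integrable_def by (intro borel_integrable_compact[OF K(3)] continuous_on_mult cont)+
  have "(LINT x:?K|lborel. b x * laplacian a x) - (LINT x:?K|lborel. a x * laplacian b x) =
      (LINT x:?K|lborel. b x * laplacian a x - a x * laplacian b x)"
    using S by (simp add: set_integral_diff)
  also have "\<dots> = (LINT x|lborel. (\<Sum>i\<in>UNIV. ext (w' i) x))"
    unfolding set_lebesgue_integral_def
  proof (intro Bochner_Integration.integral_cong refl)
    show "indicat_real ?K x *\<^sub>R (b x * laplacian a x - a x * laplacian b x) = (\<Sum>i\<in>UNIV. ext (w' i) x)" for x
      by (cases "x \<in> ?K") (simp_all add: ext0 ext2 w'_def laplacian_def sum_subtractf sum_distrib_left del: Int_iff)
  qed
  also have "\<dots> = 0" using I by simp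
  finally show ?thesis by simp
qed

text \<open>One Laplacian is moved at a time: the induction hypothesis handles the pair
  \<open>laplacian a\<close>, \<open>b\<close>, and Green's identity then moves the remaining
  Laplacian off \<open>a\<close> onto the k-fold Laplacian of \<open>b\<close>.\<close>

lemma integral_mult_iter_laplacian:
  fixes a b :: "real^'n::finite \<Rightarrow> real"
  assumes U: "open U" and K: "closed K1" "closed K2" "compact (K1 \<inter> K2)" "K1 \<inter> K2 \<subseteq> U"
    and "Ck_on (2 * k) U a" "\<And>x. x \<in> U - K1 \<Longrightarrow> a x = 0"
    and "Ck_on (2 * k) U b" "\<And>x. x \<in> U - K2 \<Longrightarrow> b x = 0"
  shows "(LINT x:(K1 \<inter> K2)|lborel. b x * iter_laplacian k a x) =
         (LINT x:(K1 \<inter> K2)|lborel. a x * iter_laplacian k b x)"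
  using assms(6-9)
proof (induction k arbitrary: a b)
  case 0
  then show ?case by (simp add: mult.commute)
next
  case (Suc k)
  have la: "Ck_on (2 * k) U (laplacian a)"
    using Ck_on_laplacian[OF U, of "2 * k" a] Suc.prems(1) by (simp del: Ck_on.simps)
  have b: "Ck_on (2 * k) U b"
    by (rule Ck_on_mono[OF Suc.prems(3)]) simp
  have lb: "Ck_on 2 U (iter_laplacian k b)"
    by (rule Ck_on_iter_laplacian[OF U]) (use Suc.prems(3) in \<open>simp del: Ck_on.simps\<close>)
  have a2: "Ck_on 2 U a" by (rule Ck_on_mono[OF Suc.prems(1)]) simp
  have la0: "laplacian a x = 0" if "x \<in> U - K1" for x
    using iter_laplacian_zero_outside[where j = 1 and g = a and K = K1 and U = U, OF U K(1) _ that]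
      Suc.prems(2) by (simp add: iter_laplacian_Suc)
  have lb0: "iter_laplacian k b x = 0" if "x \<in> U - K2" for x
    using iter_laplacian_zero_outside[where g = b and K = K2 and U = U, OF U K(2) _ that]
      Suc.prems(4) by simp
  have "(LINT x:(K1 \<inter> K2)|lborel. b x * iter_laplacian (Suc k) a x) =
        (LINT x:(K1 \<inter> K2)|lborel. laplacian a x * iter_laplacian k b x)"
    unfolding iter_laplacian_Suc' by (rule Suc.IH) (fact la la0 b Suc.prems(4))+
  also have "\<dots> = (LINT x:(K1 \<inter> K2)|lborel. iter_laplacian k b x * laplacian a x)"
    by (simp add: mult.commute)
  also have "\<dots> = (LINT x:(K1 \<inter> K2)|lborel. a x * laplacian (iter_laplacian k b) x)"
    by (rule integral_mult_laplacian[where U = U]) (fact U K a2 Suc.prems(2) lb lb0)+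
  finally show ?case by (simp add: iter_laplacian_Suc)
qed

section \<open>The radial Laplacian\<close>

text \<open>In dimension \<open>2 * M\<close> the Laplacian of \<open>h (norm x ^ 2)\<close> is \<open>4 * (s * h'' s + M * h' s)\<close>
  at \<open>s = norm x ^ 2\<close>.\<close>

definition rlap :: "real \<Rightarrow> real set \<Rightarrow> (real \<Rightarrow> real) \<Rightarrow> (real \<Rightarrow> real) \<Rightarrow> bool" where
  "rlap M S h k \<longleftrightarrow> (\<exists>h1 h2. \<forall>s\<in>S. (h has_real_derivative h1 s) (at s) \<and>
     (h1 has_real_derivative h2 s) (at s) \<and> k s = 4 * (s * h2 s + M * h1 s))"

text \<open>A relation rather than an operator: every intermediate function may be given by whatever
  closed formula is convenient on \<open>S\<close>, with no claim outside \<open>S\<close>.\<close>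

fun rlapn :: "real \<Rightarrow> real set \<Rightarrow> nat \<Rightarrow> (real \<Rightarrow> real) \<Rightarrow> (real \<Rightarrow> real) \<Rightarrow> bool" where
  "rlapn M S 0 h k \<longleftrightarrow> (\<forall>s\<in>S. h s = k s)"
| "rlapn M S (Suc j) h k \<longleftrightarrow> (\<exists>h'. rlap M S h h' \<and> rlapn M S j h' k)"

lemma rlapI:
  assumes "\<And>s. s \<in> S \<Longrightarrow> (h has_real_derivative h1 s) (at s)"
    "\<And>s. s \<in> S \<Longrightarrow> (h1 has_real_derivative h2 s) (at s)"
    "\<And>s. s \<in> S \<Longrightarrow> k s = 4 * (s * h2 s + M * h1 s)"
  shows "rlap M S h k"
  using assms unfolding rlap_def by blast

lemma rlap_add:
  assumes "rlap M S h k" "rlap M S h' k'"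
  shows "rlap M S (\<lambda>s. h s + h' s) (\<lambda>s. k s + k' s)"
proof -
  obtain h1 h2 where "\<forall>s\<in>S. (h has_real_derivative h1 s) (at s) \<and>
     (h1 has_real_derivative h2 s) (at s) \<and> k s = 4 * (s * h2 s + M * h1 s)"
    using assms(1) unfolding rlap_def by blast
  moreover obtain h1' h2' where "\<forall>s\<in>S. (h' has_real_derivative h1' s) (at s) \<and>
     (h1' has_real_derivative h2' s) (at s) \<and> k' s = 4 * (s * h2' s + M * h1' s)"
    using assms(2) unfolding rlap_def by blast
  ultimately show ?thesis
    by (intro rlapI[where ?h1.0 = "\<lambda>s. h1 s + h1' s" and ?h2.0 = "\<lambda>s. h2 s + h2' s"])
       (auto intro!: DERIV_add simp: distrib_left)
qed

lemma rlap_cmult: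
  assumes "rlap M S h k"
  shows "rlap M S (\<lambda>s. c * h s) (\<lambda>s. c * k s)"
proof -
  obtain h1 h2 where "\<forall>s\<in>S. (h has_real_derivative h1 s) (at s) \<and>
     (h1 has_real_derivative h2 s) (at s) \<and> k s = 4 * (s * h2 s + M * h1 s)"
    using assms(1) unfolding rlap_def by blast
  then show ?thesis
    by (intro rlapI[where ?h1.0 = "\<lambda>s. c * h1 s" and ?h2.0 = "\<lambda>s. c * h2 s"])
       (auto intro: DERIV_cmult simp: algebra_simps)
qed

text \<open>The operator has no term of order zero, so an additive constant is invisible to it. This
  allows \<open>kern\<close>, defined by an integral, to be replaced by an elementary
  antiderivative.\<close>

lemma rlap_same_deriv:
  assumes "\<And>s. s \<in> S \<Longrightarrow> \<exists>d. (h has_real_derivative d) (at s) \<and> (h' has_real_derivative d) (at s)"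
    and "rlap M S h k"
  shows "rlap M S h' k"
proof -
  obtain h1 h2 where h: "\<forall>s\<in>S. (h has_real_derivative h1 s) (at s) \<and>
     (h1 has_real_derivative h2 s) (at s) \<and> k s = 4 * (s * h2 s + M * h1 s)"
    using assms(2) unfolding rlap_def by blast
  moreover have "(h' has_real_derivative h1 s) (at s)" if "s \<in> S" for s
    using assms(1)[OF that] h that DERIV_unique by metis
  ultimately show ?thesis unfolding rlap_def by blast
qed

lemma rlap_cong:
  assumes "open S" "\<And>s. s \<in> S \<Longrightarrow> h s = h' s" "rlap M S h k"
  shows "rlap M S h' k"
proof -
  obtain h1 h2 where h: "\<forall>s\<in>S. (h has_real_derivative h1 s) (at s) \<and>
     (h1 has_real_derivative h2 s) (at s) \<and> k s = 4 * (s * h2 s + M * h1 s)"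
    using assms(3) unfolding rlap_def by blast
  moreover have "(h' has_real_derivative h1 s) (at s)" if "s \<in> S" for s
    by (rule has_field_derivative_transform_within_open[of h _ _ S]) (use assms h that in auto)
  ultimately show ?thesis unfolding rlap_def by blast
qed

lemma rlap_cong_right: "rlap M S h k \<Longrightarrow> (\<And>s. s \<in> S \<Longrightarrow> k s = k' s) \<Longrightarrow> rlap M S h k'"
  unfolding rlap_def by fastforce

lemma rlap_zero: "rlap M S (\<lambda>s. 0) (\<lambda>s. 0)"
  by (rule rlapI[where ?h1.0 = "\<lambda>s. 0" and ?h2.0 = "\<lambda>s. 0"]) auto

lemma rlap_sum:
  assumes "finite I" "\<And>i. i \<in> I \<Longrightarrow> rlap M S (h i) (k i)"
  shows "rlap M S (\<lambda>s. \<Sum>i\<in>I. c i * h i s) (\<lambda>s. \<Sum>i\<in>I. c i * k i s)"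
  using assms
proof (induction I rule: finite_induct)
  case (insert i I)
  then have "rlap M S (\<lambda>s. c i * h i s + (\<Sum>i\<in>I. c i * h i s)) (\<lambda>s. c i * k i s + (\<Sum>i\<in>I. c i * k i s))"
    by (intro rlap_add rlap_cmult) auto
  then show ?case using insert by simp
qed (simp add: rlap_zero)

lemma rlapn_add:
  "rlapn M S j h k \<Longrightarrow> rlapn M S j h' k' \<Longrightarrow> rlapn M S j (\<lambda>s. h s + h' s) (\<lambda>s. k s + k' s)"
proof (induction j arbitrary: h h')
  case (Suc j)
  obtain g where g: "rlap M S h g" "rlapn M S j g k" using Suc.prems(1) by auto
  obtain g' where g': "rlap M S h' g'" "rlapn M S j g' k'" using Suc.prems(2) by auto
  show ?case using rlap_add[OF g(1) g'(1)] Suc.IH[OF g(2) g'(2)] by auto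
qed auto

lemma rlapn_cmult:
  "rlapn M S j h k \<Longrightarrow> rlapn M S j (\<lambda>s. c * h s) (\<lambda>s. c * k s)"
proof (induction j arbitrary: h)
  case (Suc j)
  obtain g where g: "rlap M S h g" "rlapn M S j g k" using Suc.prems(1) by auto
  show ?case using rlap_cmult[OF g(1)] Suc.IH[OF g(2)] by auto
qed auto

lemma rlapn_zero: "rlapn M S j (\<lambda>s. 0) (\<lambda>s. 0)"
  using rlap_zero by (induction j) auto

lemma rlapn_sum:
  assumes "finite I" "\<And>i. i \<in> I \<Longrightarrow> rlapn M S j (h i) (k i)"
  shows "rlapn M S j (\<lambda>s. \<Sum>i\<in>I. c i * h i s) (\<lambda>s. \<Sum>i\<in>I. c i * k i s)"
  using assms
proof (induction I rule: finite_induct)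
  case (insert i I)
  then have "rlapn M S j (\<lambda>s. c i * h i s + (\<Sum>i\<in>I. c i * h i s)) (\<lambda>s. c i * k i s + (\<Sum>i\<in>I. c i * k i s))"
    by (intro rlapn_add rlapn_cmult) auto
  then show ?case using insert by simp
qed (simp add: rlapn_zero)

lemma rlapn_Suc_right:
  assumes "open S"
  shows "rlapn M S j h g \<Longrightarrow> rlap M S g k \<Longrightarrow> rlapn M S (Suc j) h k"
proof (induction j arbitrary: h)
  case 0
  then have "rlap M S h k" using rlap_cong[of S g h M k] assms by auto
  then show ?case by auto
next
  case (Suc j)
  then show ?case by (metis rlapn.simps(2))
qed

lemma rlapn_same_deriv:
  assumes "\<And>s. s \<in> S \<Longrightarrow> \<exists>d. (h has_real_derivative d) (at s) \<and> (h' has_real_derivative d) (at s)"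
    and "rlapn M S (Suc j) h k"
  shows "rlapn M S (Suc j) h' k"
proof -
  obtain g where "rlap M S h g" "rlapn M S j g k" using assms(2) by auto
  then have "rlap M S h' g" "rlapn M S j g k" using rlap_same_deriv[of S h h' M g] assms(1) by auto
  then show ?thesis by auto
qed

section \<open>Passage from radial profiles to functions on R^n\<close>

lemma has_partial_sq_dist:
  fixes x y :: "real^'n::finite"
  shows "has_partial i (\<lambda>x. c * (norm (x - y))\<^sup>2) (2 * c * (x - y) $ i) x"
proof -
  have "(norm (x + t *\<^sub>R axis i 1 - y))\<^sup>2 = (norm (x - y))\<^sup>2 + 2 * t * (x - y) $ i + t\<^sup>2" for t :: real
  proof -
    have "x + t *\<^sub>R axis i 1 - y = (x - y) + t *\<^sub>R axis i 1" by simp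
    then show ?thesis
      unfolding power2_norm_eq_inner
      by (simp add: inner_add_left inner_add_right inner_axis inner_axis' power2_eq_square algebra_simps)
  qed
  then show ?thesis unfolding has_partial_def
    by (simp only:) (auto intro!: derivative_eq_intros)
qed

lemma Ck_on_sq_dist:
  assumes "open U"
  shows "Ck_on k U (\<lambda>x::real^'n::finite. c * (norm (x - y))\<^sup>2)"
proof -
  have "(norm (x - y))\<^sup>2 = (\<Sum>i\<in>UNIV. (x $ i - y $ i) ^ 2)" for x
    unfolding power2_norm_eq_inner by (simp add: inner_vec_def power2_eq_square)
  then show ?thesis
    by (simp only:) (intro Ck_on_cmult Ck_on_sum Ck_on_power Ck_on_diff Ck_on_coord Ck_on_const assms finite)
qed

text \<open>With \<open>s = \<kappa> * |x - y|^2\<close> the sum of second partials is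
  \<open>4 * \<kappa>^2 * |x - y|^2 * h2 s + 2 * \<kappa> * n * h1 s\<close>, and n = 2M. Using the
  squared distance as the variable avoids any exception at \<open>x = y\<close>.\<close>

lemma laplacian_radial:
  fixes x y :: "real^'n::finite"
  assumes "open S" "rlap M S h k" "real CARD('n) = 2 * M" "\<kappa> * (norm (x - y))\<^sup>2 \<in> S"
  shows "laplacian (\<lambda>x. h (\<kappa> * (norm (x - y))\<^sup>2)) x = \<kappa> * k (\<kappa> * (norm (x - y))\<^sup>2)"
proof -
  define s where "s x = \<kappa> * (norm (x - y))\<^sup>2" for x
  define V where "V = {x. s x \<in> S}"
  have "continuous_on UNIV s" unfolding s_def by (intro continuous_intros)
  then have V: "open V" "x \<in> V"
    using assms(1,4) open_vimage[of S s] by (auto simp: V_def vimage_def s_def continuous_on_eq_continuous_at)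
  obtain h1 h2 where h: "\<And>s. s \<in> S \<Longrightarrow> (h has_real_derivative h1 s) (at s)"
     "\<And>s. s \<in> S \<Longrightarrow> (h1 has_real_derivative h2 s) (at s)" "\<And>s. s \<in> S \<Longrightarrow> k s = 4 * (s * h2 s + M * h1 s)"
    using assms(2) unfolding rlap_def by blast
  have ps: "has_partial i s (2 * \<kappa> * (x - y) $ i) x" for i x
    unfolding s_def by (rule has_partial_sq_dist)
  have p1: "partial i (\<lambda>x. h (s x)) z = h1 (s z) * (2 * \<kappa> * (z - y) $ i)" if "z \<in> V" for i z
    by (rule has_partial_imp_partial, rule has_partial_chain[OF h(1) ps]) (use that in \<open>simp add: V_def\<close>)
  have p2: "partial i (partial i (\<lambda>x. h (s x))) x =
      h2 (s x) * (2 * \<kappa> * (x - y) $ i)\<^sup>2 + h1 (s x) * (2 * \<kappa>)" for i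
  proof -
    have c: "has_partial i (\<lambda>z. 2 * \<kappa> * (z - y) $ i) (2 * \<kappa>) x"
      unfolding has_partial_def by (auto intro!: derivative_eq_intros simp: axis_def)
    have "has_partial i (\<lambda>x. h1 (s x)) (h2 (s x) * (2 * \<kappa> * (x - y) $ i)) x"
      by (rule has_partial_chain[OF h(2) ps]) (use V(2) in \<open>simp add: V_def\<close>)
    from has_partial_mult[OF this c]
    have *: "has_partial i (\<lambda>z. h1 (s z) * (2 * \<kappa> * (z - y) $ i))
        (h2 (s x) * (2 * \<kappa> * (x - y) $ i)\<^sup>2 + h1 (s x) * (2 * \<kappa>)) x"
      by (simp add: power2_eq_square algebra_simps)
    show ?thesis
      by (rule has_partial_imp_partial, rule has_partial_cong[OF V _ *]) (simp add: p1)
  qed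
  have n: "(\<Sum>i\<in>UNIV. ((x - y) $ i)\<^sup>2) = (norm (x - y))\<^sup>2"
    unfolding power2_norm_eq_inner by (simp add: inner_vec_def power2_eq_square)
  have "laplacian (\<lambda>x. h (s x)) x = (\<Sum>i\<in>UNIV. h2 (s x) * (2 * \<kappa>)\<^sup>2 * ((x - y) $ i)\<^sup>2 + h1 (s x) * (2 * \<kappa>))"
    unfolding laplacian_def p2 by (simp add: power_mult_distrib mult.assoc)
  also have "\<dots> = h2 (s x) * (2 * \<kappa>)\<^sup>2 * (norm (x - y))\<^sup>2 + real CARD('n) * (h1 (s x) * (2 * \<kappa>))"
    by (simp add: sum.distrib sum_distrib_left[symmetric] n[simplified])
  also have "\<dots> = \<kappa> * k (s x)"
    using h(3)[of "s x"] assms(4) by (simp add: assms(3) s_def power2_eq_square algebra_simps)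
  finally show ?thesis by (simp add: s_def)
qed

lemma iter_laplacian_radial:
  fixes x y :: "real^'n::finite"
  assumes S: "open S" and M: "real CARD('n) = 2 * M"
    and "rlapn M S j h k" "\<kappa> * (norm (x - y))\<^sup>2 \<in> S"
  shows "iter_laplacian j (\<lambda>x. h (\<kappa> * (norm (x - y))\<^sup>2)) x = \<kappa> ^ j * k (\<kappa> * (norm (x - y))\<^sup>2)"
proof -
  \<comment> \<open>Each Laplacian releases a factor \<open>\<kappa>\<close>; the free constant
    \<open>c\<close> lets the induction carry it along.\<close>
  have "iter_laplacian j (\<lambda>x. c * h (\<kappa> * (norm (x - y))\<^sup>2)) x = c * \<kappa> ^ j * k (\<kappa> * (norm (x - y))\<^sup>2)" for c
    using assms(3)
  proof (induction j arbitrary: h c)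
    case 0
    then show ?case using assms(4) by simp
  next
    case (Suc j)
    obtain g where g: "rlap M S h g" "rlapn M S j g k" using Suc.prems by auto
    define V where "V = {x. \<kappa> * (norm (x - y))\<^sup>2 \<in> S}"
    have "continuous_on UNIV (\<lambda>x. \<kappa> * (norm (x - y))\<^sup>2)" by (intro continuous_intros)
    then have V: "open V" "x \<in> V"
      using assms(1,4) open_vimage[of S "\<lambda>x. \<kappa> * (norm (x - y))\<^sup>2"]
      by (auto simp: V_def vimage_def continuous_on_eq_continuous_at)
    have "iter_laplacian (Suc j) (\<lambda>x. c * h (\<kappa> * (norm (x - y))\<^sup>2)) x =
        iter_laplacian j (\<lambda>x. (c * \<kappa>) * g (\<kappa> * (norm (x - y))\<^sup>2)) x"
      unfolding iter_laplacian_Suc'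
    proof (rule iter_laplacian_cong[OF V(1) _ V(2)])
      fix z assume "z \<in> V"
      then show "laplacian (\<lambda>x. c * h (\<kappa> * (norm (x - y))\<^sup>2)) z = c * \<kappa> * g (\<kappa> * (norm (z - y))\<^sup>2)"
        using laplacian_radial[OF S rlap_cmult[OF g(1), of c] M, of \<kappa> z y] by (simp add: V_def mult.commute)
    qed
    also have "\<dots> = c * \<kappa> * \<kappa> ^ j * k (\<kappa> * (norm (x - y))\<^sup>2)"
      by (rule Suc.IH[OF g(2)])
    finally show ?case by (simp add: mult.assoc)
  qed
  from this[of 1] show ?thesis by simp
qed

section \<open>Radial Laplacians of powers and of the logarithm\<close>

text \<open>Writing the factor \<open>s\<close> of the operator as \<open>(s + e) - e\<close> keeps
  the family of powers of \<open>s + e\<close> closed under it; negative powers and the logarithm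
  are treated alike. The truncated exponents \<open>i - 1\<close> and \<open>i - 2\<close> do no
  harm, as their coefficients vanish whenever truncation occurs.\<close>

lemma rlap_power:
  "rlap M S (\<lambda>s. (s + e) ^ i)
    (\<lambda>s. 4 * real i * ((real i - 1 + M) * (s + e) ^ (i - 1) - (real i - 1) * e * (s + e) ^ (i - 2)))"
proof (rule rlapI)
  show "((\<lambda>s. (s + e) ^ i) has_real_derivative real i * (s + e) ^ (i - 1)) (at s)" for s
    by (auto intro!: derivative_eq_intros)
  show "((\<lambda>s. real i * (s + e) ^ (i - 1)) has_real_derivative real i * (real i - 1) * (s + e) ^ (i - 2)) (at s)" for s
    by (cases i) (auto intro!: derivative_eq_intros simp: numeral_2_eq_2)
  fix s
  consider "i = 0" | "i = 1" | j where "i = j + 2"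
    by (metis One_nat_def add_2_eq_Suc' not0_implies_Suc)
  then show "4 * real i * ((real i - 1 + M) * (s + e) ^ (i - 1) - (real i - 1) * e * (s + e) ^ (i - 2)) =
    4 * (s * (real i * (real i - 1) * (s + e) ^ (i - 2)) + M * (real i * (s + e) ^ (i - 1)))"
    by cases (auto simp: algebra_simps)
qed

lemma rlap_inverse_power:
  assumes "\<And>s. s \<in> S \<Longrightarrow> s + e > 0"
  shows "rlap M S (\<lambda>s. inverse (s + e) ^ p)
    (\<lambda>s. 4 * real p * ((real p + 1 - M) * inverse (s + e) ^ (p + 1) - (real p + 1) * e * inverse (s + e) ^ (p + 2)))"
proof (rule rlapI)
  have D: "((\<lambda>s. inverse (s + e) ^ q) has_real_derivative - real q * inverse (s + e) ^ (q + 1)) (at s)"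
    if "s \<in> S" for q s
  proof -
    have "((\<lambda>s. inverse (s + e)) has_real_derivative - (inverse (s + e) ^ 2)) (at s)"
      using assms[OF that] by (auto intro!: derivative_eq_intros simp: power2_eq_square)
    from DERIV_power[OF this, of q] show ?thesis
      by (cases q) (simp_all add: power2_eq_square algebra_simps)
  qed
  show "((\<lambda>s. inverse (s + e) ^ p) has_real_derivative - real p * inverse (s + e) ^ (p + 1)) (at s)" if "s \<in> S" for s
    by (rule D[OF that])
  show "((\<lambda>s. - real p * inverse (s + e) ^ (p + 1)) has_real_derivative
      real p * (real p + 1) * inverse (s + e) ^ (p + 2)) (at s)" if "s \<in> S" for s
    using DERIV_cmult[OF D[OF that, of "p + 1"], of "- real p"] by (simp add: algebra_simps)
  fix s assume "s \<in> S"
  then have "s + e \<noteq> 0" using assms[of s] by auto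
  then have 1: "(s + e) * inverse (s + e) = 1" by simp
  have aux1: "(s + e) * r = 1 \<Longrightarrow> s * (P * (r * r)) = P * r - e * (P * (r * r))" for r P :: real
    by algebra
  have 2: "s * inverse (s + e) ^ (p + 2) = inverse (s + e) ^ (p + 1) - e * inverse (s + e) ^ (p + 2)"
    unfolding power_add power_one_right power2_eq_square by (rule aux1[OF 1])
  have aux2: "s * w = u - e * w \<Longrightarrow> 4 * P * ((P + 1 - M) * u - (P + 1) * e * w) =
      4 * (s * (P * (P + 1) * w) + M * (- P * u))" for u w P :: real
    by algebra
  show "4 * real p * ((real p + 1 - M) * inverse (s + e) ^ (p + 1) - (real p + 1) * e * inverse (s + e) ^ (p + 2)) =
    4 * (s * (real p * (real p + 1) * inverse (s + e) ^ (p + 2)) + M * (- real p * inverse (s + e) ^ (p + 1)))"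
    by (rule aux2[OF 2])
qed

lemma rlap_ln:
  assumes "\<And>s. s \<in> S \<Longrightarrow> s + e > 0"
  shows "rlap M S (\<lambda>s. ln (s + e)) (\<lambda>s. 4 * ((M - 1) * inverse (s + e) + e * inverse (s + e) ^ 2))"
proof (rule rlapI)
  show "((\<lambda>s. ln (s + e)) has_real_derivative inverse (s + e)) (at s)" if "s \<in> S" for s
    using assms[OF that] by (auto intro!: derivative_eq_intros simp: field_simps)
  show "((\<lambda>s. inverse (s + e)) has_real_derivative - (inverse (s + e) ^ 2)) (at s)" if "s \<in> S" for s
    using assms[OF that] by (auto intro!: derivative_eq_intros simp: field_simps power2_eq_square)
  fix s assume "s \<in> S"
  then have "s + e \<noteq> 0" using assms[of s] by auto
  then have "(s + e) * inverse (s + e) = 1" by simp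
  then have "s * inverse (s + e) ^ 2 = inverse (s + e) - e * inverse (s + e) ^ 2"
    unfolding power2_eq_square by algebra
  then show "4 * ((M - 1) * inverse (s + e) + e * inverse (s + e) ^ 2) =
    4 * (s * - (inverse (s + e) ^ 2) + M * inverse (s + e))"
    by algebra
qed

text \<open>The coefficient of \<open>e ^ i * (s + e) ^ (- j - i)\<close> in the \<open>j\<close>-fold radial Laplacian of
  \<open>ln (s + e)\<close>.\<close>

definition lnc :: "real \<Rightarrow> nat \<Rightarrow> nat \<Rightarrow> real" where
  "lnc M j i = (- 1) ^ (j + 1) * 4 ^ j * real (j choose i) * fact (j + i - 1) * (\<Prod>l=i..<j. M - 1 - real l)"

text \<open>The recurrence imposed by \<open>rlap_inverse_power\<close>: the power of
  \<open>inverse (s + e)\<close> rises by one with the same power of \<open>e\<close>, or by two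
  with one more factor \<open>e\<close>. The bound \<open>1 \<le> j\<close> keeps the truncated
  \<open>j + i - 1\<close> in the factorial honest.\<close>

lemma lnc_Suc:
  assumes "j \<ge> 1" "i \<le> Suc j"
  shows "lnc M (Suc j) i = 4 * lnc M j i * real (j + i) * (real (j + i) + 1 - M)
    - (if i = 0 then 0 else 4 * lnc M j (i - 1) * real (j + i - 1) * real (j + i))"
proof -
  have "i = 0 \<or> i = Suc j \<or> (\<exists>l. i = Suc l \<and> l < j)" using assms by (cases i) auto
  then consider "i = 0" | "i = Suc j" | l where "i = Suc l" "l < j" by blast
  then show ?thesis
  proof cases
    case 1
    obtain p where "j = Suc p" using assms by (cases j) auto
    then show ?thesis using 1 unfolding lnc_def by (simp add: algebra_simps)
  next
    case 2
    obtain p where "j = Suc p" using assms by (cases j) auto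
    moreover have "lnc M j (Suc j) = 0" by (simp add: lnc_def binomial_eq_0)
    ultimately show ?thesis using 2 by simp (simp add: lnc_def binomial_eq_0 algebra_simps)
  next
    case 3
    obtain p where p: "j = Suc p" using assms by (cases j) auto
    define P where "P = (\<Prod>l=i..<j. M - 1 - real l)"
    define F where "F = (fact (j + l - 1) :: real)"
    define K where "K = (- 1 :: real) ^ j * 4 ^ j"
    have P1: "(\<Prod>l=i..<Suc j. M - 1 - real l) = P * (M - 1 - real j)"
      using 3 by (simp add: P_def)
    have P2: "(\<Prod>l=l..<j. M - 1 - real l) = (M - 1 - real l) * P"
      using 3 by (simp add: P_def prod.atLeast_Suc_lessThan)
    have F1: "fact (j + i - 1) = real (j + l) * F" "fact (Suc j + i - 1) = real (j + i) * real (j + l) * F"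
      using 3 p by (simp_all add: F_def)
    \<comment> \<open>Once the common factors are removed, this relation between neighbouring
      binomials is all that the recurrence amounts to.\<close>
    have "Suc l * (j choose Suc l) = (j - l) * (j choose l)"
      by (simp only: binomial_absorb_comp binomial_absorption)
    then have "real (Suc l * (j choose Suc l)) = real ((j - l) * (j choose l))" by (rule arg_cong)
    moreover have "real (j - l) = real j - real l" using 3 by (simp add: of_nat_diff)
    ultimately have b: "real i * real (j choose i) = (real j - real l) * real (j choose l)"
      unfolding 3(1) by (simp only: of_nat_mult)
    have c: "real (Suc j choose i) = real (j choose i) + real (j choose l)"
      unfolding 3(1) by (simp only: binomial_Suc_Suc of_nat_add)
    have i: "real i = real l + 1" "i - 1 = l" "i \<noteq> 0" "real (j + i - 1) = real (j + l)" using 3 by auto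
    have L: "lnc M (Suc j) i = 4 * K * (real (j choose i) + real (j choose l)) * (real (j + i) * real (j + l) * F) * (P * (M - 1 - real j))"
      unfolding lnc_def P1 F1 c K_def by simp
    have R1: "lnc M j i = - K * real (j choose i) * (real (j + l) * F) * P"
      unfolding lnc_def F1 K_def P_def by simp
    have R2: "lnc M j (i - 1) = - K * real (j choose l) * F * ((M - 1 - real l) * P)"
      unfolding lnc_def i P2 K_def F_def by simp
    have alg: "4 * K * (x + y) * (a * c * F) * (P * (M - 1 - j')) =
        4 * (- K * x * (c * F) * P) * a * (j' + (l' + 1) + 1 - M) - 4 * (- K * y * F * ((M - 1 - l') * P)) * c * a"
      if "(l' + 1) * x = (j' - l') * y" for x y a c j' l' :: real
    proof -
      have *: "(x + y) * (M - 1 - j') = z * y - x * w"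
        if "w = j' + (l' + 1) + 1 - M" "z = M - 1 - l'" for w z
      proof -
        have "(x + y) * (M - 1 - j') - (z * y - x * w) = (l' + 1) * x - (j' - l') * y"
          unfolding that by (simp add: algebra_simps)
        then show ?thesis using \<open>(l' + 1) * x = (j' - l') * y\<close> by linarith
      qed
      have **: "4 * (- K * x * (c * F) * P) * a * w - 4 * (- K * y * F * (z * P)) * c * a =
          4 * K * F * P * a * c * (z * y - x * w)" for w z
      proof -
        have "4 * (- K * x * (c * F) * P) * a * w = - (4 * K * F * P * a * c * (x * w))"
          by (simp only: mult_minus_left mult_minus_right mult_ac)
        moreover have "4 * (- K * y * F * (z * P)) * c * a = - (4 * K * F * P * a * c * (z * y))"
          by (simp only: mult_minus_left mult_minus_right mult_ac)
        ultimately show ?thesis unfolding right_diff_distrib by linarith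
      qed
      show ?thesis unfolding ** *[OF refl refl, symmetric] by (simp only: mult_ac)
    qed
    have "real (j + i) + 1 - M = real j + (real l + 1) + 1 - M" using i by simp
    then show ?thesis
      unfolding L R1 R2 using alg[OF b[unfolded i(1)], of "real (j + i)" "real (j + l)"] i(3,4)
      by (simp only: if_False)
  qed
qed

lemma rlapn_ln:
  assumes S: "open S" "\<And>s. s \<in> S \<Longrightarrow> s + e > 0"
  shows "rlapn M S (Suc j) (\<lambda>s. ln (s + e))
    (\<lambda>s. \<Sum>i\<le>Suc j. (lnc M (Suc j) i * e ^ i) * inverse (s + e) ^ (Suc j + i))"
proof (induction j)
  case 0
  have "rlap M S (\<lambda>s. ln (s + e)) (\<lambda>s. \<Sum>i\<le>Suc 0. (lnc M (Suc 0) i * e ^ i) * inverse (s + e) ^ (Suc 0 + i))"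
    by (rule rlap_cong_right[OF rlap_ln[OF S(2)]]) (simp_all add: lnc_def algebra_simps power2_eq_square)
  then show ?case by auto
next
  case (Suc j)
  let ?J = "Suc j"
  define X where "X i = 4 * lnc M ?J i * real (?J + i) * (real (?J + i) + 1 - M)" for i
  define Y where "Y i = 4 * lnc M ?J i * real (?J + i) * (real (?J + i) + 1)" for i
  define r where "r s = inverse (s + e)" for s
  have "rlap M S (\<lambda>s. \<Sum>i\<le>?J. (lnc M ?J i * e ^ i) * inverse (s + e) ^ (?J + i))
    (\<lambda>s. \<Sum>i\<le>?J. (lnc M ?J i * e ^ i) * (4 * real (?J + i) * ((real (?J + i) + 1 - M) * inverse (s + e) ^ (?J + i + 1)
         - (real (?J + i) + 1) * e * inverse (s + e) ^ (?J + i + 2))))"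
    by (rule rlap_sum[OF finite_atMost]) (rule rlap_inverse_power, rule S(2))
  moreover have "(\<Sum>i\<le>?J. (lnc M ?J i * e ^ i) * (4 * real (?J + i) * ((real (?J + i) + 1 - M) * r s ^ (?J + i + 1)
         - (real (?J + i) + 1) * e * r s ^ (?J + i + 2)))) =
      (\<Sum>i\<le>Suc ?J. (lnc M (Suc ?J) i * e ^ i) * r s ^ (Suc ?J + i))" for s
  proof -
    have "(\<Sum>i\<le>?J. (lnc M ?J i * e ^ i) * (4 * real (?J + i) * ((real (?J + i) + 1 - M) * r s ^ (?J + i + 1)
         - (real (?J + i) + 1) * e * r s ^ (?J + i + 2)))) =
      (\<Sum>i\<le>?J. X i * (e ^ i * r s ^ (Suc ?J + i))) - (\<Sum>i\<le>?J. Y i * (e ^ Suc i * r s ^ (Suc ?J + Suc i)))"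
      unfolding sum_subtractf[symmetric] X_def Y_def
      by (intro sum.cong refl) (simp add: algebra_simps)
    \<comment> \<open>The added top term is zero, because its binomial coefficient is; the other sum
      is shifted by one index, so that both run over the same range.\<close>
    also have "(\<Sum>i\<le>?J. X i * (e ^ i * r s ^ (Suc ?J + i))) = (\<Sum>i\<le>Suc ?J. X i * (e ^ i * r s ^ (Suc ?J + i)))"
      by (simp add: X_def lnc_def binomial_eq_0)
    also have "(\<Sum>i\<le>?J. Y i * (e ^ Suc i * r s ^ (Suc ?J + Suc i))) =
       (\<Sum>i\<le>Suc ?J. (if i = 0 then 0 else Y (i - 1)) * (e ^ i * r s ^ (Suc ?J + i)))"
      by (subst sum.atMost_Suc_shift) simp
    finally show ?thesis
      unfolding sum_subtractf[symmetric]
      by (simp only:, intro sum.cong refl) (simp only: lnc_Suc X_def Y_def le_SucI atMost_iff, auto simp: algebra_simps)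
  qed
  ultimately have "rlap M S (\<lambda>s. \<Sum>i\<le>?J. (lnc M ?J i * e ^ i) * inverse (s + e) ^ (?J + i))
    (\<lambda>s. \<Sum>i\<le>Suc ?J. (lnc M (Suc ?J) i * e ^ i) * inverse (s + e) ^ (Suc ?J + i))"
    unfolding r_def by simp
  from rlapn_Suc_right[OF S(1) Suc this] show ?case .
qed

text \<open>The bubble: in dimension \<open>2 m\<close> only the last term of the sum survives.\<close>
lemma rlapn_ln_critical:
  assumes S: "open S" "\<And>s. s \<in> S \<Longrightarrow> s + e > 0" and m: "odd m"
  shows "rlapn (real m) S m (\<lambda>s. ln (s + e)) (\<lambda>s. 4 ^ m * fact (2 * m - 1) * e ^ m * inverse (s + e) ^ (2 * m))"
proof -
  obtain j where j: "m = Suc j" using m by (cases m) auto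
  \<comment> \<open>For \<open>M = m\<close> the product contains the factor with
    \<open>l = m - 1\<close>, which is zero. This is the criticality n = 2m, where the logarithm is
    polyharmonic away from its pole.\<close>
  have z: "lnc (real m) m i = 0" if "i < m" for i
  proof -
    have "(\<Prod>l=i..<m. real m - 1 - real l) = 0"
      using that j by (intro prod_zero) (auto intro!: bexI[of _ j])
    then show ?thesis by (simp add: lnc_def)
  qed
  have "(\<Sum>i\<le>m. (lnc (real m) m i * e ^ i) * inverse (s + e) ^ (m + i)) =
      4 ^ m * fact (2 * m - 1) * e ^ m * inverse (s + e) ^ (2 * m)" for s
  proof -
    have "(\<Sum>i\<le>m. (lnc (real m) m i * e ^ i) * inverse (s + e) ^ (m + i)) =
       (\<Sum>i\<in>{m}. (lnc (real m) m i * e ^ i) * inverse (s + e) ^ (m + i))"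
      by (rule sum.mono_neutral_right) (auto simp: z)
    also have "\<dots> = 4 ^ m * fact (2 * m - 1) * e ^ m * inverse (s + e) ^ (2 * m)"
      using m by (simp add: lnc_def mult_2)
    finally show ?thesis .
  qed
  then show ?thesis using rlapn_ln[OF S, of "real m" j] by (simp only: j[symmetric])
qed

text \<open>The constant has to be independent of \<open>e\<close>, since \<open>e\<close> will be
  chosen according to the solution. Induction on \<open>j\<close> only lowers the exponent, with
  coefficients bounded for \<open>e\<close> in the unit interval.\<close>

lemma rlapn_power_bound:
  assumes "M \<ge> 0"
  shows "\<exists>C\<ge>0. \<forall>S. \<forall>e\<in>{0..1}. \<exists>k. rlapn M S j (\<lambda>s. (s + e) ^ i) k \<and> (\<forall>s\<in>{0..1}. \<bar>k s\<bar> \<le> C)"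
proof (induction j arbitrary: i)
  case 0
  have "\<bar>(s + e) ^ i\<bar> \<le> 2 ^ i" if "e \<in> {0..1}" "s \<in> {0..1}" for s e :: real
    using that by (auto simp: power_abs intro!: power_mono)
  then show ?case by (intro exI[of _ "2 ^ i"]) (auto intro!: exI[of _ "\<lambda>s. (s + _) ^ i"])
next
  case (Suc j)
  obtain C1 where C1: "C1 \<ge> 0" "\<And>S e. e \<in> {0..1} \<Longrightarrow> \<exists>k. rlapn M S j (\<lambda>s. (s + e) ^ (i - 1)) k \<and> (\<forall>s\<in>{0..1}. \<bar>k s\<bar> \<le> C1)"
    using Suc.IH[of "i - 1"] by blast
  obtain C2 where C2: "C2 \<ge> 0" "\<And>S e. e \<in> {0..1} \<Longrightarrow> \<exists>k. rlapn M S j (\<lambda>s. (s + e) ^ (i - 2)) k \<and> (\<forall>s\<in>{0..1}. \<bar>k s\<bar> \<le> C2)"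
    using Suc.IH[of "i - 2"] by blast
  define A B where "A = 4 * real i * (real i - 1 + M)" and "B = 4 * real i * (real i - 1)"
  have "\<exists>k. rlapn M S (Suc j) (\<lambda>s. (s + e) ^ i) k \<and> (\<forall>s\<in>{0..1}. \<bar>k s\<bar> \<le> \<bar>A\<bar> * C1 + \<bar>B\<bar> * C2)"
    if e: "e \<in> {0..1}" for S e
  proof -
    obtain k1 where k1: "rlapn M S j (\<lambda>s. (s + e) ^ (i - 1)) k1" "\<And>s. s \<in> {0..1} \<Longrightarrow> \<bar>k1 s\<bar> \<le> C1"
      using C1(2)[OF e] by blast
    obtain k2 where k2: "rlapn M S j (\<lambda>s. (s + e) ^ (i - 2)) k2" "\<And>s. s \<in> {0..1} \<Longrightarrow> \<bar>k2 s\<bar> \<le> C2"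
      using C2(2)[OF e] by blast
    have "rlap M S (\<lambda>s. (s + e) ^ i) (\<lambda>s. A * (s + e) ^ (i - 1) + (- B * e) * (s + e) ^ (i - 2))"
      by (rule rlap_cong_right[OF rlap_power]) (simp add: A_def B_def algebra_simps)
    moreover have "rlapn M S j (\<lambda>s. A * (s + e) ^ (i - 1) + (- B * e) * (s + e) ^ (i - 2)) (\<lambda>s. A * k1 s + (- B * e) * k2 s)"
      by (intro rlapn_add rlapn_cmult k1 k2)
    moreover have "\<bar>A * k1 s + (- B * e) * k2 s\<bar> \<le> \<bar>A\<bar> * C1 + \<bar>B\<bar> * C2" if "s \<in> {0..1}" for s
    proof -
      have "\<bar>e * k2 s\<bar> \<le> 1 * C2" unfolding abs_mult using k2(2)[OF that] e by (intro mult_mono) auto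
      then have "\<bar>B\<bar> * \<bar>e * k2 s\<bar> \<le> \<bar>B\<bar> * C2" by (intro mult_left_mono) auto
      moreover have "\<bar>A\<bar> * \<bar>k1 s\<bar> \<le> \<bar>A\<bar> * C1" using k1(2)[OF that] by (intro mult_left_mono) auto
      moreover have "\<bar>A * k1 s + (- B * e) * k2 s\<bar> \<le> \<bar>A\<bar> * \<bar>k1 s\<bar> + \<bar>B\<bar> * \<bar>e * k2 s\<bar>"
        using abs_triangle_ineq[of "A * k1 s" "(- B * e) * k2 s"] by (simp add: abs_mult)
      ultimately show ?thesis by linarith
    qed
    ultimately show ?thesis by auto
  qed
  moreover have "\<bar>A\<bar> * C1 + \<bar>B\<bar> * C2 \<ge> 0" using C1(1) C2(1) by auto
  ultimately show ?case by blast
qed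

text \<open>For \<open>s\<close> beyond \<open>b\<close> the interval is empty and the integral is 0
  by convention, which agrees with \<open>q\<close> vanishing there. Hence a single formula for the
  derivative holds on all of \<open>{lo<..}\<close>, also at \<open>b\<close>.\<close>

lemma tail_integral_has_derivative:
  fixes q :: "real \<Rightarrow> real"
  assumes q: "continuous_on {lo<..} q" and lo: "lo < b" and q0: "\<And>s. s \<ge> b \<Longrightarrow> q s = 0" and s: "s > lo"
  shows "((\<lambda>s. integral {s..b} q) has_real_derivative - q s) (at s)"
proof -
  define c where "c = (lo + min s b) / 2"
  have c: "lo < c" "c < s" "c < b" using lo s by (auto simp: c_def)
  have qi: "q integrable_on {u..w}" if "u \<ge> c" for u w
    by (rule integrable_continuous_real) (use q c that in \<open>auto intro: continuous_on_subset\<close>)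
  have eq: "integral {t..b} q = integral {c..b} q - integral {c..t} q" if "t > c" for t
  proof (cases "t \<le> b")
    case True
    then show ?thesis
      using Henstock_Kurzweil_Integration.integral_combine[of c t b q] that qi by simp
  next
    case False
    have "integral {b..t} q = 0"
      using integral_cong[of "{b..t}" q "\<lambda>_. 0"] q0 by simp
    then show ?thesis
      using Henstock_Kurzweil_Integration.integral_combine[of c b t q] c False qi by simp
  qed
  have "((\<lambda>t. integral {c..t} q) has_real_derivative q s) (at s within {c..s + 1})"
    by (rule integral_has_real_derivative) (use c q in \<open>auto intro: continuous_on_subset\<close>)
  then have "((\<lambda>t. integral {c..t} q) has_real_derivative q s) (at s)"
    using c by (subst (asm) at_within_interior) auto
  then have "((\<lambda>t. integral {c..b} q - integral {c..t} q) has_real_derivative 0 - q s) (at s)"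
    by (intro DERIV_diff DERIV_const)
  then show ?thesis
    using has_field_derivative_transform_within_open[of "\<lambda>t. integral {c..b} q - integral {c..t} q" "- q s" s "{c<..}" "\<lambda>s. integral {s..b} q"] eq c
    by auto
qed

section \<open>The two test kernels\<close>

text \<open>Prescribing only the derivative \<open>- (1 - t)\<^sup>2\<^sup>m r(t)\<close> makes the kernel vanish for \<open>s \<ge> 1\<close>
  to the order needed for \<open>C\<^sup>2\<^sup>m\<close>. The choice \<open>r t = t ^ (- m)\<close> gives a weight comparable to
  \<open>s ^ (1 - m)\<close> with nonnegative \<open>m\<close>-fold Laplacian, the choice \<open>r t = 1 / (t + e)\<close> a
  regularised logarithm.\<close>

definition kern :: "nat \<Rightarrow> (real \<Rightarrow> real) \<Rightarrow> real \<Rightarrow> real" where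
  "kern m r s = integral {s..1} (\<lambda>t. max 0 (1 - t) ^ (2 * m) * r t)"

lemma kern_has_derivative:
  assumes "continuous_on {lo<..} r" "lo < 1" "lo < s" "m \<ge> 1"
  shows "(kern m r has_real_derivative - (max 0 (1 - s) ^ (2 * m) * r s)) (at s)"
  unfolding kern_def [abs_def]
  by (rule tail_integral_has_derivative[of lo]) (use assms in \<open>auto intro!: continuous_intros simp: max_absorb1\<close>)

lemma kern_eq_0: "s \<ge> 1 \<Longrightarrow> kern m r s = 0"
  by (cases "s = 1") (auto simp: kern_def)

lemma kern_antimono:
  assumes "continuous_on {lo<..} r" "lo < 1" "lo < s" "s \<le> t" "m \<ge> 1" "\<And>t. t > lo \<Longrightarrow> r t \<ge> 0"
  shows "kern m r t \<le> kern m r s"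
proof (rule DERIV_nonpos_imp_nonincreasing[OF assms(4)])
  fix x assume "s \<le> x" "x \<le> t"
  then show "\<exists>y. (kern m r has_real_derivative y) (at x) \<and> y \<le> 0"
    using assms by (intro exI[of _ "- (max 0 (1 - x) ^ (2 * m) * r x)"] conjI kern_has_derivative[of lo]) auto
qed

lemma kern_nonneg:
  assumes "continuous_on {lo<..} r" "lo < 1" "lo < s" "m \<ge> 1" "\<And>t. t > lo \<Longrightarrow> r t \<ge> 0"
  shows "kern m r s \<ge> 0"
  using kern_antimono[of lo r s "max s 1" m] kern_eq_0[of "max s 1" m r] assms by auto

text \<open>The derivative of \<open>kern\<close> is explicit and of class C^(2m-1), both at the
  outer edge and in \<open>r\<close>; integrating gains the last order.\<close>

lemma Ck_on_kern:
  fixes U :: "(real^'n::finite) set"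
  assumes U: "open U" and r: "continuous_on {lo<..} r" "lo < 1" "m \<ge> 1"
    and s: "Ck_on (2 * m) U s" "\<And>x. x \<in> U \<Longrightarrow> s x > lo"
    and rs: "Ck_on (2 * m - 1) U (\<lambda>x. r (s x))"
  shows "Ck_on (2 * m) U (\<lambda>x. kern m r (s x))"
proof -
  obtain j where j: "2 * m = Suc j" using r(3) by (metis Suc_pred' mult_pos_pos zero_less_numeral less_le_trans zero_less_one)
  have p: "has_partial i (\<lambda>x. kern m r (s x)) ((- 1 * (max 0 (1 - s x) ^ (2 * m) * r (s x))) * partial i s x) x"
    if "x \<in> U" for i x
    using has_partial_chain[OF kern_has_derivative[OF r(1,2) s(2)[OF that] r(3)]
      Ck_on_has_partial[OF s(1)[unfolded j] that], of i] by simp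
  have a: "Ck_on j U s" by (rule Ck_on_Suc_D) (use s(1) j in \<open>simp del: Ck_on.simps\<close>)
  have b: "Ck_on j U (\<lambda>x. r (s x))" using rs j by (simp del: Ck_on.simps)
  have d: "Ck_on j U (partial i s)" for i using s(1)[unfolded j] by simp
  have e: "j < 2 * m" using j by simp
  have "Ck_on j U (\<lambda>x. 1 - s x)"
    by (rule Ck_on_diff[OF U Ck_on_const[OF U] a])
  from Ck_on_pos_power[OF U this e]
  have "Ck_on j U (\<lambda>x. max 0 (1 - s x) ^ (2 * m))" .
  from Ck_on_cmult[OF U Ck_on_mult[OF U this b]]
  have "Ck_on j U (\<lambda>x. - 1 * (max 0 (1 - s x) ^ (2 * m) * r (s x)))" .
  from Ck_on_mult[OF U this d]
  have c: "Ck_on j U (\<lambda>x. (- 1 * (max 0 (1 - s x) ^ (2 * m) * r (s x))) * partial i s x)" for i .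
  have "continuous_on {lo<..} (kern m r)"
    using DERIV_isCont[OF kern_has_derivative[OF r(1,2) _ r(3)]]
    by (intro continuous_at_imp_continuous_on) simp
  then have "continuous_on U (\<lambda>x. kern m r (s x))"
    by (rule continuous_on_compose2[OF _ Ck_on_imp_continuous_on[OF s(1)]]) (use s(2) in auto)
  from Ck_on_SucI[OF U this p c] show ?thesis unfolding j .
qed

section \<open>Iterated Laplacians of the two kernels\<close>

lemma binomial_minus_power:
  "(1 - s) ^ n = (\<Sum>i\<le>n. (real (n choose i) * (- 1) ^ i * (1 + e) ^ (n - i)) * (s + e) ^ i)"
proof -
  have "(1 - s) ^ n = (- (s + e) + (1 + e)) ^ n" by simp
  also have "\<dots> = (\<Sum>i\<le>n. real (n choose i) * (- (s + e)) ^ i * (1 + e) ^ (n - i))"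
    by (rule binomial_ring)
  also have "\<dots> = (\<Sum>i\<le>n. (real (n choose i) * (- 1) ^ i * (1 + e) ^ (n - i)) * (s + e) ^ i)"
    by (intro sum.cong refl) (simp only: power_minus[of "s + e"] mult_ac)
  finally show ?thesis .
qed

text \<open>Dividing the expansion of \<open>(1 - s)^(2m)\<close> in powers of \<open>s + e\<close>
  by \<open>s + e\<close> leaves one singular term, whose antiderivative is a multiple of the
  logarithm, and a polynomial. The logarithm yields the bubble and the polynomial the error
  \<open>C\<close>, uniform in \<open>e\<close>.\<close>

lemma rlapn_kern_log:
  assumes m: "odd m"
  shows "\<exists>C\<ge>0. \<forall>e\<in>{0<..1}. \<exists>k. rlapn (real m) {-e<..<1} m (kern m (\<lambda>t. inverse (t + e))) k \<and>
    (\<forall>s\<in>{0..1}. - k s \<ge> 4 ^ m * fact (2 * m - 1) * e ^ m * inverse (s + e) ^ (2 * m) - C)"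
proof -
  obtain j where j: "m = Suc j" using m by (cases m) auto
  define K where "K = (4 ^ m * fact (2 * m - 1) :: real)"
  have K: "K > 0" by (simp add: K_def)
  have "\<exists>C. \<forall>i. C i \<ge> 0 \<and> (\<forall>S. \<forall>e\<in>{0..1}. \<exists>k. rlapn (real m) S m (\<lambda>s. (s + e) ^ i) k \<and> (\<forall>s\<in>{0..1}. \<bar>k s\<bar> \<le> C i))"
    by (intro choice allI) (use rlapn_power_bound[of "real m" m] in auto)
  then obtain C where C: "\<And>i. C i \<ge> 0"
    "\<And>i S e. e \<in> {0..1} \<Longrightarrow> \<exists>k. rlapn (real m) S m (\<lambda>s. (s + e) ^ i) k \<and> (\<forall>s\<in>{0..1}. \<bar>k s\<bar> \<le> C i)"
    by blast
  define D where "D i = real (2 * m choose i) * 2 ^ (2 * m)" for i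
  have "\<exists>k. rlapn (real m) {-e<..<1} m (kern m (\<lambda>t. inverse (t + e))) k \<and>
    (\<forall>s\<in>{0..1}. - k s \<ge> K * e ^ m * inverse (s + e) ^ (2 * m) - (\<Sum>i=1..2*m. D i * C i))"
    if e: "e \<in> {0<..1}" for e
  proof -
    let ?S = "{-e<..<1}"
    \<comment> \<open>Coefficients of the termwise antiderivative for \<open>i \<ge> 1\<close>; the
      minus sign is that of the derivative of \<open>kern\<close>. The term \<open>i = 0\<close>
      becomes the logarithm in \<open>h\<close>.\<close>
    define d where "d i = - (real (2 * m choose i) * (- 1) ^ i * (1 + e) ^ (2 * m - i) / real i)" for i
    have "\<exists>k. \<forall>i. rlapn (real m) ?S m (\<lambda>s. (s + e) ^ i) (k i) \<and> (\<forall>s\<in>{0..1}. \<bar>k i s\<bar> \<le> C i)"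
      by (intro choice allI) (use C(2)[of e] e in auto)
    then obtain k where k: "\<And>i. rlapn (real m) ?S m (\<lambda>s. (s + e) ^ i) (k i)" "\<And>i s. s \<in> {0..1} \<Longrightarrow> \<bar>k i s\<bar> \<le> C i"
      by blast
    define h where "h s = - ((1 + e) ^ (2 * m)) * ln (s + e) + (\<Sum>i=1..2*m. d i * (s + e) ^ i)" for s
    define g where "g s = - ((1 + e) ^ (2 * m)) * (K * e ^ m * inverse (s + e) ^ (2 * m)) + (\<Sum>i=1..2*m. d i * k i s)" for s
    have "rlapn (real m) ?S m (\<lambda>s. ln (s + e)) (\<lambda>s. K * e ^ m * inverse (s + e) ^ (2 * m))"
      unfolding K_def by (rule rlapn_ln_critical) (use m in auto)
    then have hg: "rlapn (real m) ?S m h g"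
      unfolding h_def g_def by (intro rlapn_add rlapn_cmult rlapn_sum k) auto
    have dh: "(h has_real_derivative - (max 0 (1 - s) ^ (2 * m) * inverse (s + e))) (at s)" if "s \<in> ?S" for s
    proof -
      have s: "s + e > 0" "s < 1" using that by auto
      have "(h has_real_derivative - ((1 + e) ^ (2 * m)) * inverse (s + e) +
          (\<Sum>i=1..2*m. d i * (real i * (s + e) ^ (i - 1)))) (at s)"
        unfolding h_def using s
        by (auto intro!: derivative_eq_intros simp: inverse_eq_divide mult_ac)
      moreover have "- ((1 + e) ^ (2 * m)) * inverse (s + e) + (\<Sum>i=1..2*m. d i * (real i * (s + e) ^ (i - 1)))
          = - ((1 - s) ^ (2 * m) * inverse (s + e))"
      proof -
        define T where "T i = real (2 * m choose i) * (- 1) ^ i * (1 + e) ^ (2 * m - i) * (s + e) ^ i" for i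
        have "d i * (real i * (s + e) ^ (i - 1)) = - T i * inverse (s + e)" if "i \<in> {1..2*m}" for i
        proof -
          have "d i * real i = - (real (2 * m choose i) * (- 1) ^ i * (1 + e) ^ (2 * m - i))"
            using that by (simp only: d_def) auto
          moreover have "(s + e) ^ (i - 1) = (s + e) ^ i * inverse (s + e)"
            using s that by (simp add: power_diff divide_inverse)
          ultimately show ?thesis unfolding T_def by (simp only: mult.assoc[symmetric] mult_minus_left)
        qed
        then have "(\<Sum>i=1..2*m. d i * (real i * (s + e) ^ (i - 1))) = (\<Sum>i=1..2*m. - T i * inverse (s + e))"
          by (rule sum.cong[OF refl])
        also have "\<dots> = - (\<Sum>i=1..2*m. T i) * inverse (s + e)"
          by (simp only: mult_minus_left sum_negf sum_distrib_right)
        finally have A: "(\<Sum>i=1..2*m. d i * (real i * (s + e) ^ (i - 1))) = - (\<Sum>i=1..2*m. T i) * inverse (s + e)" .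
        have "(1 - s) ^ (2 * m) = (\<Sum>i\<le>2 * m. T i)"
          unfolding binomial_minus_power[of s "2 * m" e] T_def ..
        also have "\<dots> = T 0 + (\<Sum>i=1..2*m. T i)"
          by (simp add: atMost_atLeast0 sum.atLeast_Suc_atMost)
        also have "T 0 = (1 + e) ^ (2 * m)" by (simp add: T_def)
        finally have B: "(1 - s) ^ (2 * m) = (1 + e) ^ (2 * m) + (\<Sum>i=1..2*m. T i)" .
        show ?thesis unfolding A B by (simp only: distrib_right mult_minus_left minus_add_distrib)
      qed
      moreover have "max 0 (1 - s) = 1 - s" using s by simp
      ultimately show ?thesis by simp
    qed
    have "rlapn (real m) ?S m (kern m (\<lambda>t. inverse (t + e))) g"
      unfolding j
    proof (rule rlapn_same_deriv[OF _ hg[unfolded j]], unfold j[symmetric])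
      fix s assume s: "s \<in> ?S"
      have "(kern m (\<lambda>t. inverse (t + e)) has_real_derivative - (max 0 (1 - s) ^ (2 * m) * inverse (s + e))) (at s)"
        by (rule kern_has_derivative[of "- e"]) (use s e m in \<open>auto intro!: continuous_intros elim: oddE\<close>)
      then show "\<exists>d. (h has_real_derivative d) (at s) \<and> (kern m (\<lambda>t. inverse (t + e)) has_real_derivative d) (at s)"
        using dh[OF s] by blast
    qed
    moreover have "- g s \<ge> K * e ^ m * inverse (s + e) ^ (2 * m) - (\<Sum>i=1..2*m. D i * C i)" if "s \<in> {0..1}" for s
    proof -
      have "\<bar>\<Sum>i=1..2*m. d i * k i s\<bar> \<le> (\<Sum>i=1..2*m. D i * C i)"
      proof (rule order_trans[OF sum_abs], rule sum_mono)
        fix i assume i: "i \<in> {1..2*m}"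
        have "(1 + e) ^ (2 * m - i) \<le> 2 ^ (2 * m - i)" using e by (intro power_mono) auto
        also have "(2::real) ^ (2 * m - i) \<le> 2 ^ (2 * m)" by (rule power_increasing) auto
        finally have "real (2 * m choose i) * (1 + e) ^ (2 * m - i) \<le> D i"
          unfolding D_def by (intro mult_left_mono) auto
        moreover have "\<bar>d i\<bar> = real (2 * m choose i) * (1 + e) ^ (2 * m - i) / real i"
          using e by (simp add: d_def abs_mult power_abs)
        moreover have "real (2 * m choose i) * (1 + e) ^ (2 * m - i) / real i \<le> real (2 * m choose i) * (1 + e) ^ (2 * m - i) / 1"
          using i e by (intro divide_left_mono) auto
        ultimately have "\<bar>d i\<bar> \<le> D i" by simp
        then show "\<bar>d i * k i s\<bar> \<le> D i * C i"
          unfolding abs_mult using k(2)[OF that, of i] by (intro mult_mono) auto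
      qed
      \<comment> \<open>Only a lower bound for a nonnegative bubble is wanted, so the factor
        \<open>(1 + e)^(2m)\<close>, which is at least 1, may be dropped.\<close>
      moreover have "K * e ^ m * inverse (s + e) ^ (2 * m) \<le> (1 + e) ^ (2 * m) * (K * e ^ m * inverse (s + e) ^ (2 * m))"
      proof -
        have "1 \<le> (1 + e) ^ (2 * m)" using e by (intro one_le_power) auto
        moreover have "0 \<le> K * e ^ m * inverse (s + e) ^ (2 * m)" using e K that by auto
        ultimately show ?thesis using mult_right_mono by fastforce
      qed
      ultimately show ?thesis unfolding g_def by linarith
    qed
    ultimately show ?thesis by blast
  qed
  moreover have "(\<Sum>i=1..2*m. D i * C i) \<ge> 0" using C(1) by (intro sum_nonneg) (auto simp: D_def)
  ultimately show ?thesis unfolding K_def by blast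
qed

lemma rlap_powi:
  assumes "\<And>s. s \<in> S \<Longrightarrow> s > 0"
  shows "rlap M S (\<lambda>s. s powi b) (\<lambda>s. 4 * of_int b * (of_int b + M - 1) * s powi (b - 1))"
proof (rule rlapI)
  have D: "((\<lambda>s. s powi c) has_real_derivative of_int c * s powi (c - 1)) (at s)" if "s \<in> S" for c s
    using assms[OF that] by (auto intro!: derivative_eq_intros)
  show "((\<lambda>s. s powi b) has_real_derivative of_int b * s powi (b - 1)) (at s)" if "s \<in> S" for s
    by (rule D[OF that])
  show "((\<lambda>s. of_int b * s powi (b - 1)) has_real_derivative of_int b * (of_int (b - 1) * s powi (b - 2))) (at s)"
    if "s \<in> S" for s
    using DERIV_cmult[OF D[OF that, of "b - 1"], of "of_int b"] by simp
  fix s assume "s \<in> S"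
  then have "s * s powi (b - 2) = s powi (b - 1)"
    using assms[of s] power_int_add[of s 1 "b - 2"] by simp
  moreover have "s * (of_int b * (of_int (b - 1) * w)) = of_int b * (of_int b - 1) * (s * w)" for w
    by (simp only: of_int_diff of_int_1 mult_ac)
  ultimately have *: "s * (of_int b * (of_int (b - 1) * s powi (b - 2))) = of_int b * (of_int b - 1) * s powi (b - 1)"
    by simp
  show "4 * of_int b * (of_int b + M - 1) * s powi (b - 1) =
    4 * (s * (of_int b * (of_int (b - 1) * s powi (b - 2))) + M * (of_int b * s powi (b - 1)))"
    unfolding * by (simp add: algebra_simps)
qed

lemma rlapn_powi:
  assumes "open S" "\<And>s. s \<in> S \<Longrightarrow> s > 0"
  shows "rlapn M S j (\<lambda>s. s powi b)
    (\<lambda>s. (\<Prod>l<j. 4 * (of_int b - real l) * (of_int b + M - 1 - real l)) * s powi (b - int j))"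
proof (induction j)
  case (Suc j)
  let ?c = "\<lambda>j. \<Prod>l<j. 4 * (of_int b - real l) * (of_int b + M - 1 - real l)"
  have "rlap M S (\<lambda>s. ?c j * s powi (b - int j))
     (\<lambda>s. ?c j * (4 * of_int (b - int j) * (of_int (b - int j) + M - 1) * s powi (b - int j - 1)))"
    by (intro rlap_cmult rlap_powi assms(2))
  then have "rlap M S (\<lambda>s. ?c j * s powi (b - int j)) (\<lambda>s. ?c (Suc j) * s powi (b - int (Suc j)))"
    by (rule rlap_cong_right) (simp add: algebra_simps)
  from rlapn_Suc_right[OF assms(1) Suc this] show ?case .
qed simp

lemma prod_diff_fact: "j \<le> a \<Longrightarrow> (\<Prod>l<j. real a - real l) * fact (a - j) = fact a"
proof (induction j)
  case (Suc j)
  have "a - j = Suc (a - Suc j)" using Suc.prems by simp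
  then have f: "fact (a - j) = (real a - real j) * fact (a - Suc j)"
    using Suc.prems by (simp add: of_nat_diff)
  have "(\<Prod>l<Suc j. real a - real l) * fact (a - Suc j) = (\<Prod>l<j. real a - real l) * fact (a - j)"
    unfolding f by (simp only: prod.lessThan_Suc mult_ac)
  then show ?case using Suc by simp
qed simp

text \<open>With \<open>h' = - (1 - s)^(2m) / s^m\<close> the derivatives of \<open>s^(-m)\<close>
  cancel in \<open>s * h'' + m * h'\<close>, and only a multiple of
  \<open>(1 - s)^(2m-1) * s^(1-m)\<close> is left. Of its monomials all but the top two are
  annihilated by \<open>m - 1\<close> further Laplacians, and those two combine to a multiple of
  \<open>1 - s\<close>.\<close>

lemma rlapn_kern_power:
  assumes m: "m \<ge> 2"
  shows "rlapn (real m) {0<..<1} m (kern m (\<lambda>t. inverse (t ^ m)))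
    (\<lambda>s. 8 * real m * 4 ^ (m - 1) * fact (2 * m - 1) * (1 - s))"
proof -
  let ?S = "{0<..<1::real}" and ?n = "2 * m - 1"
  obtain j where j: "m = Suc (Suc j)" using m by (metis add_2_eq_Suc le_Suc_ex)
  have 1: "rlap (real m) ?S (kern m (\<lambda>t. inverse (t ^ m))) (\<lambda>s. 8 * real m * ((1 - s) ^ ?n * (s * inverse (s ^ m))))"
  proof (rule rlapI)
    fix s :: real assume s: "s \<in> ?S"
    have "(kern m (\<lambda>t. inverse (t ^ m)) has_real_derivative - (max 0 (1 - s) ^ (2 * m) * inverse (s ^ m))) (at s)"
      by (rule kern_has_derivative[of 0]) (use s m in \<open>auto intro!: continuous_intros\<close>)
    then show "(kern m (\<lambda>t. inverse (t ^ m)) has_real_derivative - ((1 - s) ^ (2 * m) * inverse s ^ m)) (at s)"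
      using s by (simp add: power_inverse)
    have i: "(inverse has_real_derivative - (inverse s ^ 2)) (at s)"
      using s by (auto intro!: derivative_eq_intros simp: power2_eq_square)
    have p: "((\<lambda>s. inverse s ^ m) has_real_derivative - (real m * inverse s ^ (m + 1))) (at s)"
      using DERIV_power[OF i, of m] by (simp add: j power2_eq_square algebra_simps)
    have q: "((\<lambda>s. (1 - s) ^ (2 * m)) has_real_derivative - (2 * real m * (1 - s) ^ ?n)) (at s)"
      by (auto intro!: derivative_eq_intros)
    show "((\<lambda>s. - ((1 - s) ^ (2 * m) * inverse s ^ m)) has_real_derivative
        2 * real m * (1 - s) ^ ?n * inverse s ^ m + (1 - s) ^ (2 * m) * (real m * inverse s ^ (m + 1))) (at s)"
      using DERIV_minus[OF DERIV_mult[OF q p]] by (simp add: algebra_simps)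
    have "s * inverse s ^ (m + 1) = inverse s ^ m" using s by simp
    then have "s * ((1 - s) ^ (2 * m) * (real m * inverse s ^ (m + 1))) = (1 - s) ^ (2 * m) * (real m * inverse s ^ m)"
      by (simp only: mult.left_commute[of s])
    then show "8 * real m * ((1 - s) ^ ?n * (s * inverse (s ^ m))) =
      4 * (s * (2 * real m * (1 - s) ^ ?n * inverse s ^ m + (1 - s) ^ (2 * m) * (real m * inverse s ^ (m + 1)))
       + real m * - ((1 - s) ^ (2 * m) * inverse s ^ m))"
      unfolding distrib_left[of s] by (simp add: power_inverse)
  qed
  define c where "c i = 8 * real m * (real (?n choose i) * (- 1) ^ i)" for i
  define b where "b i = int i + 1 - int m" for i
  have 2: "8 * real m * ((1 - s) ^ ?n * (s * inverse (s ^ m))) = (\<Sum>i\<le>?n. c i * s powi (b i))" if "s \<in> ?S" for s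
  proof -
    have "s powi (b i) = s ^ i * (s * inverse (s ^ m))" for i
      using that unfolding b_def by (simp add: power_int_diff power_int_add divide_inverse)
    then show ?thesis
      using binomial_minus_power[of s ?n 0] by (simp add: c_def sum_distrib_left sum_distrib_right mult_ac)
  qed
  define P where "P i = (\<Prod>l<m-1. 4 * (of_int (b i) - real l) * (of_int (b i) + real m - 1 - real l))" for i
  have 3: "rlapn (real m) ?S (m - 1) (\<lambda>s. \<Sum>i\<le>?n. c i * s powi (b i)) (\<lambda>s. \<Sum>i\<le>?n. c i * (P i * s powi (b i - int (m - 1))))"
    unfolding P_def by (intro rlapn_sum rlapn_powi) auto
  have P: "P i = 4 ^ (m - 1) * ((\<Prod>l<m-1. of_int (b i) - real l) * (\<Prod>l<m-1. real i - real l))" for i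
  proof -
    have "of_int (b i) + real m - 1 = real i" by (simp add: b_def)
    then show ?thesis unfolding P_def
      by (simp only: prod.distrib mult.assoc prod_constant card_lessThan)
  qed
  \<comment> \<open>Below \<open>m - 1\<close> the second product hits zero; for
    \<open>m - 1 \<le> i < 2m - 2\<close> the exponent \<open>b i\<close> lies between 0 and
    \<open>m - 2\<close>, and the first product does.\<close>
  have P0: "P i = 0" if "i < 2 * m - 2" for i
  proof (cases "i < m - 1")
    case True
    then have "(\<Prod>l<m-1. real i - real l) = 0" by (intro prod_zero) auto
    then show ?thesis by (simp add: P)
  next
    case False
    have "(\<Prod>l<m-1. of_int (b i) - real l) = 0"
      using False that m by (intro prod_zero) (auto intro!: bexI[of _ "i + 1 - m"] simp: b_def of_nat_diff)
    then show ?thesis by (simp add: P)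
  qed
  have A1: "P (2 * m - 2) = 4 ^ (m - 1) * fact (2 * m - 2)"
  proof -
    have "of_int (b (2 * m - 2)) = real (m - 1)" using m by (simp add: b_def of_nat_diff)
    then show ?thesis unfolding P using prod_diff_fact[of "m - 1" "m - 1"] prod_diff_fact[of "m - 1" "2 * m - 2"] m
      by (simp add: mult.commute diff_add_inverse2 numeral_2_eq_2 j)
  qed
  have A2: "P (2 * m - 1) = 4 ^ (m - 1) * fact (2 * m - 1)"
  proof -
    have "of_int (b (2 * m - 1)) = real m" using m by (simp add: b_def of_nat_diff)
    then have "P (2 * m - 1) = 4 ^ (m - 1) * ((\<Prod>l<m-1. real m - real l) * (\<Prod>l<m-1. real (2 * m - 1) - real l))"
      unfolding P by simp
    moreover have "(\<Prod>l<m-1. real m - real l) = fact m"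
      using prod_diff_fact[of "m - 1" m] m by simp
    moreover have "(\<Prod>l<m-1. real (2 * m - 1) - real l) * fact m = fact (2 * m - 1)"
      using prod_diff_fact[of "m - 1" "2 * m - 1"] m by (simp add: j)
    ultimately show ?thesis by (simp add: mult.commute)
  qed
  have 4: "(\<Sum>i\<le>?n. c i * (P i * s powi (b i - int (m - 1)))) = 8 * real m * 4 ^ (m - 1) * fact (2 * m - 1) * (1 - s)" for s
  proof -
    have "(\<Sum>i\<le>?n. c i * (P i * s powi (b i - int (m - 1)))) =
       (\<Sum>i\<in>{2*m-2, 2*m-1}. c i * (P i * s powi (b i - int (m - 1))))"
    proof (rule sum.mono_neutral_right)
      show "\<forall>i\<in>{..?n} - {2 * m - 2, 2 * m - 1}. c i * (P i * s powi (b i - int (m - 1))) = 0"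
        using P0 m by auto
    qed (use m in auto)
    also have "\<dots> = c (2*m-2) * (P (2*m-2) * s powi (b (2*m-2) - int (m - 1))) + c (2*m-1) * (P (2*m-1) * s powi (b (2*m-1) - int (m - 1)))"
      using m by simp
    also have "b (2*m-2) - int (m - 1) = 0" using m by (simp add: b_def of_nat_diff)
    also have "b (2*m-1) - int (m - 1) = 1" using m by (simp add: b_def of_nat_diff)
    also have "c (2*m-2) = 8 * real m * real (2 * m - 1)"
      using binomial_symmetric[of "2*m-2" "2*m-1"] m by (simp add: c_def)
    also have "c (2*m-1) = - (8 * real m)"
    proof -
      have "odd (2 * m - 1)" using m by simp
      then show ?thesis by (simp add: c_def)
    qed
    also have "8 * real m * real (2 * m - 1) * (P (2 * m - 2) * s powi 0) + - (8 * real m) * (P (2 * m - 1) * s powi 1) =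
        8 * real m * 4 ^ (m - 1) * (fact (2 * m - 1) - fact (2 * m - 1) * s)"
    proof -
      have "fact (2 * m - 1) = real (2 * m - 1) * fact (2 * m - 2)"
        using m by (simp add: fact_reduce numeral_2_eq_2)
      then show ?thesis unfolding A1 A2 by (simp add: algebra_simps)
    qed
    finally show ?thesis by (simp add: algebra_simps)
  qed
  have "rlapn (real m) ?S (Suc (m - 1)) (kern m (\<lambda>t. inverse (t ^ m)))
    (\<lambda>s. \<Sum>i\<le>?n. c i * (P i * s powi (b i - int (m - 1))))"
    using rlap_cong_right[OF 1 2] 3 by auto
  then show ?thesis using m unfolding 4 by simp
qed

section \<open>Size of the kernels\<close>

text \<open>Comparison of derivatives from \<open>s\<close> up to 1, where the kernel is zero.
  \<open>m \<ge> 2\<close> enters through \<open>1 \<le> m - 1\<close>.\<close>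

lemma kern_power_le:
  assumes "m \<ge> 2" "0 < s" "s \<le> 1"
  shows "kern m (\<lambda>t. inverse (t ^ m)) s \<le> inverse (s ^ (m - 1))"
proof -
  obtain j where j: "m = Suc (Suc j)" using assms(1) by (metis add_2_eq_Suc le_Suc_ex)
  have "inverse (1 ^ (m - 1)) - kern m (\<lambda>t. inverse (t ^ m)) 1 \<le> inverse (s ^ (m - 1)) - kern m (\<lambda>t. inverse (t ^ m)) s"
  proof (rule DERIV_nonpos_imp_nonincreasing[OF assms(3)])
    fix x :: real assume x: "s \<le> x" "x \<le> 1"
    have "((\<lambda>x. inverse (x ^ (m - 1))) has_real_derivative - (real (m - 1) * inverse (x ^ m))) (at x)"
    proof -
      have "(inverse has_real_derivative - (inverse x ^ 2)) (at x)"
        using x assms by (auto intro!: derivative_eq_intros simp: power2_eq_square)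
      from DERIV_power[OF this, of "Suc j"] show ?thesis
        by (simp add: j power_inverse power2_eq_square algebra_simps)
    qed
    moreover have "(kern m (\<lambda>t. inverse (t ^ m)) has_real_derivative - (max 0 (1 - x) ^ (2 * m) * inverse (x ^ m))) (at x)"
      by (rule kern_has_derivative[of 0]) (use x assms in \<open>auto intro!: continuous_intros\<close>)
    ultimately have "((\<lambda>x. inverse (x ^ (m - 1)) - kern m (\<lambda>t. inverse (t ^ m)) x) has_real_derivative
       - (real (m - 1) * inverse (x ^ m)) - - (max 0 (1 - x) ^ (2 * m) * inverse (x ^ m))) (at x)"
      by (rule DERIV_diff)
    moreover have "max 0 (1 - x) ^ (2 * m) * inverse (x ^ m) \<le> real (m - 1) * inverse (x ^ m)"
    proof (rule mult_right_mono)
      have "max 0 (1 - x) ^ (2 * m) \<le> 1" using x assms by (intro power_le_one) auto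
      then show "max 0 (1 - x) ^ (2 * m) \<le> real (m - 1)" using assms(1) by linarith
    qed (use x assms in auto)
    ultimately show "\<exists>y. ((\<lambda>x. inverse (x ^ (m - 1)) - kern m (\<lambda>t. inverse (t ^ m)) x) has_real_derivative y) (at x) \<and> y \<le> 0"
      by (intro exI conjI) auto
  qed
  then show ?thesis using kern_eq_0[of 1 m] by simp
qed

text \<open>The drop of the kernel over \<open>[s, 2s]\<close> is already large enough. There
  \<open>1 - z \<ge> 1/2\<close> and \<open>z \<le> 2s\<close>, which gives the constant 2^(-2m) *
  2^(-m).\<close>

lemma kern_power_ge:
  assumes "m \<ge> 1" "0 < s" "s \<le> 1 / 4"
  shows "kern m (\<lambda>t. inverse (t ^ m)) s \<ge> inverse (2 ^ (3 * m)) * inverse (s ^ (m - 1))"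
proof -
  let ?k = "kern m (\<lambda>t. inverse (t ^ m))"
  have D: "(?k has_real_derivative - (max 0 (1 - x) ^ (2 * m) * inverse (x ^ m))) (at x)" if "x > 0" for x
    by (rule kern_has_derivative[of 0]) (use that assms in \<open>auto intro!: continuous_intros\<close>)
  have "\<exists>z>s. z < 2 * s \<and> ?k (2 * s) - ?k s = (2 * s - s) * - (max 0 (1 - z) ^ (2 * m) * inverse (z ^ m))"
    by (rule MVT2[OF _ D]) (use assms in simp_all)
  then obtain z where z: "s < z" "z < 2 * s" "?k s = ?k (2 * s) + s * (max 0 (1 - z) ^ (2 * m) * inverse (z ^ m))"
    by (auto simp: algebra_simps)
  have "?k (2 * s) \<ge> 0"
    by (rule kern_nonneg[of 0]) (use assms in \<open>auto intro!: continuous_intros\<close>)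
  moreover have "(1/2) ^ (2 * m) * inverse ((2 * s) ^ m) \<le> max 0 (1 - z) ^ (2 * m) * inverse (z ^ m)"
    using z assms by (intro mult_mono power_mono le_imp_inverse_le) auto
  then have "s * ((1/2) ^ (2 * m) * inverse ((2 * s) ^ m)) \<le> s * (max 0 (1 - z) ^ (2 * m) * inverse (z ^ m))"
    using assms by (intro mult_left_mono) auto
  moreover have "s * ((1/2) ^ (2 * m) * inverse ((2 * s) ^ m)) = inverse (2 ^ (3 * m)) * inverse (s ^ (m - 1))"
  proof -
    obtain j where j: "m = Suc j" using assms(1) by (cases m) auto
    have "(2::real) ^ (3 * m) = 2 ^ (2 * m) * 2 ^ m" by (simp add: power_add[symmetric])
    then show ?thesis using assms(2) by (simp add: j power_mult_distrib power_divide divide_simps)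
  qed
  ultimately show ?thesis using z(3) by linarith
qed

lemma kern_log_le:
  assumes "m \<ge> 1" "e > 0" "0 < s" "s \<le> 1"
  shows "kern m (\<lambda>t. inverse (t + e)) s \<le> - ln s"
proof -
  have "- ln 1 - kern m (\<lambda>t. inverse (t + e)) 1 \<le> - ln s - kern m (\<lambda>t. inverse (t + e)) s"
  proof (rule DERIV_nonpos_imp_nonincreasing[OF assms(4)])
    fix x :: real assume x: "s \<le> x" "x \<le> 1"
    have "((\<lambda>x. - ln x) has_real_derivative - inverse x) (at x)"
      using x assms by (auto intro!: derivative_eq_intros simp: divide_inverse)
    moreover have "(kern m (\<lambda>t. inverse (t + e)) has_real_derivative - (max 0 (1 - x) ^ (2 * m) * inverse (x + e))) (at x)"
      by (rule kern_has_derivative[of "- e"]) (use x assms in \<open>auto intro!: continuous_intros\<close>)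
    ultimately have "((\<lambda>x. - ln x - kern m (\<lambda>t. inverse (t + e)) x) has_real_derivative
       - inverse x - - (max 0 (1 - x) ^ (2 * m) * inverse (x + e))) (at x)"
      by (rule DERIV_diff)
    moreover have "max 0 (1 - x) ^ (2 * m) * inverse (x + e) \<le> 1 * inverse x"
      using x assms by (intro mult_mono power_le_one le_imp_inverse_le) auto
    ultimately show "\<exists>y. ((\<lambda>x. - ln x - kern m (\<lambda>t. inverse (t + e)) x) has_real_derivative y) (at x) \<and> y \<le> 0"
      by (intro exI conjI) auto
  qed
  then show ?thesis using kern_eq_0[of 1 m] by simp
qed

section \<open>Integrals over compact sets and null spheres\<close>

lemma integrable_indicator_compact:
  fixes f :: "'a::euclidean_space \<Rightarrow> real"
  assumes "compact K" "continuous_on K f"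
  shows "integrable lborel (\<lambda>x. indicator K x * f x)"
  using borel_integrable_compact[OF assms] by simp

lemma set_integral_indicator:
  fixes f :: "'a::euclidean_space \<Rightarrow> real"
  shows "(LINT x:K|lborel. f x) = (LINT x|lborel. indicator K x * f x)"
  unfolding set_lebesgue_integral_def by simp

text \<open>The closed formulas for the Laplacians of the kernels hold for \<open>s < 1\<close>
  only; the sphere \<open>s = 1\<close> is discarded as a null set.\<close>

lemma AE_not_on_sphere: "AE x in lborel. norm (x - y) \<noteq> (R::real)" for y :: "'a::euclidean_space"
proof -
  have "sphere y R \<in> null_sets lebesgue" using negligible_sphere negligible_iff_null_sets by blast
  moreover have "sphere y R \<in> sets lborel" by simp
  ultimately have "sphere y R \<in> null_sets lborel" using null_sets_completion_iff by blast
  then have "AE x in lborel. x \<notin> sphere y R" by (rule AE_not_in)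
  then show ?thesis by eventually_elim (auto simp: dist_norm norm_minus_commute)
qed

section \<open>Estimates for exterior solutions\<close>

locale exterior =
  fixes m :: nat and v :: "real^'n::finite \<Rightarrow> real"
  assumes odd_m: "odd m" and m3: "m \<ge> 3" and card_n: "CARD('n) = 2 * m"
    and Ck_v: "Ck_on (2 * m) {y. norm y > 1/2} v"
    and v_nonneg: "norm y > 1/2 \<Longrightarrow> v y \<ge> 0"
    and g_nonneg: "norm y > 1/2 \<Longrightarrow> - iter_laplacian m v y \<ge> 0"
begin

definition g :: "real^'n \<Rightarrow> real" where "g y = - iter_laplacian m v y"

abbreviation U :: "(real^'n) set" where "U \<equiv> {y. norm y > 1/2}"

abbreviation A :: "real \<Rightarrow> (real^'n) set" where "A T \<equiv> {x. 2 \<le> norm x \<and> norm x \<le> T}"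

lemma open_U: "open U"
  by (intro open_Collect_less continuous_intros)

lemma half_card: "real CARD('n) = 2 * real m"
  by (simp add: card_n)

lemma continuous_v: "continuous_on U v"
  by (rule Ck_on_imp_continuous_on[OF Ck_v])

lemma continuous_g: "continuous_on U g"
proof -
  have "Ck_on 0 U (iter_laplacian m v)"
    by (rule Ck_on_iter_laplacian[OF open_U]) (simp only: add_0 Ck_v)
  then show ?thesis unfolding g_def by (auto intro: continuous_on_minus)
qed

lemma g_nonneg': "x \<in> U \<Longrightarrow> g x \<ge> 0"
  using g_nonneg by (simp add: g_def)

lemma compact_A: "compact (A T)"
proof -
  have "A T = cball 0 T \<inter> - ball 0 2" by auto
  then show ?thesis by (simp only:) (intro compact_Int_closed compact_cball closed_Compl open_ball)
qed

text \<open>Testing with \<open>kern m (\<lambda>t. inverse (t ^ m))\<close> at scale \<open>R\<close>: as \<open>v \<ge> 0\<close> and the iterated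
  Laplacian of the kernel is nonnegative, every term has a sign except one on
  \<open>1 \<le> norm x \<le> 2\<close>, where the cutoff \<open>psi\<close> acts.\<close>

lemma weighted_estimates:
  "\<exists>C\<ge>0. \<forall>R\<ge>4. (LINT x:A (R / 2)|lborel. g x * inverse (norm x ^ (2 * m - 2))) \<le> C \<and>
     (LINT x:A (R / 2)|lborel. v x) \<le> C * R ^ (4 * m - 2)"
proof -
  \<comment> \<open>A cutoff of class C^(2m) made of truncated powers: zero inside the unit ball,
    one as soon as |x|^2 - 1 exceeds 1. The forms \<open>1 *\<close> and \<open>- 0\<close> match
    the pattern of \<open>Ck_on_sq_dist\<close>.\<close>
  define psi where "psi x = 1 - max 0 (1 - max 0 (1 * (norm (x - 0))\<^sup>2 - 1) ^ (2 * m + 1)) ^ (2 * m + 1)" for x :: "real^'n"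
  define a where "a x = psi x * v x" for x
  have m0: "m \<ge> 1" "m \<ge> 2" using m3 by auto
  have psi_Ck: "Ck_on (2 * m) U psi"
    unfolding psi_def
    by (rule Ck_on_diff[OF open_U Ck_on_const[OF open_U]], rule Ck_on_pos_power[OF open_U],
        rule Ck_on_diff[OF open_U Ck_on_const[OF open_U]], rule Ck_on_pos_power[OF open_U],
        rule Ck_on_diff[OF open_U Ck_on_sq_dist[OF open_U] Ck_on_const[OF open_U]]) simp_all
  have psi01: "0 \<le> psi x" for x
  proof -
    have "max 0 (1 - max 0 (1 * (norm (x - 0))\<^sup>2 - 1) ^ (2 * m + 1)) ^ (2 * m + 1) \<le> 1"
      by (rule power_le_one) auto
    then show ?thesis unfolding psi_def by linarith
  qed
  have psi1: "psi x = 1" if "norm x > 3/2" for x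
  proof -
    have "(3/2) ^ 2 \<le> (norm x)\<^sup>2" using that by (intro power_mono) auto
    then have "(norm x)\<^sup>2 - 1 \<ge> 1" by (simp add: power2_eq_square)
    then have "1 \<le> max 0 ((norm x)\<^sup>2 - 1) ^ (2 * m + 1)" by (intro one_le_power) auto
    then show ?thesis unfolding psi_def by simp
  qed
  have psi0: "psi x = 0" if "norm x < 1" for x
  proof -
    have "(norm x)\<^sup>2 \<le> 1" using that by (intro power_le_one) auto
    then show ?thesis unfolding psi_def by simp
  qed
  have a_Ck: "Ck_on (2 * m) U a" unfolding a_def by (rule Ck_on_mult[OF open_U psi_Ck Ck_v])
  have a0: "a x = 0" if "x \<in> U - (- ball 0 1)" for x using that psi0 by (auto simp: a_def)
  have a_nonneg: "a x \<ge> 0" if "x \<in> U" for x using that psi01 v_nonneg by (auto simp: a_def)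
  have La_c: "continuous_on U (iter_laplacian m a)"
    by (rule Ck_on_imp_continuous_on[of 0], rule Ck_on_iter_laplacian[OF open_U])
       (simp only: add_0 a_Ck)
  have La: "iter_laplacian m a x = - g x" if "norm x \<ge> 2" for x
  proof -
    have "iter_laplacian m a x = iter_laplacian m v x"
      by (rule iter_laplacian_cong[of "{x. norm x > 3/2}"])
         (use that psi1 in \<open>auto simp: a_def intro!: open_Collect_less continuous_intros\<close>)
    then show ?thesis by (simp add: g_def)
  qed
  \<comment> \<open>The cutoff spoils the sign of the m-fold Laplacian only on this fixed annulus,
    so the resulting constant does not depend on \<open>R\<close>.\<close>
  obtain C0 where C0: "C0 \<ge> 0" "\<And>x. 1 \<le> norm x \<Longrightarrow> norm x \<le> 2 \<Longrightarrow> \<bar>iter_laplacian m a x\<bar> \<le> C0"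
  proof -
    have "compact (cball 0 2 \<inter> - ball (0::real^'n) 1)"
      by (intro compact_Int_closed compact_cball closed_Compl open_ball)
    moreover have "cball 0 2 \<inter> - ball (0::real^'n) 1 \<subseteq> U" by auto
    ultimately have "compact (iter_laplacian m a ` (cball 0 2 \<inter> - ball (0::real^'n) 1))"
      using La_c continuous_on_subset by (blast intro: compact_continuous_image)
    then have "bounded (iter_laplacian m a ` (cball 0 2 \<inter> - ball (0::real^'n) 1))" by (rule compact_imp_bounded)
    then obtain B where B: "\<And>x. x \<in> cball 0 2 \<inter> - ball (0::real^'n) 1 \<Longrightarrow> \<bar>iter_laplacian m a x\<bar> \<le> B"
      unfolding bounded_iff ball_simps real_norm_def by blast
    show ?thesis
      by (rule that[of "max B 0"]) (use B in \<open>force intro: max.coboundedI1\<close>)+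
  qed
  define D where "D = 8 * real m * 4 ^ (m - 1) * fact (2 * m - 1)"
  have D: "D > 0" using m0 by (simp add: D_def)
  define c where "c = inverse (2 ^ (3 * m) :: real)"
  have c: "c > 0" by (simp add: c_def)
  define W where "W = measure lborel (ball (0::real^'n) 2)"
  have W: "W \<ge> 0" by (simp add: W_def)
  define r where "r t = inverse (t ^ m)" for t :: real
  have r_c: "continuous_on {0<..} r" unfolding r_def by (intro continuous_intros) auto
  have r0: "r t \<ge> 0" if "t > 0" for t using that by (simp add: r_def)
  have "c * (LINT x:A (R / 2)|lborel. g x * inverse (norm x ^ (2 * m - 2))) \<le> C0 * W \<and>
     D * (3 / 4) * (LINT x:A (R / 2)|lborel. v x) \<le> C0 * W * R ^ (4 * m - 2)" if R: "R \<ge> 4" for R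
  proof -
    define \<kappa> where "\<kappa> = inverse (R\<^sup>2)"
    have k: "\<kappa> > 0" using R by (simp add: \<kappa>_def)
    define s where "s x = \<kappa> * (norm (x - 0))\<^sup>2" for x :: "real^'n"
    have s_def': "s x = (norm x / R)\<^sup>2" for x by (simp add: s_def \<kappa>_def divide_inverse_commute power_mult_distrib power_inverse)
    define \<phi> where "\<phi> x = kern m r (s x)" for x
    have s_Ck: "Ck_on j U s" for j unfolding s_def by (rule Ck_on_sq_dist[OF open_U])
    have s_pos: "s x > 0" if "x \<in> U" for x using that k unfolding s_def by (intro mult_pos_pos zero_less_power) auto
    have rs_Ck: "Ck_on j U (\<lambda>x. r (s x))" for j
      unfolding r_def by (rule Ck_on_inverse[OF open_U Ck_on_power[OF open_U s_Ck]]) (use s_pos in force)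
    have phi_Ck: "Ck_on (2 * m) U \<phi>"
      unfolding \<phi>_def by (rule Ck_on_kern[OF open_U r_c _ m0(1) s_Ck s_pos rs_Ck]) auto
    have phi0: "\<phi> x = 0" if "x \<in> U - cball 0 R" for x
    proof -
      have "1 \<le> norm x / R" using that R by simp
      then have "1 \<le> s x" unfolding s_def' by (rule one_le_power)
      then show ?thesis by (simp add: \<phi>_def kern_eq_0)
    qed
    have phi_nonneg: "\<phi> x \<ge> 0" if "x \<in> U" for x
      unfolding \<phi>_def by (rule kern_nonneg[OF r_c _ s_pos[OF that] m0(1)]) (use r0 in auto)
    let ?K = "- ball 0 1 \<inter> cball (0::real^'n) R"
    have K: "compact ?K" "?K \<subseteq> U" by (intro closed_Int_compact compact_cball closed_Compl open_ball) auto
    \<comment> \<open>\<open>a\<close> vanishes inside the unit ball and \<open>\<phi>\<close>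
      outside the ball of radius \<open>R\<close>; only the shell between them remains.\<close>
    have I: "(LINT x:?K|lborel. \<phi> x * iter_laplacian m a x) = (LINT x:?K|lborel. a x * iter_laplacian m \<phi> x)"
      by (rule integral_mult_iter_laplacian[OF open_U _ _ K a_Ck _ phi_Ck]) (use a0 phi0 in auto)
    have Lphi: "iter_laplacian m \<phi> x = \<kappa> ^ m * (D * (1 - s x))" if "x \<in> U" "norm x < R" for x
    proof -
      have "s x \<in> {0<..<1}" using s_pos that R by (auto simp: s_def' power_less_one_iff)
      then show ?thesis
        using iter_laplacian_radial[OF _ half_card rlapn_kern_power[OF m0(2)], of \<kappa> x 0]
        unfolding \<phi>_def r_def s_def D_def by simp
    qed
    have Lphi_c: "continuous_on U (iter_laplacian m \<phi>)"
      by (rule Ck_on_imp_continuous_on[of 0], rule Ck_on_iter_laplacian[OF open_U])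
         (simp only: add_0 phi_Ck)
    have A: "A (R / 2) \<subseteq> U" "A (R / 2) \<subseteq> ?K" using R by auto
    have c_phi: "continuous_on U \<phi>" and c_a: "continuous_on U a"
      using Ck_on_imp_continuous_on phi_Ck a_Ck by blast+
    have int1: "integrable lborel (\<lambda>x. indicator ?K x * (\<phi> x * iter_laplacian m a x))"
      by (intro integrable_indicator_compact K continuous_on_mult continuous_on_subset[OF c_phi K(2)] continuous_on_subset[OF La_c K(2)])
    have int2: "integrable lborel (\<lambda>x. indicator ?K x * (a x * iter_laplacian m \<phi> x))"
      by (intro integrable_indicator_compact K continuous_on_mult continuous_on_subset[OF c_a K(2)] continuous_on_subset[OF Lphi_c K(2)])
    have int3: "integrable lborel (\<lambda>x. indicator (A (R / 2)) x * v x)"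
      by (intro integrable_indicator_compact compact_A continuous_on_subset[OF continuous_v A(1)])
    have int4: "integrable lborel (\<lambda>x. indicator (A (R / 2)) x * (g x * inverse (norm x ^ (2 * m - 2))))"
      by (intro integrable_indicator_compact compact_A continuous_on_mult continuous_on_subset[OF continuous_g A(1)]
         continuous_on_inverse continuous_on_power continuous_on_norm continuous_on_id) auto
    define iv where "iv = (LINT x:A (R / 2)|lborel. v x)"
    define ig where "ig = (LINT x:A (R / 2)|lborel. g x * inverse (norm x ^ (2 * m - 2)))"
    have iv0: "iv \<ge> 0" unfolding iv_def set_integral_indicator
      by (intro integral_nonneg_AE AE_I2) (use v_nonneg in \<open>auto simp: indicator_def\<close>)
    have ig0: "ig \<ge> 0" unfolding ig_def set_integral_indicator
      by (intro integral_nonneg_AE AE_I2) (use g_nonneg' in \<open>auto simp: indicator_def intro!: mult_nonneg_nonneg\<close>)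
    have lower: "\<kappa> ^ m * D * (3 / 4) * iv \<le> (LINT x:?K|lborel. a x * iter_laplacian m \<phi> x)"
    proof -
      have "\<kappa> ^ m * D * (3 / 4) * iv = (LINT x|lborel. \<kappa> ^ m * D * (3 / 4) * (indicator (A (R / 2)) x * v x))"
        unfolding iv_def set_integral_indicator by simp
      also have "\<dots> \<le> (LINT x|lborel. indicator ?K x * (a x * iter_laplacian m \<phi> x))"
      proof (rule integral_mono_AE)
        show "AE x in lborel. \<kappa> ^ m * D * (3 / 4) * (indicator (A (R / 2)) x * v x) \<le> indicator ?K x * (a x * iter_laplacian m \<phi> x)"
          using AE_not_on_sphere[of 0 R]
        proof eventually_elim
          fix x :: "real^'n" assume x: "norm (x - 0) \<noteq> R"
          consider "x \<in> A (R / 2)" | "x \<in> ?K" "x \<notin> A (R / 2)" | "x \<notin> ?K" using A by blast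
          then show "\<kappa> ^ m * D * (3 / 4) * (indicator (A (R / 2)) x * v x) \<le> indicator ?K x * (a x * iter_laplacian m \<phi> x)"
          proof cases
            case 1
            have xK: "x \<in> ?K" "x \<in> U" "norm x < R" "a x = v x" using 1 A R psi1[of x] by (auto simp: a_def)
            have "norm x / R \<le> 1 / 2" using 1 R by (auto simp: field_simps)
            then have "s x \<le> (1 / 2)\<^sup>2" unfolding s_def' using R by (intro power_mono) auto
            then have "3 / 4 \<le> 1 - s x" by (simp add: power2_eq_square)
            then have "(\<kappa> ^ m * D * v x) * (3 / 4) \<le> (\<kappa> ^ m * D * v x) * (1 - s x)"
              using k D v_nonneg xK by (intro mult_left_mono) auto
            then show ?thesis using 1 xK Lphi[OF xK(2,3)] by (simp add: mult_ac)
          next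
            case 2
            then have xU: "x \<in> U" "norm x < R" using x by auto
            have "s x \<le> 1" unfolding s_def' using R xU by (intro power_le_one) auto
            then show ?thesis using 2 Lphi[OF xU] a_nonneg[OF xU(1)] k D by auto
          next
            case 3
            then have "x \<notin> A (R / 2)" using A by blast
            then show ?thesis using 3 by simp
          qed
        qed
      qed (use int2 int3 in auto)
      finally show ?thesis by (simp add: set_integral_indicator)
    qed
    \<comment> \<open>\<open>q\<close> equals R^(n-2), the size of \<open>\<phi>\<close> near the
      unit sphere: on the shell \<open>\<phi>\<close> is at most \<open>q * |x|^(2-n)\<close>, and
      for \<open>|x| \<le> R / 2\<close> it is at least \<open>c\<close> times that.\<close>
    define q where "q = inverse (\<kappa> ^ (m - 1))"
    have q: "q > 0" using k by (simp add: q_def)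
    have upper: "(LINT x:?K|lborel. \<phi> x * iter_laplacian m a x) \<le> C0 * q * W - c * q * ig"
    proof -
      have "(LINT x:?K|lborel. \<phi> x * iter_laplacian m a x) \<le>
        (LINT x|lborel. C0 * q * indicator (ball (0::real^'n) 2) x - c * q * (indicator (A (R / 2)) x * (g x * inverse (norm x ^ (2 * m - 2)))))"
        unfolding set_integral_indicator
      proof (rule integral_mono)
        fix x :: "real^'n"
        have ub: "\<phi> x \<le> q" if "x \<in> ?K"
        proof -
          have xx: "1 \<le> norm x" "norm x \<le> R" "x \<in> U" using that by auto
          have "\<phi> x \<le> inverse (s x ^ (m - 1))"
            unfolding \<phi>_def r_def
            by (rule kern_power_le[OF m0(2) s_pos[OF xx(3)]]) (use xx R in \<open>auto simp: s_def' power_le_one\<close>)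
          also have "\<dots> \<le> q" unfolding q_def
          proof (intro le_imp_inverse_le power_mono)
            have "1 \<le> (norm x)\<^sup>2" using xx by (intro one_le_power)
            then show "\<kappa> \<le> s x" using k by (simp add: s_def)
          qed (use k in auto)
          finally show ?thesis .
        qed
        consider "x \<in> ?K" "norm x < 2" | "x \<in> ?K" "norm x \<ge> 2" "x \<notin> A (R / 2)" | "x \<in> A (R / 2)" | "x \<notin> ?K" using A by fastforce
        then show "indicator ?K x * (\<phi> x * iter_laplacian m a x) \<le>
          C0 * q * indicator (ball 0 2) x - c * q * (indicator (A (R / 2)) x * (g x * inverse (norm x ^ (2 * m - 2))))"
        proof cases
          case 1
          then have "\<phi> x * iter_laplacian m a x \<le> q * C0"
          proof -
            have "x \<in> U" "\<phi> x \<le> q" using 1 ub by auto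
            then have "\<phi> x * iter_laplacian m a x \<le> \<phi> x * C0"
              using 1 C0(2)[of x] by (intro mult_left_mono phi_nonneg) auto
            also have "\<dots> \<le> q * C0" using \<open>\<phi> x \<le> q\<close> C0(1) by (rule mult_right_mono)
            finally show ?thesis .
          qed
          then show ?thesis using 1 by (auto simp: mult.commute)
        next
          \<comment> \<open>Between \<open>R / 2\<close> and \<open>R\<close> the kernel has no
            useful lower bound; the sign of \<open>\<phi> * g\<close> is enough to discard this
            part.\<close>
          case 2
          then have "x \<in> U" by auto
          then have "\<phi> x * g x \<ge> 0" by (intro mult_nonneg_nonneg phi_nonneg g_nonneg')
          then show ?thesis using 2 La[of x] by auto
        next
          case 3
          have xK: "x \<in> ?K" "x \<in> U" "norm x \<ge> 2" using 3 A by auto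
          have "norm x / R \<le> 1 / 2" using 3 R by (auto simp: field_simps)
          then have "s x \<le> (1 / 2)\<^sup>2" unfolding s_def' using R by (intro power_mono) auto
          then have "s x \<le> 1 / 4" by (simp add: power2_eq_square)
          then have "c * inverse (s x ^ (m - 1)) \<le> \<phi> x"
            unfolding c_def \<phi>_def r_def by (rule kern_power_ge[OF m0(1) s_pos[OF xK(2)]])
          moreover have "inverse (s x ^ (m - 1)) = q * inverse (norm x ^ (2 * m - 2))"
          proof -
            have "2 * m - 2 = 2 * (m - 1)" by simp
            then show ?thesis unfolding s_def q_def by (simp add: power_mult_distrib power_mult[symmetric])
          qed
          ultimately have "c * (q * inverse (norm x ^ (2 * m - 2))) \<le> \<phi> x"
            by (simp only:)
          then have "(c * (q * inverse (norm x ^ (2 * m - 2)))) * g x \<le> \<phi> x * g x"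
            by (rule mult_right_mono[OF _ g_nonneg'[OF xK(2)]])
          then show ?thesis using 3 xK La[of x] by (simp add: mult_ac)
        next
          case 4
          then have "x \<notin> A (R / 2)" using A by blast
          then show ?thesis using 4 C0 q by simp
        qed
      next
        show "integrable lborel (\<lambda>x. C0 * q * indicator (ball (0::real^'n) 2) x - c * q * (indicator (A (R / 2)) x * (g x * inverse (norm x ^ (2 * m - 2)))))"
          using int4 emeasure_lborel_ball_finite[of "0::real^'n" 2] by (intro Bochner_Integration.integrable_diff integrable_mult_right integrable_real_indicator) auto
      qed (rule int1)
      also have "\<dots> = C0 * q * W - c * q * ig"
        unfolding ig_def W_def set_integral_indicator using int4 emeasure_lborel_ball_finite[of "0::real^'n" 2]
        by (subst Bochner_Integration.integral_diff) auto
      finally show ?thesis .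
    qed
    have main: "\<kappa> ^ m * D * (3 / 4) * iv + c * q * ig \<le> C0 * q * W" using lower upper I by linarith
    have "0 \<le> \<kappa> ^ m * D * (3 / 4) * iv" using k D iv0 by auto
    then have "q * (c * ig) \<le> q * (C0 * W)" using main by (simp add: mult_ac)
    then have 1: "c * ig \<le> C0 * W" using q by simp
    have "0 \<le> c * q * ig" using c q ig0 by auto
    then have "\<kappa> ^ m * (D * (3 / 4) * iv) \<le> q * (C0 * W)" using main by (simp add: mult_ac)
    then have "inverse (\<kappa> ^ m) * (\<kappa> ^ m * (D * (3 / 4) * iv)) \<le> inverse (\<kappa> ^ m) * (q * (C0 * W))"
      using k by (intro mult_left_mono) auto
    moreover have "inverse (\<kappa> ^ m) * q = R ^ (4 * m - 2)"
    proof -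
      \<comment> \<open>One factor R^n compensates \<open>\<kappa> ^ m\<close>, the other R^(n-2) is
        \<open>q\<close>; divided by the volume of the ball this is a mean of order R^(n-2).\<close>
      have "4 * m - 2 = 2 * m + 2 * (m - 1)" using m0 by auto
      then show ?thesis unfolding q_def \<kappa>_def by (simp only: power_add power_mult power_inverse inverse_inverse_eq)
    qed
    moreover have "inverse (\<kappa> ^ m) * (\<kappa> ^ m * (D * (3 / 4) * iv)) = D * (3 / 4) * iv"
      using k by simp
    ultimately have 2: "D * (3 / 4) * iv \<le> C0 * W * R ^ (4 * m - 2)"
      by (simp only: mult.assoc[symmetric]) (simp only: mult_ac)
    show ?thesis using 1 2 unfolding iv_def ig_def by blast
  qed
  note main = this
  let ?C = "max (C0 * W / c) (C0 * W / (D * (3 / 4)))"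
  show ?thesis
  proof (intro exI[of _ ?C] conjI allI impI)
    show "0 \<le> ?C" using C0 W c by (auto intro: max.coboundedI1)
    fix R :: real assume R: "4 \<le> R"
    have "(LINT x:A (R / 2)|lborel. g x * inverse (norm x ^ (2 * m - 2))) \<le> C0 * W / c"
      using main[OF R] c by (simp add: field_simps)
    then show "(LINT x:A (R / 2)|lborel. g x * inverse (norm x ^ (2 * m - 2))) \<le> ?C" by simp
    have "(LINT x:A (R / 2)|lborel. v x) \<le> C0 * W / (D * (3 / 4)) * R ^ (4 * m - 2)"
      using main[OF R] D by (simp add: field_simps)
    also have "\<dots> \<le> ?C * R ^ (4 * m - 2)" using R by (intro mult_right_mono) auto
    finally show "(LINT x:A (R / 2)|lborel. v x) \<le> ?C * R ^ (4 * m - 2)" .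
  qed
qed

end

section \<open>Integrability of the logarithmic singularity\<close>

lemma content_cball_eq:
  fixes z :: "'a::euclidean_space"
  assumes "\<rho> \<ge> 0"
  shows "measure lborel (cball z \<rho>) = unit_ball_vol (real DIM('a)) * \<rho> ^ DIM('a)"
proof -
  have "emeasure lborel (cball z \<rho>) = ennreal (unit_ball_vol (real DIM('a)) * \<rho> ^ DIM('a))"
    by (rule emeasure_cball[OF assms])
  then show ?thesis unfolding measure_def using assms by (simp add: enn2real_ennreal)
qed

text \<open>Dyadic layers \<open>cball z (\<rho> / 2 ^ k)\<close> make the logarithm integrable.\<close>
lemma log_dominated:
  fixes z :: "'a::euclidean_space"
  assumes r: "\<rho> > 0"
  shows "\<exists>S. integrable lborel S \<and>
     (LINT x|lborel. S x) \<le> 4 * ln 2 * unit_ball_vol (real DIM('a)) * \<rho> ^ DIM('a) \<and>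
     (\<forall>x. x \<noteq> z \<longrightarrow> 0 \<le> S x \<and> (norm (x - z) \<le> \<rho> \<longrightarrow> 2 * ln (\<rho> / norm (x - z)) \<le> S x))"
proof -
  define w where "w = unit_ball_vol (real DIM('a))"
  have w: "w \<ge> 0" by (simp add: w_def)
  define f :: "nat \<Rightarrow> 'a \<Rightarrow> real" where "f k x = 2 * ln 2 * indicator (cball z (\<rho> / 2 ^ k)) x" for k x
  have f0: "f k x \<ge> 0" for k x by (simp add: f_def)
  have fi: "integrable lborel (f k)" for k
    unfolding f_def using emeasure_lborel_cball_finite[of z "\<rho> / 2 ^ k"]
    by (intro integrable_mult_right integrable_real_indicator) auto
  have fI: "(LINT x|lborel. f k x) = 2 * ln 2 * w * (\<rho> / 2 ^ k) ^ DIM('a)" for k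
    unfolding f_def using r by (simp add: content_cball_eq w_def)
  have fle: "(LINT x|lborel. f k x) \<le> 2 * ln 2 * w * \<rho> ^ DIM('a) * (1 / 2) ^ k" for k
  proof -
    \<comment> \<open>A dimension of at least 1 already makes the volumes decay geometrically with
      ratio 1/2. The sum 2 of the series turns \<open>2 * ln 2\<close> into
      \<open>4 * ln 2\<close>.\<close>
    have "(1 / 2 ^ k) ^ DIM('a) \<le> (1 / 2 ^ k :: real) ^ 1"
      by (intro power_decreasing) (auto simp: Suc_le_eq)
    then have "\<rho> ^ DIM('a) * (1 / 2 ^ k) ^ DIM('a) \<le> \<rho> ^ DIM('a) * (1 / 2) ^ k"
      using r by (intro mult_left_mono) (auto simp: power_divide)
    from mult_left_mono[OF this, of "2 * ln 2 * w"]
    have "(2 * ln 2 * w) * (\<rho> ^ DIM('a) * (1 / 2 ^ k) ^ DIM('a)) \<le> (2 * ln 2 * w) * (\<rho> ^ DIM('a) * (1 / 2) ^ k)"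
      using w by simp
    then show ?thesis unfolding fI by (simp add: power_divide mult_ac)
  qed
  have geo: "summable (\<lambda>k. 2 * ln 2 * w * \<rho> ^ DIM('a) * (1 / 2) ^ k)"
    by (intro summable_mult summable_geometric) auto
  have norms: "(LINT x|lborel. norm (f k x)) = (LINT x|lborel. f k x)" for k
    using f0 by simp
  have sum1: "summable (\<lambda>k. LINT x|lborel. norm (f k x))"
    unfolding norms by (rule summable_comparison_test'[OF geo, of 0]) (use fle f0 in \<open>auto simp: integral_nonneg_AE\<close>)
  \<comment> \<open>A point other than \<open>z\<close> lies in finitely many layers, so the series
    is a finite sum there; \<open>z\<close> itself is a null set.\<close>
  have out: "f k x = 0" if "x \<noteq> z" "k > nat \<lceil>log 2 (\<rho> / norm (x - z))\<rceil>" for k x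
  proof -
    have n: "norm (x - z) > 0" using that by simp
    have "log 2 (\<rho> / norm (x - z)) < real k" using that(2) by linarith
    then have "\<rho> / norm (x - z) < 2 powr real k" using r n by (simp add: log_less_iff)
    then have "\<rho> / 2 ^ k < norm (x - z)" using n by (simp add: powr_realpow field_simps)
    then show ?thesis by (simp add: f_def dist_norm norm_minus_commute)
  qed
  have summ: "summable (\<lambda>k. f k x)" if "x \<noteq> z" for x
    by (rule summable_finite[of "{.. nat \<lceil>log 2 (\<rho> / norm (x - z))\<rceil>}"]) (use out[OF that] in \<open>auto simp: not_le\<close>)
  have AEs: "AE x in lborel. summable (\<lambda>k. norm (f k x))"
    using AE_lborel_singleton[of z] by eventually_elim (use summ f0 in simp)
  define S where "S x = (\<Sum>k. f k x)" for x
  have "integrable lborel S"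
    unfolding S_def by (rule integrable_suminf[OF fi AEs sum1])
  moreover have "(LINT x|lborel. S x) \<le> 4 * ln 2 * w * \<rho> ^ DIM('a)"
  proof -
    have "(LINT x|lborel. S x) = (\<Sum>k. LINT x|lborel. f k x)"
      unfolding S_def by (rule integral_suminf[OF fi AEs sum1])
    also have "\<dots> \<le> (\<Sum>k. 2 * ln 2 * w * \<rho> ^ DIM('a) * (1 / 2) ^ k)"
      using sum1 unfolding norms by (intro suminf_le fle geo) 
    also have "\<dots> = 2 * ln 2 * w * \<rho> ^ DIM('a) * 2"
      by (subst suminf_mult) (auto simp: suminf_geometric)
    finally show ?thesis by simp
  qed
  moreover have "0 \<le> S x" if "x \<noteq> z" for x
    unfolding S_def by (rule suminf_nonneg[OF summ[OF that] f0])
  moreover have "2 * ln (\<rho> / norm (x - z)) \<le> S x" if "x \<noteq> z" "norm (x - z) \<le> \<rho>" for x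
  proof -
    have n: "norm (x - z) > 0" using that by simp
    define t where "t = log 2 (\<rho> / norm (x - z))"
    have "1 \<le> \<rho> / norm (x - z)" using n that by simp
    then have t0: "t \<ge> 0" unfolding t_def by (subst zero_le_log_cancel_iff) auto
    define N where "N = nat \<lfloor>t\<rfloor>"
    have N: "real N \<le> t" "t < real N + 1" using t0 by (auto simp: N_def)
    \<comment> \<open>All \<open>N + 1\<close> layers with index up to \<open>N\<close> contain
      \<open>x\<close>, which covers \<open>t < N + 1\<close>.\<close>
    have one: "f k x = 2 * ln 2" if "k \<le> N" for k
    proof -
      have "real k \<le> t" using that N by simp
      then have "2 powr real k \<le> \<rho> / norm (x - z)" unfolding t_def using r n by (simp add: le_log_iff)
      then have "norm (x - z) \<le> \<rho> / 2 ^ k" using n by (simp add: powr_realpow field_simps)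
      then show ?thesis by (simp add: f_def dist_norm norm_minus_commute)
    qed
    have "2 * ln (\<rho> / norm (x - z)) = 2 * ln 2 * t" by (simp add: t_def log_def)
    also have "\<dots> \<le> 2 * ln 2 * (real N + 1)" using N by (intro mult_left_mono) auto
    also have "\<dots> = (\<Sum>k\<le>N. f k x)" using one by simp
    also have "\<dots> \<le> S x" unfolding S_def by (rule sum_le_suminf[OF summ[OF that(1)]]) (use f0 in auto)
    finally show ?thesis .
  qed
  ultimately show ?thesis unfolding w_def by blast
qed

section \<open>Mass of g far out and pointwise bounds for v\<close>

context exterior
begin

text \<open>The weighted masses \<open>I T\<close> are bounded, so beyond some \<open>T0\<close>
  less than \<open>\<eta>'\<close> remains below their supremum. On a ball where
  \<open>norm x \<le> 3 * R\<close> the weight is at least (3R)^(2-n), so removing it costs 3^(n-2);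
  this factor is built into \<open>\<eta>'\<close>.\<close>

lemma g_tail:
  assumes eta: "\<eta> > 0"
  shows "\<exists>R0\<ge>2. \<forall>y R. 0 < R \<longrightarrow> cball y R \<subseteq> {x. R0 < norm x \<and> norm x \<le> 3 * R} \<longrightarrow>
    (LINT x:cball y R|lborel. g x) \<le> \<eta> * R ^ (2 * m - 2)"
proof -
  define h where "h x = g x * inverse (norm x ^ (2 * m - 2))" for x
  define I where "I T = (LINT x:A T|lborel. h x)" for T
  obtain C where C: "\<And>R. R \<ge> 4 \<Longrightarrow> I (R / 2) \<le> C"
    using weighted_estimates unfolding I_def h_def by blast
  have bound: "I T \<le> C" if "T \<ge> 2" for T using C[of "2 * T"] that by simp
  have bdd: "bdd_above (I ` {2..})" using bound by (intro bdd_aboveI2[of _ _ C]) auto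
  define S where "S = (SUP T\<in>{2..}. I T)"
  define \<eta>' where "\<eta>' = \<eta> / 3 ^ (2 * m - 2)"
  have "S - \<eta>' < S" using eta by (simp add: \<eta>'_def)
  then obtain T0 where T0: "T0 \<ge> 2" "S - \<eta>' < I T0"
    unfolding S_def using less_cSUP_iff[OF _ bdd, of "S - \<eta>'"] by (auto simp: S_def)
  have AU: "A T \<subseteq> U" for T by auto
  have h_c: "continuous_on U h" unfolding h_def
    by (intro continuous_on_mult continuous_g continuous_on_inverse continuous_on_power continuous_on_norm continuous_on_id) auto
  have intA: "integrable lborel (\<lambda>x. indicator (A T) x * h x)" for T
    by (intro integrable_indicator_compact compact_A continuous_on_subset[OF h_c AU])
  have h0: "h x \<ge> 0" if "x \<in> U" for x
    using g_nonneg that unfolding h_def g_def by (intro mult_nonneg_nonneg) auto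
  show ?thesis
  proof (intro exI[of _ T0] conjI allI impI T0(1))
    fix y :: "real^'n" and R :: real assume R: "0 < R" and sub: "cball y R \<subseteq> {x. T0 < norm x \<and> norm x \<le> 3 * R}"
    \<comment> \<open>Large enough for \<open>A T\<close> to contain both \<open>A T0\<close> and
      the ball, which are disjoint.\<close>
    define T where "T = max T0 (3 * R)"
    have KU: "cball y R \<subseteq> U" using sub T0 by force
    have "I T \<le> S" unfolding S_def using bdd T0 by (intro cSUP_upper) (auto simp: T_def)
    have intK: "integrable lborel (\<lambda>x. indicator (cball y R) x * h x)"
      by (intro integrable_indicator_compact compact_cball continuous_on_subset[OF h_c KU])
    have "(LINT x|lborel. indicator (cball y R) x * h x) + I T0 =
        (LINT x|lborel. indicator (cball y R) x * h x + indicator (A T0) x * h x)"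
      unfolding I_def set_integral_indicator using intK intA by simp
    also have "\<dots> \<le> (LINT x|lborel. indicator (A T) x * h x)"
    proof (rule integral_mono)
      fix x
      consider "x \<in> cball y R" | "x \<notin> cball y R" "x \<in> A T0" | "x \<notin> cball y R" "x \<notin> A T0" by blast
      then show "indicator (cball y R) x * h x + indicator (A T0) x * h x \<le> indicator (A T) x * h x"
      proof cases
        case 1
        then have "T0 < norm x" "norm x \<le> 3 * R" using sub by auto
        then have "x \<notin> A T0" "x \<in> A T" using T0 by (auto simp: T_def)
        then show ?thesis using 1 by simp
      next
        case 2
        then have "x \<in> A T" by (auto simp: T_def)
        then show ?thesis using 2 by simp
      next
        case 3
        then show ?thesis using h0 AU by (auto simp: indicator_def)
      qed
    qed (use intK intA in auto)
    also have "\<dots> = I T" by (simp add: I_def set_integral_indicator)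
    finally have small: "(LINT x|lborel. indicator (cball y R) x * h x) \<le> \<eta>'"
      using \<open>I T \<le> S\<close> T0 by linarith
    have "(LINT x:cball y R|lborel. g x) \<le> (LINT x|lborel. (3 * R) ^ (2 * m - 2) * (indicator (cball y R) x * h x))"
      unfolding set_integral_indicator
    proof (rule integral_mono)
      show "integrable lborel (\<lambda>x. indicator (cball y R) x * g x)"
        by (intro integrable_indicator_compact compact_cball continuous_on_subset[OF continuous_g KU])
      fix x
      show "indicator (cball y R) x * g x \<le> (3 * R) ^ (2 * m - 2) * (indicator (cball y R) x * h x)"
      proof (cases "x \<in> cball y R")
        case True
        then have x: "T0 < norm x" "norm x \<le> 3 * R" "x \<in> U" using sub KU by auto
        have "norm x ^ (2 * m - 2) \<noteq> 0" using x T0 by auto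
        moreover have "p \<noteq> 0 \<Longrightarrow> g x = p * (g x * inverse p)" for p by simp
        ultimately have "g x = norm x ^ (2 * m - 2) * h x" unfolding h_def by blast
        also have "\<dots> \<le> (3 * R) ^ (2 * m - 2) * h x"
          using x h0 by (intro mult_right_mono power_mono) auto
        finally show ?thesis using True by simp
      qed simp
    qed (use intK in simp)
    also have "\<dots> = (3 * R) ^ (2 * m - 2) * (LINT x|lborel. indicator (cball y R) x * h x)" by simp
    also have "\<dots> \<le> (3 * R) ^ (2 * m - 2) * \<eta>'" using small R by (intro mult_left_mono) auto
    also have "\<dots> = \<eta> * R ^ (2 * m - 2)" by (simp add: \<eta>'_def power_mult_distrib)
    finally show "(LINT x:cball y R|lborel. g x) \<le> \<eta> * R ^ (2 * m - 2)" .
  qed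
qed

text \<open>Here \<open>e \<rightarrow> 0\<close>: the bubbles \<open>e ^ m * (s + e) ^ (- 2 * m)\<close> concentrate at \<open>y\<close>.\<close>

lemma local_bound:
  "\<exists>C\<ge>0. \<forall>y R J. 0 < R \<longrightarrow> cball y R \<subseteq> U \<longrightarrow> 0 \<le> J \<longrightarrow>
    (\<forall>e\<in>{0<..1}. (LINT x:cball y R|lborel. kern m (\<lambda>t. inverse (t + e)) (inverse (R\<^sup>2) * (norm (x - y))\<^sup>2) * g x) \<le> J) \<longrightarrow>
    v y \<le> C * (J + inverse (R\<^sup>2) ^ m * (LINT x:cball y R|lborel. v x))"
proof -
  obtain C1 where C1: "C1 \<ge> 0" "\<And>e. e \<in> {0<..1} \<Longrightarrow> \<exists>k. rlapn (real m) {-e<..<1} m (kern m (\<lambda>t. inverse (t + e))) k \<and>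
    (\<forall>s\<in>{0..1}. - k s \<ge> 4 ^ m * fact (2 * m - 1) * e ^ m * inverse (s + e) ^ (2 * m) - C1)"
    using rlapn_kern_log[OF odd_m] by blast
  define B where "B = (4 ^ m * fact (2 * m - 1) :: real)"
  have B: "B > 0" by (simp add: B_def)
  define w where "w = unit_ball_vol (real CARD('n))"
  have w: "w > 0" by (simp add: w_def)
  \<comment> \<open>The mass of the bubble on the ball of radius \<open>R * q\<close>, bounded below
    with \<open>s \<le> e\<close>: the powers of \<open>R\<close> and of \<open>q\<close> cancel,
    which is the scale invariance of the bubble in dimension 2m. The factor 1/2 comes from
    \<open>v x > v y / 2\<close>.\<close>
  define \<beta> where "\<beta> = B * inverse (4 ^ m) * w / 2"
  have beta: "\<beta> > 0" using B w by (simp add: \<beta>_def)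
  have m0: "m \<ge> 1" using m3 by simp
  have "\<beta> * v y \<le> J + C1 * (inverse (R\<^sup>2) ^ m * (LINT x:cball y R|lborel. v x))"
    if R: "R > 0" and KU: "cball y R \<subseteq> U" and J: "0 \<le> J"
      "\<And>e. e \<in> {0<..1} \<Longrightarrow> (LINT x:cball y R|lborel. kern m (\<lambda>t. inverse (t + e)) (inverse (R\<^sup>2) * (norm (x - y))\<^sup>2) * g x) \<le> J"
    for y R J
  proof -
    define \<kappa> where "\<kappa> = inverse (R\<^sup>2)"
    have k: "\<kappa> > 0" using R by (simp add: \<kappa>_def)
    define iv where "iv = (LINT x:cball y R|lborel. v x)"
    have iv0: "iv \<ge> 0" unfolding iv_def set_integral_indicator
      by (intro integral_nonneg_AE AE_I2) (use v_nonneg KU in \<open>auto simp: indicator_def\<close>)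
    have yU: "y \<in> U" using KU R by (meson centre_in_cball less_imp_le subsetD)
    show ?thesis
    proof (cases "v y = 0")
      case True
      then show ?thesis using J(1) C1(1) k iv0 unfolding \<kappa>_def[symmetric] iv_def[symmetric] by simp
    next
      case False
      then have vy: "v y > 0" using v_nonneg[of y] yU by auto
      have "isCont v y" using continuous_v open_U yU by (simp add: continuous_on_eq_continuous_at)
      then have "\<forall>\<^sub>F x in nhds y. v x > v y / 2"
        using vy order_tendstoD(1)[of v "v y" "nhds y" "v y / 2"]
        by (simp add: isCont_def tendsto_at_iff_tendsto_nhds)
      then obtain d where d: "d > 0" "\<And>x. dist x y < d \<Longrightarrow> v x > v y / 2"
        unfolding eventually_nhds_metric by auto
      \<comment> \<open>No limit in \<open>e\<close> is taken: a single bubble of width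
        \<open>R * q\<close> below the continuity radius \<open>d\<close> suffices, since the bound
        on the right is assumed for every \<open>e\<close>.\<close>
      define q where "q = min 1 (d / (2 * R))"
      have q: "q > 0" "q \<le> 1" "R * q < d"
      proof -
        show "q > 0" "q \<le> 1" using d R by (auto simp: q_def)
        have "R * q \<le> R * (d / (2 * R))" using R by (intro mult_left_mono) (auto simp: q_def)
        then show "R * q < d" using d R by simp
      qed
      define e where "e = q\<^sup>2"
      have e: "e \<in> {0<..1}" using q by (auto simp: e_def power_le_one)
      obtain kk where kk: "rlapn (real m) {-e<..<1} m (kern m (\<lambda>t. inverse (t + e))) kk"
        "\<And>s. s \<in> {0..1} \<Longrightarrow> - kk s \<ge> B * e ^ m * inverse (s + e) ^ (2 * m) - C1"
        using C1(2)[OF e] unfolding B_def by blast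
      define s where "s x = \<kappa> * (norm (x - y))\<^sup>2" for x
      have s_def': "s x = (norm (x - y) / R)\<^sup>2" for x
        by (simp add: s_def \<kappa>_def divide_inverse_commute power_mult_distrib power_inverse)
      have s0: "s x \<ge> 0" for x using k by (simp add: s_def)
      define E where "E x = kern m (\<lambda>t. inverse (t + e)) (s x)" for x
      have r_c: "continuous_on {-e<..} (\<lambda>t. inverse (t + e))" by (intro continuous_intros) auto
      have s_Ck: "Ck_on j U s" for j unfolding s_def by (rule Ck_on_sq_dist[OF open_U])
      have s_lo: "s x > - e" for x using s0[of x] e by auto
      have se: "s x + e \<noteq> 0" for x using s_lo[of x] by auto
      have rs_Ck: "Ck_on j U (\<lambda>x. inverse (s x + e))" for j
        by (rule Ck_on_inverse[OF open_U Ck_on_add[OF open_U s_Ck Ck_on_const[OF open_U]] se])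
      have E_Ck: "Ck_on (2 * m) U E"
        unfolding E_def by (rule Ck_on_kern[OF open_U r_c _ m0 s_Ck s_lo rs_Ck]) (use e in auto)
      have E0: "E x = 0" if "x \<in> U - cball y R" for x
      proof -
        have "1 \<le> norm (x - y) / R" using that R by (simp add: dist_norm norm_minus_commute)
        then have "1 \<le> s x" unfolding s_def' by (rule one_le_power)
        then show ?thesis by (simp add: E_def kern_eq_0)
      qed
      \<comment> \<open>No cutoff of \<open>v\<close> is required, hence the closed set
        \<open>UNIV\<close>: the support of \<open>E\<close> already lies inside
        \<open>U\<close>.\<close>
      have "(LINT x:(UNIV \<inter> cball y R)|lborel. E x * iter_laplacian m v x) = (LINT x:(UNIV \<inter> cball y R)|lborel. v x * iter_laplacian m E x)"
        by (rule integral_mult_iter_laplacian[OF open_U _ _ _ _ Ck_v _ E_Ck]) (use E0 KU in auto)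
      then have I: "(LINT x:cball y R|lborel. E x * iter_laplacian m v x) = (LINT x:cball y R|lborel. v x * iter_laplacian m E x)" by simp
      have LE: "- iter_laplacian m E x \<ge> \<kappa> ^ m * (B * e ^ m * inverse (s x + e) ^ (2 * m) - C1)" if "norm (x - y) < R" for x
      proof -
        have "s x < 1" using that R by (simp add: s_def' power_less_one_iff)
        then have "iter_laplacian m E x = \<kappa> ^ m * kk (s x)"
          using iter_laplacian_radial[OF _ half_card kk(1), of \<kappa> x y] s_lo[of x] unfolding E_def s_def by simp
        moreover have "\<kappa> ^ m * (B * e ^ m * inverse (s x + e) ^ (2 * m) - C1) \<le> \<kappa> ^ m * (- kk (s x))"
          using kk(2)[of "s x"] s0[of x] \<open>s x < 1\<close> k by (intro mult_left_mono) auto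
        ultimately show ?thesis by simp
      qed
      have LE_c: "continuous_on U (iter_laplacian m E)"
        by (rule Ck_on_imp_continuous_on[of 0], rule Ck_on_iter_laplacian[OF open_U]) (simp only: add_0 E_Ck)
      have intL: "integrable lborel (\<lambda>x. indicator (cball y R) x * (v x * - iter_laplacian m E x))"
        by (intro integrable_indicator_compact compact_cball continuous_on_mult continuous_on_minus
            continuous_on_subset[OF continuous_v KU] continuous_on_subset[OF LE_c KU])
      have intv: "integrable lborel (\<lambda>x. indicator (cball y R) x * v x)"
        by (intro integrable_indicator_compact compact_cball continuous_on_subset[OF continuous_v KU])
      define c where "c = \<kappa> ^ m * (v y / 2 * (B * e ^ m * inverse (2 * e) ^ (2 * m)))"
      have c: "c \<ge> 0" using k vy B e by (simp add: c_def)
      have intP: "integrable lborel (\<lambda>x. c * indicator (cball y (R * q)) x)"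
        using emeasure_lborel_cball_finite[of y "R * q"] by (intro integrable_mult_right integrable_real_indicator) auto
      have "c * measure lborel (cball y (R * q)) - \<kappa> ^ m * C1 * iv =
         (LINT x|lborel. c * indicator (cball y (R * q)) x - \<kappa> ^ m * C1 * (indicator (cball y R) x * v x))"
        using intP intv by (simp add: iv_def set_integral_indicator)
      also have "\<dots> \<le> (LINT x|lborel. indicator (cball y R) x * (v x * - iter_laplacian m E x))"
      proof (rule integral_mono_AE)
        show "AE x in lborel. c * indicator (cball y (R * q)) x - \<kappa> ^ m * C1 * (indicator (cball y R) x * v x)
            \<le> indicator (cball y R) x * (v x * - iter_laplacian m E x)"
          using AE_not_on_sphere[of y R]
        proof eventually_elim
          fix x assume ns: "norm (x - y) \<noteq> R"
          have "R * q \<le> R" using R q by (simp add: mult_left_le)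
          show "c * indicator (cball y (R * q)) x - \<kappa> ^ m * C1 * (indicator (cball y R) x * v x)
            \<le> indicator (cball y R) x * (v x * - iter_laplacian m E x)"
          proof (cases "x \<in> cball y R")
            case False
            then have "x \<notin> cball y (R * q)" using \<open>R * q \<le> R\<close> by auto
            then show ?thesis using False by simp
          next
            case True
            then have x: "norm (x - y) < R" "x \<in> U"
              using ns KU by (simp add: dist_norm norm_minus_commute, blast)
            define z where "z = B * e ^ m * inverse (s x + e) ^ (2 * m)"
            have z: "z \<ge> 0" using B e s0[of x] by (simp add: z_def)
            have "v x * (\<kappa> ^ m * (z - C1)) \<le> v x * - iter_laplacian m E x"
              using LE[OF x(1)] v_nonneg x(2) unfolding z_def by (intro mult_left_mono) auto
            moreover have "c * indicator (cball y (R * q)) x \<le> \<kappa> ^ m * (v x * z)"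
            proof (cases "x \<in> cball y (R * q)")
              case True
              then have "norm (x - y) / R \<le> q" using R by (simp add: dist_norm norm_minus_commute field_simps)
              then have "s x \<le> e" unfolding s_def' e_def using R by (intro power_mono) auto
              then have "inverse (2 * e) ^ (2 * m) \<le> inverse (s x + e) ^ (2 * m)"
                using e s0[of x] by (intro power_mono le_imp_inverse_le) auto
              then have "B * e ^ m * inverse (2 * e) ^ (2 * m) \<le> z"
                unfolding z_def using B e by (intro mult_left_mono) auto
              moreover have "v y / 2 \<le> v x" using d(2)[of x] True q by (auto simp: dist_commute intro: less_imp_le)
              ultimately have "v y / 2 * (B * e ^ m * inverse (2 * e) ^ (2 * m)) \<le> v x * z"
                using vy B e by (intro mult_mono) auto
              then show ?thesis using True k unfolding c_def by (auto intro!: mult_left_mono)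
            next
              case False
              then show ?thesis using k z v_nonneg x(2) by auto
            qed
            ultimately show ?thesis using True by (simp add: algebra_simps)
          qed
        qed
      qed (use intP intv intL in auto)
      also have "\<dots> = - (LINT x:cball y R|lborel. v x * iter_laplacian m E x)"
        unfolding set_integral_indicator by simp
      also have "\<dots> = (LINT x:cball y R|lborel. E x * g x)"
        using I unfolding set_integral_indicator g_def by simp
      also have "\<dots> \<le> J" using J(2)[OF e] unfolding E_def s_def \<kappa>_def .
      finally have "c * measure lborel (cball y (R * q)) \<le> J + C1 * (\<kappa> ^ m * iv)" by (simp add: mult_ac)
      moreover have "c * measure lborel (cball y (R * q)) = \<beta> * v y"
      proof -
        define a b where "a = R ^ (2 * m)" and "b = q ^ (2 * m)"
        have ab: "a > 0" "b > 0" using R q by (auto simp: a_def b_def)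
        have "measure lborel (cball y (R * q)) = w * (a * b)"
          using R q by (subst content_cball_eq) (auto simp: w_def a_def b_def card_n power_mult_distrib)
        moreover have "\<kappa> ^ m = inverse a" by (simp add: \<kappa>_def a_def power_mult power_inverse)
        moreover have "e ^ m = b" by (simp add: e_def b_def power_mult)
        moreover have "inverse (2 * e) ^ (2 * m) = inverse (4 ^ m) * inverse (b * b)"
        proof -
          have "(2 * e) ^ (2 * m) = (2\<^sup>2) ^ m * (e ^ m * e ^ m)"
          proof -
            have "e ^ (2 * m) = e ^ m * e ^ m" by (simp only: mult_2 power_add)
            then show ?thesis by (simp only: power_mult_distrib[of 2 e "2 * m"] power_mult[of 2 2 m])
          qed
          also have "\<dots> = 4 ^ m * (b * b)" using \<open>e ^ m = b\<close> by simp
          finally have "inverse (2 * e) ^ (2 * m) = inverse (4 ^ m * (b * b))" by (simp only: power_inverse)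
          then show ?thesis by (simp only: inverse_mult_distrib)
        qed
        ultimately show ?thesis using ab unfolding c_def \<beta>_def by (simp add: field_simps)
      qed
      ultimately show ?thesis unfolding \<kappa>_def iv_def by simp
    qed
  qed
  note main = this
  show ?thesis
  proof (intro exI[of _ "(1 + C1) / \<beta>"] conjI allI impI)
    show "0 \<le> (1 + C1) / \<beta>" using C1 beta by simp
    fix y :: "real^'n" and R J :: real
    assume *: "0 < R" "cball y R \<subseteq> U" "0 \<le> J"
      "\<forall>e\<in>{0<..1}. (LINT x:cball y R|lborel. kern m (\<lambda>t. inverse (t + e)) (inverse (R\<^sup>2) * (norm (x - y))\<^sup>2) * g x) \<le> J"
    define X where "X = inverse (R\<^sup>2) ^ m * (LINT x:cball y R|lborel. v x)"
    have "0 \<le> (LINT x:cball y R|lborel. v x)" unfolding set_integral_indicator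
      by (intro integral_nonneg_AE AE_I2) (use v_nonneg * in \<open>auto simp: indicator_def\<close>)
    then have X: "X \<ge> 0" unfolding X_def by (intro mult_nonneg_nonneg) auto
    have "\<beta> * v y \<le> J + C1 * X" unfolding X_def using main[of R y J] * by blast
    also have "\<dots> \<le> (1 + C1) * (J + X)" using X C1 *(3) by (simp add: algebra_simps)
    finally show "v y \<le> (1 + C1) / \<beta> * (J + inverse (R\<^sup>2) ^ m * (LINT x:cball y R|lborel. v x))"
      using beta unfolding X_def by (simp add: field_simps)
  qed
qed

text \<open>With R = |z|/2 the kernel is at most 2 ln(R/|x - z|). Outside the ball of radius
  \<open>\<rho>\<close> this is at most \<open>2 * ln (R / \<rho>)\<close>, paid for by the mass
  \<open>M\<close>; inside, the excess is the integrable singularity of \<open>log_dominated\<close>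
  times \<open>G\<close>, and \<open>G * \<rho> \<le> 1\<close> keeps that part down to order ln R.
  The last term is the mean of \<open>v\<close>.\<close>

lemma point_bound:
  "\<exists>C\<ge>0. \<forall>z \<rho> G M. 8 \<le> norm z \<longrightarrow> 0 < \<rho> \<longrightarrow> \<rho> \<le> 1 \<longrightarrow> 0 \<le> G \<longrightarrow> G * \<rho> \<le> 1 \<longrightarrow>
    (\<forall>x\<in>ball z \<rho>. g x \<le> G) \<longrightarrow> (LINT x:cball z (norm z / 2)|lborel. g x) \<le> M \<longrightarrow>
    v z \<le> C * (M * (2 * ln (norm z / 2 / \<rho>)) + (2 * ln (norm z / 2) + 1) + (norm z / 2) ^ (2 * m - 2))"
proof -
  obtain C1 where C1: "C1 \<ge> 0" "\<And>R. R \<ge> 4 \<Longrightarrow> (LINT x:A (R / 2)|lborel. v x) \<le> C1 * R ^ (4 * m - 2)"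
    using weighted_estimates by blast
  obtain C2 where C2: "C2 \<ge> 0" "\<And>y R J. 0 < R \<Longrightarrow> cball y R \<subseteq> U \<Longrightarrow> 0 \<le> J \<Longrightarrow>
    (\<And>e. e \<in> {0<..1} \<Longrightarrow> (LINT x:cball y R|lborel. kern m (\<lambda>t. inverse (t + e)) (inverse (R\<^sup>2) * (norm (x - y))\<^sup>2) * g x) \<le> J) \<Longrightarrow>
    v y \<le> C2 * (J + inverse (R\<^sup>2) ^ m * (LINT x:cball y R|lborel. v x))"
    using local_bound by blast
  define w where "w = unit_ball_vol (real CARD('n))"
  have w: "w \<ge> 0" by (simp add: w_def)
  define c where "c = 4 * ln 2 * w"
  have c: "c \<ge> 0" using w by (simp add: c_def)
  \<comment> \<open>One constant for all terms. The 6 arises because the ball lies in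
    \<open>A (3 * R)\<close>, which is the shell of \<open>weighted_estimates\<close> for the radius
    \<open>6 * R\<close>.\<close>
  define K' where "K' = 1 + 2 * w + c + C1 * 6 ^ (4 * m - 2)"
  have K': "K' \<ge> 1" "2 * w + c \<le> K'" "C1 * 6 ^ (4 * m - 2) \<le> K'" using w c C1 by (auto simp: K'_def)
  show ?thesis
  proof (intro exI[of _ "C2 * K'"] conjI allI impI)
    show "0 \<le> C2 * K'" using C2(1) K' by simp
    fix z :: "real^'n" and \<rho> G M :: real
    assume z: "8 \<le> norm z" and r: "0 < \<rho>" "\<rho> \<le> 1" and G: "0 \<le> G" "G * \<rho> \<le> 1" "\<forall>x\<in>ball z \<rho>. g x \<le> G"
      and M: "(LINT x:cball z (norm z / 2)|lborel. g x) \<le> M"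
    define R where "R = norm z / 2"
    have R: "R \<ge> 4" using z by (simp add: R_def)
    define L where "L = 2 * ln (R / \<rho>)"
    have L: "L \<ge> 0" unfolding L_def using R r by simp
    have nx: "R \<le> norm x" "norm x \<le> 3 * R" if "x \<in> cball z R" for x
      using that norm_triangle_ineq2[of z x] norm_triangle_ineq2[of x z] by (auto simp: R_def dist_norm norm_minus_commute)
    have KU: "cball z R \<subseteq> U" using nx R by force
    have KA: "cball z R \<subseteq> A (3 * R)" using nx R by force
    have intg: "integrable lborel (\<lambda>x. indicator (cball z R) x * g x)"
      by (intro integrable_indicator_compact compact_cball continuous_on_subset[OF continuous_g KU])
    have intv: "integrable lborel (\<lambda>x. indicator (cball z R) x * v x)"
      by (intro integrable_indicator_compact compact_cball continuous_on_subset[OF continuous_v KU])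
    have "0 \<le> (LINT x:cball z R|lborel. g x)" unfolding set_integral_indicator
      by (intro integral_nonneg_AE AE_I2) (use g_nonneg' KU in \<open>auto simp: indicator_def\<close>)
    then have M0: "M \<ge> 0" using M by (simp add: R_def)
    obtain S where S: "integrable lborel S" "(LINT x|lborel. S x) \<le> c * \<rho> ^ (2 * m)"
      "\<And>x. x \<noteq> z \<Longrightarrow> 0 \<le> S x" "\<And>x. x \<noteq> z \<Longrightarrow> norm (x - z) \<le> \<rho> \<Longrightarrow> 2 * ln (\<rho> / norm (x - z)) \<le> S x"
      using log_dominated[OF r(1), of z] by (auto simp: c_def w_def card_n)
    define J where "J = M * L + w * (2 * ln R + 2) + c"
    have J0: "J \<ge> 0" using M0 L w c R by (simp add: J_def)
    have est: "(LINT x:cball z R|lborel. kern m (\<lambda>t. inverse (t + e)) (inverse (R\<^sup>2) * (norm (x - z))\<^sup>2) * g x) \<le> J"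
      if e: "e \<in> {0<..1}" for e
    proof -
      define s where "s x = inverse (R\<^sup>2) * (norm (x - z))\<^sup>2" for x
      have s_def': "s x = (norm (x - z) / R)\<^sup>2" for x
        by (simp add: s_def divide_inverse_commute power_mult_distrib power_inverse)
      define E where "E x = kern m (\<lambda>t. inverse (t + e)) (s x)" for x
      have s0: "s x \<ge> 0" for x by (simp add: s_def)
      have r_c: "continuous_on {-e<..} (\<lambda>t. inverse (t + e))" by (intro continuous_intros) auto
      have kc: "continuous_on {-e<..} (kern m (\<lambda>t. inverse (t + e)))"
        using DERIV_isCont[OF kern_has_derivative[OF r_c]] m3 e
        by (intro continuous_at_imp_continuous_on) simp
      have s_lo: "s x > - e" for x using s0[of x] e by auto
      have s_c: "continuous_on UNIV s" unfolding s_def by (intro continuous_intros)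
      have E_c: "continuous_on UNIV E" unfolding E_def
        by (rule continuous_on_compose2[OF kc s_c]) (use s_lo in auto)
      have intE: "integrable lborel (\<lambda>x. indicator (cball z R) x * (E x * g x))"
        by (intro integrable_indicator_compact compact_cball continuous_on_mult continuous_on_subset[OF continuous_g KU]
            continuous_on_subset[OF E_c]) auto
      have E_nonneg: "E x \<ge> 0" for x
        unfolding E_def by (rule kern_nonneg[OF r_c]) (use s0[of x] e m3 in auto)
      have E_le: "E x \<le> 2 * ln (R / norm (x - z))" if "x \<noteq> z" "norm (x - z) \<le> R" for x
      proof -
        have n: "norm (x - z) > 0" using that by simp
        have "E x \<le> - ln (s x)" unfolding E_def
          by (rule kern_log_le) (use n e m3 that R in \<open>auto simp: s_def' power_le_one\<close>)
        also have "\<dots> = 2 * ln (R / norm (x - z))"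
          using n R by (simp add: s_def' ln_realpow ln_div)
        finally show ?thesis .
      qed
      define F where "F x = L * (indicator (cball z R) x * g x) + G * (L * indicator (cball z \<rho>) x + S x)" for x
      have intb: "integrable lborel (\<lambda>x. indicator (cball z \<rho>) x :: real)"
        using emeasure_lborel_cball_finite[of z \<rho>] by (intro integrable_real_indicator) auto
      have intF: "integrable lborel F" unfolding F_def using intg intb S(1) by auto
      have "(LINT x:cball z R|lborel. E x * g x) \<le> (LINT x|lborel. F x)"
        unfolding set_integral_indicator
      proof (rule integral_mono_AE)
        show "AE x in lborel. indicator (cball z R) x * (E x * g x) \<le> F x"
          using AE_lborel_singleton[of z]
        proof eventually_elim
          fix x assume x: "x \<noteq> z"
          have n: "norm (x - z) > 0" using x by simp
          have GS: "0 \<le> G * (L * indicator (cball z \<rho>) x + S x)"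
            using G L S(3)[OF x] by (intro mult_nonneg_nonneg add_nonneg_nonneg) auto
          show "indicator (cball z R) x * (E x * g x) \<le> F x"
          proof (cases "x \<in> cball z R")
            case False
            then show ?thesis using GS by (simp add: F_def)
          next
            case True
            then have xR: "norm (x - z) \<le> R" "x \<in> U"
              using KU by (simp add: dist_norm norm_minus_commute, blast)
            have g0: "g x \<ge> 0" by (rule g_nonneg'[OF xR(2)])
            show ?thesis
            proof (cases "norm (x - z) < \<rho>")
              case False
              have "ln (R / norm (x - z)) \<le> ln (R / \<rho>)"
                using False r n R by (subst ln_le_cancel_iff) (auto intro!: divide_left_mono)
              then have "E x \<le> L" using E_le[OF x xR(1)] by (simp add: L_def)
              then have "E x * g x \<le> L * g x" using g0 by (rule mult_right_mono)
              then show ?thesis using GS True by (simp add: F_def)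
            next
              case in\<rho>: True
              have "2 * ln (R / norm (x - z)) = L + 2 * ln (\<rho> / norm (x - z))"
                using n R r by (simp add: L_def ln_div)
              then have "E x \<le> L + S x" using E_le[OF x xR(1)] S(4)[OF x] in\<rho> by simp
              then have "E x * g x \<le> (L + S x) * G"
                using G(3) in\<rho> g0 L S(3)[OF x] by (intro mult_mono) (auto simp: dist_norm norm_minus_commute)
              moreover have "x \<in> cball z \<rho>" using in\<rho> by (simp add: dist_norm norm_minus_commute)
              moreover have "0 \<le> L * g x" using L g0 by simp
              ultimately show ?thesis using True by (simp add: F_def mult.commute)
            qed
          qed
        qed
      qed (use intE intF in auto)
      also have "\<dots> = L * (LINT x:cball z R|lborel. g x) + G * (L * measure lborel (cball z \<rho>) + (LINT x|lborel. S x))"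
        unfolding F_def set_integral_indicator using intg intb S(1) by simp
      also have "\<dots> \<le> L * M + G * (L * (w * \<rho> ^ (2 * m)) + c * \<rho> ^ (2 * m))"
        using L M G S(2) content_cball_eq[of \<rho> z] r
        by (intro add_mono mult_left_mono) (auto simp: R_def w_def card_n)
      also have "G * (L * (w * \<rho> ^ (2 * m)) + c * \<rho> ^ (2 * m)) \<le> w * (2 * ln R + 2) + c"
      proof -
        \<comment> \<open>Two of the 2m powers of \<open>\<rho>\<close> are kept: one is spent on
          \<open>G\<close>, the other tames the logarithm through
          \<open>\<rho> * ln (1 / \<rho>) \<le> 1\<close>.\<close>
        have "\<rho> ^ (2 * m) \<le> \<rho> ^ 2" using r m3 by (intro power_decreasing) auto
        then have "G * \<rho> ^ (2 * m) \<le> G * (\<rho> * \<rho>)" using G by (intro mult_left_mono) (auto simp: power2_eq_square)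
        also have "\<dots> \<le> \<rho>" using mult_right_mono[OF G(2), of \<rho>] r by (simp add: mult.assoc)
        finally have Gr: "G * \<rho> ^ (2 * m) \<le> \<rho>" .
        have Lw: "0 \<le> L * w + c" using L w c by simp
        have "G * (L * (w * \<rho> ^ (2 * m)) + c * \<rho> ^ (2 * m)) = (G * \<rho> ^ (2 * m)) * (L * w + c)"
          by (simp add: algebra_simps)
        also have "\<dots> \<le> \<rho> * (L * w + c)" using Gr Lw by (rule mult_right_mono)
        also have "\<dots> = w * (\<rho> * L) + \<rho> * c" by (simp add: algebra_simps)
        also have "\<dots> \<le> w * (2 * ln R + 2) + 1 * c"
        proof (intro add_mono mult_left_mono mult_right_mono w c r)
          have "\<rho> * ln (1 / \<rho>) \<le> \<rho> * (1 / \<rho> - 1)" using r by (intro mult_left_mono ln_le_minus_one) auto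
          also have "\<dots> \<le> 1" using r by (simp add: right_diff_distrib)
          finally have "\<rho> * ln (1 / \<rho>) \<le> 1" .
          moreover have "\<rho> * ln R \<le> 1 * ln R" using r R by (intro mult_right_mono) auto
          moreover have "\<rho> * L = 2 * (\<rho> * ln R) + 2 * (\<rho> * ln (1 / \<rho>))"
            using r R by (simp add: L_def ln_div algebra_simps)
          ultimately show "\<rho> * L \<le> 2 * ln R + 2" by linarith
        qed
        finally show ?thesis by simp
      qed
      finally show ?thesis unfolding J_def E_def s_def by (simp add: mult.commute)
    qed
    have vb: "v z \<le> C2 * (J + inverse (R\<^sup>2) ^ m * (LINT x:cball z R|lborel. v x))"
      by (rule C2(2)) (use R KU J0 est in auto)
    have "(LINT x:cball z R|lborel. v x) \<le> (LINT x:A (3 * R)|lborel. v x)"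
      unfolding set_integral_indicator
    proof (rule integral_mono)
      show "integrable lborel (\<lambda>x. indicator (A (3 * R)) x * v x)"
        by (intro integrable_indicator_compact compact_A continuous_on_subset[OF continuous_v]) auto
      fix x show "indicator (cball z R) x * v x \<le> indicator (A (3 * R)) x * v x"
        using KA v_nonneg[of x] by (cases "x \<in> cball z R"; cases "x \<in> A (3 * R)") auto
    qed (rule intv)
    also have "\<dots> \<le> C1 * (6 * R) ^ (4 * m - 2)" using C1(2)[of "6 * R"] R by simp
    finally have "inverse (R\<^sup>2) ^ m * (LINT x:cball z R|lborel. v x) \<le> inverse (R\<^sup>2) ^ m * (C1 * (6 * R) ^ (4 * m - 2))"
      by (intro mult_left_mono) auto
    also have "\<dots> = C1 * 6 ^ (4 * m - 2) * R ^ (2 * m - 2)"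
    proof -
      have "4 * m - 2 = 2 * m + (2 * m - 2)" using m3 by simp
      then have "R ^ (4 * m - 2) = (R\<^sup>2) ^ m * R ^ (2 * m - 2)" by (simp only: power_add power_mult)
      moreover have "inverse (R\<^sup>2) ^ m * (R\<^sup>2) ^ m = 1" using R by (simp add: power_mult_distrib[symmetric])
      ultimately show ?thesis by (simp add: power_mult_distrib)
    qed
    also have "\<dots> \<le> K' * R ^ (2 * m - 2)" using K' R by (intro mult_right_mono) auto
    finally have t1: "inverse (R\<^sup>2) ^ m * (LINT x:cball z R|lborel. v x) \<le> K' * R ^ (2 * m - 2)" .
    have lR: "ln R \<ge> 0" using R by simp
    have "J \<le> K' * (M * L) + K' * (2 * ln R + 1)"
    proof -
      have "1 * (M * L) \<le> K' * (M * L)" using K' M0 L by (intro mult_right_mono) auto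
      moreover have "w * (2 * ln R + 2) + c \<le> (2 * w + c) * (2 * ln R + 1)"
        using w c lR by (simp add: algebra_simps)
      moreover have "(2 * w + c) * (2 * ln R + 1) \<le> K' * (2 * ln R + 1)"
        using K' lR by (intro mult_right_mono) auto
      ultimately show ?thesis unfolding J_def by linarith
    qed
    then have "J + inverse (R\<^sup>2) ^ m * (LINT x:cball z R|lborel. v x) \<le> K' * (M * L + (2 * ln R + 1) + R ^ (2 * m - 2))"
      using t1 by (simp add: distrib_left)
    then have "v z \<le> C2 * (K' * (M * L + (2 * ln R + 1) + R ^ (2 * m - 2)))"
      using vb C2(1) mult_left_mono order_trans by blast
    then show "v z \<le> C2 * K' * (M * (2 * ln (norm z / 2 / \<rho>)) + (2 * ln (norm z / 2) + 1) + (norm z / 2) ^ (2 * m - 2))"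
      unfolding L_def R_def by (simp only: mult.assoc)
  qed
qed

text \<open>At a maximum \<open>z\<close> of \<open>v x * (1 - norm (x - y))\<close> over \<open>cball y 1\<close> one has \<open>v z \<ge> v y\<close>, while
  \<open>v \<le> 2 * v z\<close> on a ball around \<open>z\<close> of radius at least \<open>1 / (2 * v z)\<close>. This controls
  \<open>g\<close> near the logarithmic singularity.\<close>

lemma growth_bound:
  fixes A0 lam \<epsilon> :: real
  assumes lam: "0 < lam" "lam < 1" and A0: "A0 \<ge> 0"
    and g_exp: "\<And>x. x \<in> U \<Longrightarrow> g x \<le> exp (A0 * (1 + v x powr lam))" and eps: "\<epsilon> > 0"
  shows "\<exists>Y. \<forall>y. Y \<le> norm y \<longrightarrow> v y \<le> \<epsilon> * norm y powr (real (2 * m - 2) / (1 - lam))"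
proof -
  define N where "N = 2 * m - 2"
  define p where "p = real N / (1 - lam)"
  have N: "N \<ge> 4" using m3 by (simp add: N_def)
  have pN: "real N < p"
    using N lam unfolding p_def by (simp add: field_simps)
  define \<delta> where "\<delta> = p - real N"
  have d0: "\<delta> > 0" using pN by (simp add: \<delta>_def)
  obtain C where C: "C \<ge> 0" "\<And>z \<rho> G M. 8 \<le> norm z \<Longrightarrow> 0 < \<rho> \<Longrightarrow> \<rho> \<le> 1 \<Longrightarrow> 0 \<le> G \<Longrightarrow> G * \<rho> \<le> 1 \<Longrightarrow>
    (\<forall>x\<in>ball z \<rho>. g x \<le> G) \<Longrightarrow> (LINT x:cball z (norm z / 2)|lborel. g x) \<le> M \<Longrightarrow>
    v z \<le> C * (M * (2 * ln (norm z / 2 / \<rho>)) + (2 * ln (norm z / 2) + 1) + (norm z / 2) ^ N)"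
    using point_bound unfolding N_def by blast
  \<comment> \<open>Coefficient of V^lam in the bound for ln(2 * V * G): the summands stand for ln
    2, for ln V (at most V^lam / lam), and for the two parts of ln G.\<close>
  define A' where "A' = ln 2 + 1 / lam + A0 + A0 * 2 powr lam"
  have A': "A' \<ge> 0" using A0 lam by (simp add: A'_def)
  define E where "E = \<epsilon> powr (lam - 1)"
  have E: "E > 0" using eps by (simp add: E_def)
  \<comment> \<open>Chosen so that the term R^N * V^lam, at most \<open>E * V\<close> when the claim
    fails, enters the estimate with total weight at most V / 4.\<close>
  define \<eta> where "\<eta> = min 1 (1 / (8 * (C + 1) * (A' + 1) * E))"
  have eta: "\<eta> > 0" "\<eta> \<le> 1" using C A' E by (auto simp: \<eta>_def)
  have eta_small: "2 * C * \<eta> * A' * E \<le> 1 / 4"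
  proof -
    have "C * A' \<le> (C + 1) * (A' + 1)" using C A' by (intro mult_mono) auto
    then have "(C * A') * (2 * \<eta> * E) \<le> ((C + 1) * (A' + 1)) * (2 * \<eta> * E)"
      using eta E by (intro mult_right_mono) auto
    also have "\<dots> \<le> ((C + 1) * (A' + 1)) * (2 * (1 / (8 * (C + 1) * (A' + 1) * E)) * E)"
      using C A' E by (intro mult_left_mono mult_right_mono) (auto simp: \<eta>_def)
    also have "\<dots> = 1 / 4"
    proof -
      have "x \<noteq> 0 \<Longrightarrow> y \<noteq> 0 \<Longrightarrow> E \<noteq> 0 \<Longrightarrow> (x * y) * (2 * (1 / (8 * x * y * E)) * E) = 1 / 4" for x y
        by (simp add: field_simps)
      then show ?thesis using C(1) A' E by simp
    qed
    finally show ?thesis by (simp add: mult_ac)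
  qed
  obtain R0 where R0: "R0 \<ge> 2" "\<And>y R. 0 < R \<Longrightarrow> cball y R \<subseteq> {x. R0 < norm x \<and> norm x \<le> 3 * R} \<Longrightarrow>
    (LINT x:cball y R|lborel. g x) \<le> \<eta> * R ^ N"
    using g_tail[OF eta(1)] unfolding N_def by blast
  \<comment> \<open>The gap \<open>\<delta>\<close> between \<open>p\<close> and \<open>N\<close> is
    split in halves: one absorbs ln R, the other exceeds the constant \<open>Q\<close> once
    \<open>R \<ge> R1\<close>.\<close>
  define Q where "Q = max 1 (16 * C * (1 + 2 / \<delta>) / \<epsilon>)"
  define R1 where "R1 = Q powr (2 / \<delta>)"
  have R1: "R1 \<ge> 1" unfolding R1_def Q_def using d0 by (intro ge_one_powr_ge_zero) auto
  have lower_order: "C * (2 * R ^ N * ln R + (2 * ln R + 1) + R ^ N) \<le> \<epsilon> / 4 * R powr p" if "R \<ge> R1" for R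
  proof -
    have R: "R \<ge> 1" using that R1 by simp
    have RN: "R ^ N \<ge> 1" "R ^ N = R powr real N" using R by (auto simp: powr_realpow)
    have lR: "ln R \<ge> 0" using R by simp
    have "ln R \<le> R powr (\<delta> / 2) / (\<delta> / 2)" using R d0 by (intro ln_powr_bound) auto
    moreover have h1: "1 \<le> R powr (\<delta> / 2)" using R d0 by (intro ge_one_powr_ge_zero) auto
    ultimately have l: "1 + ln R \<le> (1 + 2 / \<delta>) * R powr (\<delta> / 2)" by (simp add: algebra_simps)
    have "1 * (2 * ln R + 1) \<le> R ^ N * (2 * ln R + 1)" using RN lR by (intro mult_right_mono) auto
    then have "2 * R ^ N * ln R + (2 * ln R + 1) + R ^ N \<le> R ^ N * (4 * (1 + ln R))"
      using RN lR by (simp add: algebra_simps)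
    also have "\<dots> \<le> R ^ N * (4 * ((1 + 2 / \<delta>) * R powr (\<delta> / 2)))" using l RN by (intro mult_left_mono) auto
    finally have "C * (2 * R ^ N * ln R + (2 * ln R + 1) + R ^ N) \<le> C * (R ^ N * (4 * ((1 + 2 / \<delta>) * R powr (\<delta> / 2))))"
      using C(1) by (rule mult_left_mono)
    also have "\<dots> = (16 * C * (1 + 2 / \<delta>) / \<epsilon>) * (\<epsilon> / 4 * (R ^ N * R powr (\<delta> / 2)))" using eps by simp
    also have "\<dots> \<le> R powr (\<delta> / 2) * (\<epsilon> / 4 * (R ^ N * R powr (\<delta> / 2)))"
    proof (rule mult_right_mono)
      have "Q = R1 powr (\<delta> / 2)" unfolding R1_def using d0 by (simp add: powr_powr Q_def)
      also have "\<dots> \<le> R powr (\<delta> / 2)" using that R1 d0 by (intro powr_mono2) auto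
      finally show "16 * C * (1 + 2 / \<delta>) / \<epsilon> \<le> R powr (\<delta> / 2)" by (simp add: Q_def)
    qed (use eps RN in auto)
    also have "\<dots> = \<epsilon> / 4 * R powr p"
    proof -
      have "R powr p = R powr (real N + \<delta> / 2 + \<delta> / 2)" by (simp add: \<delta>_def)
      also have "\<dots> = R powr real N * R powr (\<delta> / 2) * R powr (\<delta> / 2)" by (simp only: powr_add)
      finally show ?thesis using RN by simp
    qed
    finally show ?thesis .
  qed
  \<comment> \<open>The summand \<open>1 / \<epsilon>\<close> makes a failing \<open>v y\<close> at
    least 1; the others survive the shift to a point at distance at most 1 and the halving in
    \<open>R\<close>.\<close>
  define Y where "Y = 2 * R1 + 2 * R0 + 10 + 1 / \<epsilon>"
  have "v y \<le> \<epsilon> * norm y powr p" if y: "Y \<le> norm y" for y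
  proof (rule ccontr)
    assume "\<not> v y \<le> \<epsilon> * norm y powr p"
    then have vy: "\<epsilon> * norm y powr p < v y" by simp
    have ny: "norm y \<ge> 10" "norm y \<ge> 1 / \<epsilon>" "norm y \<ge> 2 * R1 + 2 * R0 + 10"
      using y R1 R0(1) eps zero_le_divide_1_iff[of \<epsilon>] unfolding Y_def by linarith+
    have "1 \<le> \<epsilon> * norm y" using ny(2) eps by (simp add: field_simps)
    also have "norm y = norm y powr 1" using ny by simp
    also have "\<epsilon> * norm y powr 1 \<le> \<epsilon> * norm y powr p" using eps ny pN N by (intro mult_left_mono powr_mono) auto
    finally have vy1: "1 \<le> v y" using vy by simp
    have sub: "cball y 1 \<subseteq> U"
    proof
      fix x assume "x \<in> cball y 1"
      then have "norm (y - x) \<le> 1" by (simp add: dist_norm)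
      then show "x \<in> U" using norm_triangle_ineq2[of y x] ny by auto
    qed
    have "continuous_on (cball y 1) (\<lambda>x. v x * (1 - norm (x - y)))"
      by (intro continuous_intros continuous_on_subset[OF continuous_v sub])
    then obtain z where z: "z \<in> cball y 1" "\<And>x. x \<in> cball y 1 \<Longrightarrow> v x * (1 - norm (x - y)) \<le> v z * (1 - norm (z - y))"
      using continuous_attains_sup[of "cball y 1" "\<lambda>x. v x * (1 - norm (x - y))"] by auto
    define V where "V = v z"
    define d where "d = 1 - norm (z - y)"
    have d: "0 \<le> d" "d \<le> 1" using z(1) by (auto simp: d_def dist_norm norm_minus_commute)
    have Vd: "v y \<le> V * d" using z(2)[of y] by (simp add: V_def d_def)
    have V0: "V \<ge> 0" unfolding V_def using v_nonneg sub z(1) by blast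
    have dpos: "d > 0" using Vd vy1 d by (cases "d = 0") auto
    have V: "v y \<le> V" "1 \<le> V" using Vd vy1 mult_left_le[OF d(2) V0] by auto
    have dV: "1 / V \<le> d" using Vd vy1 V by (simp add: field_simps)
    have v2V: "v x \<le> 2 * V" "x \<in> U" if "x \<in> ball z (d / 2)" for x
    proof -
      have "norm (x - y) \<le> norm (z - y) + norm (x - z)" using norm_triangle_ineq[of "x - z" "z - y"] by simp
      moreover have "norm (x - z) < d / 2" using that by (simp add: dist_norm norm_minus_commute)
      ultimately have nx: "d / 2 \<le> 1 - norm (x - y)" by (simp add: d_def)
      then have xc: "x \<in> cball y 1" using d by (simp add: dist_norm norm_minus_commute)
      then show "x \<in> U" using sub by blast
      have "v x * (d / 2) \<le> v x * (1 - norm (x - y))" using nx v_nonneg xc sub by (intro mult_left_mono) auto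
      also have "\<dots> \<le> V * d" using z(2)[OF xc] by (simp add: V_def d_def)
      finally show "v x \<le> 2 * V" using dpos by (simp add: field_simps)
    qed
    define G where "G = exp (A0 * (1 + (2 * V) powr lam))"
    have G: "G \<ge> 1" unfolding G_def using A0 by simp
    \<comment> \<open>Radius \<open>d / 2\<close> preserves \<open>v \<le> 2 * V\<close>, and
      \<open>1 / G\<close> provides \<open>G * \<rho> \<le> 1\<close>. As
      \<open>d \<ge> 1 / V\<close>, the radius is no smaller than 1 / (2 * V * G).\<close>
    define \<rho> where "\<rho> = min (d / 2) (1 / G)"
    have r: "0 < \<rho>" "\<rho> \<le> 1" using dpos d G by (auto simp: \<rho>_def)
    have Gr: "G * \<rho> \<le> 1"
    proof -
      have "G * \<rho> \<le> G * (1 / G)" using G by (intro mult_left_mono) (auto simp: \<rho>_def)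
      then show ?thesis using G by simp
    qed
    have gG: "\<forall>x\<in>ball z \<rho>. g x \<le> G"
    proof
      fix x assume "x \<in> ball z \<rho>"
      then have x: "x \<in> ball z (d / 2)" by (auto simp: \<rho>_def)
      have "v x powr lam \<le> (2 * V) powr lam" using v2V[OF x] v_nonneg lam by (intro powr_mono2) auto
      then have "A0 * (1 + v x powr lam) \<le> A0 * (1 + (2 * V) powr lam)" using A0 by (intro mult_left_mono) auto
      then show "g x \<le> G" unfolding G_def using g_exp[OF v2V(2)[OF x]] by (meson exp_le_cancel_iff order_trans)
    qed
    define R where "R = norm z / 2"
    have nz: "norm y - 1 \<le> norm z" "norm z \<le> norm y + 1"
      using z(1) norm_triangle_ineq2[of y z] norm_triangle_ineq2[of z y] by (auto simp: dist_norm norm_minus_commute)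
    have R: "R \<ge> R1" "R > R0" "R \<ge> 4" "R \<le> norm y" using nz ny R0 R1 by (auto simp: R_def)
    have tail: "(LINT x:cball z R|lborel. g x) \<le> \<eta> * R ^ N"
    proof (rule R0(2))
      show "cball z R \<subseteq> {x. R0 < norm x \<and> norm x \<le> 3 * R}"
      proof
        fix x assume "x \<in> cball z R"
        then show "x \<in> {x. R0 < norm x \<and> norm x \<le> 3 * R}"
          using norm_triangle_ineq2[of z x] norm_triangle_ineq2[of x z] R
          by (auto simp: R_def dist_norm norm_minus_commute)
      qed
    qed (use R in simp)
    have Vb: "V \<le> C * (\<eta> * R ^ N * (2 * ln (R / \<rho>)) + (2 * ln R + 1) + R ^ N)"
      unfolding V_def R_def by (rule C(2)[OF _ r _ Gr gG]) (use R G tail in \<open>auto simp: R_def\<close>)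
    define W where "W = V powr lam"
    have W: "W \<ge> 1" unfolding W_def using V lam by (intro ge_one_powr_ge_zero) auto
    have lnr: "ln (R / \<rho>) \<le> ln R + A' * W"
    proof -
      have "1 / (2 * V * G) \<le> \<rho>" unfolding \<rho>_def
      proof (rule min.boundedI)
        have "1 / (2 * V * G) \<le> 1 / (2 * V * 1)" using V G by (intro divide_left_mono mult_left_mono) auto
        also have "\<dots> \<le> d / 2" using dV by simp
        finally show "1 / (2 * V * G) \<le> d / 2" .
        show "1 / (2 * V * G) \<le> 1 / G" using V G by (intro divide_left_mono) auto
      qed
      then have "R / \<rho> \<le> R * (2 * V * G)" using V G R r by (simp add: field_simps)
      then have "ln (R / \<rho>) \<le> ln (R * (2 * V * G))" using R r V G by (subst ln_le_cancel_iff) auto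
      also have "\<dots> = ln R + (ln 2 + ln V + A0 * (1 + 2 powr lam * W))"
        using R V G by (simp add: ln_mult G_def W_def powr_mult)
      also have "\<dots> \<le> ln R + A' * W"
      proof -
        have "ln V \<le> W / lam" unfolding W_def using V lam by (intro ln_powr_bound) auto
        moreover have "ln 2 * 1 \<le> ln 2 * W" using W by (intro mult_left_mono) auto
        moreover have "A0 * 1 \<le> A0 * W" using W A0 by (intro mult_left_mono) auto
        moreover have "A' * W = ln 2 * W + W / lam + A0 * W + A0 * (2 powr lam * W)"
          by (simp add: A'_def algebra_simps)
        moreover have "A0 * (1 + 2 powr lam * W) = A0 + A0 * (2 powr lam * W)"
          by (simp add: algebra_simps)
        ultimately show ?thesis by linarith
      qed
      finally show ?thesis .
    qed
    \<comment> \<open>Here the exponent is used: since p * (1 - lam) = N, the assumed failure R^p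
      \<le> V / \<epsilon> raised to the power 1 - lam gives R^N \<le> E * V^(1 - lam).\<close>
    have RNW: "R ^ N * W \<le> V * E"
    proof -
      have "\<epsilon> * R powr p \<le> \<epsilon> * norm y powr p" using eps R pN N by (intro mult_left_mono powr_mono2) auto
      then have "R powr p * \<epsilon> \<le> V" using vy V by (simp only: mult.commute[of _ \<epsilon>])
      then have "R powr p \<le> V / \<epsilon>" using eps by (simp only: pos_le_divide_eq)
      then have "(R powr p) powr (1 - lam) \<le> (V / \<epsilon>) powr (1 - lam)" using lam by (intro powr_mono2) auto
      moreover have "(R powr p) powr (1 - lam) = R ^ N"
        using R lam by (simp add: powr_powr p_def powr_realpow)
      moreover have "(V / \<epsilon>) powr (1 - lam) = V powr (1 - lam) * E"
        using V eps powr_minus[of \<epsilon> "1 - lam"] by (subst powr_divide) (simp_all add: E_def divide_inverse)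
      ultimately have "R ^ N * W \<le> V powr (1 - lam) * E * W" using W by (intro mult_right_mono) auto
      also have "\<dots> = V powr (1 - lam + lam) * E" by (simp only: powr_add W_def mult_ac)
      also have "\<dots> = V * E" using V by simp
      finally show ?thesis .
    qed
    have RN: "R ^ N \<ge> 0" using R by simp
    have lR: "ln R \<ge> 0" using R by simp
    have "V \<le> C * (\<eta> * R ^ N * (2 * (ln R + A' * W)) + (2 * ln R + 1) + R ^ N)"
      using Vb
    proof (rule order_trans)
      show "C * (\<eta> * R ^ N * (2 * ln (R / \<rho>)) + (2 * ln R + 1) + R ^ N) \<le>
        C * (\<eta> * R ^ N * (2 * (ln R + A' * W)) + (2 * ln R + 1) + R ^ N)"
        using lnr eta RN C(1) by (intro mult_left_mono add_right_mono) auto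
    qed
    also have "\<dots> = (2 * C * \<eta> * A') * (R ^ N * W) + C * (\<eta> * (2 * R ^ N * ln R) + (2 * ln R + 1) + R ^ N)"
      by (simp add: algebra_simps)
    also have "\<dots> \<le> (2 * C * \<eta> * A') * (V * E) + C * (1 * (2 * R ^ N * ln R) + (2 * ln R + 1) + R ^ N)"
      using RNW C(1) eta A' RN lR by (intro add_mono mult_left_mono mult_right_mono) auto
    also have "\<dots> = (2 * C * \<eta> * A' * E) * V + C * (2 * R ^ N * ln R + (2 * ln R + 1) + R ^ N)"
      by (simp add: mult_ac)
    also have "\<dots> \<le> 1 / 4 * V + \<epsilon> / 4 * R powr p"
      using eta_small V0 lower_order[OF R(1)] by (intro add_mono mult_right_mono) auto
    also have "\<epsilon> / 4 * R powr p \<le> 1 / 4 * V"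
    proof -
      have "\<epsilon> * R powr p \<le> \<epsilon> * norm y powr p" using eps R pN N by (intro mult_left_mono powr_mono2) auto
      then show ?thesis using vy V by linarith
    qed
    finally show False using V by simp
  qed
  then show ?thesis unfolding p_def N_def by blast
qed

end

section \<open>Growth of the nonlinearity and conclusion\<close>

text \<open>The asymptotic bound speaks of large \<open>t\<close> only; on the remaining compact
  interval continuity bounds \<open>f\<close>. The summand 1 next to \<open>t powr lam\<close> keeps
  the exponent away from zero for small \<open>t\<close>.\<close>

lemma exp_growth_bound:
  fixes f :: "real \<Rightarrow> real"
  assumes "continuous_on {0..} f" "\<forall>t\<ge>0. f t \<ge> 0"
    and "(\<lambda>t. ln (1 + f t)) \<in> O[at_top](\<lambda>t. t powr lam)"
  shows "\<exists>A\<ge>0. \<forall>t\<ge>0. f t \<le> exp (A * (1 + t powr lam))"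
proof -
  obtain c where c: "c > 0" "\<forall>\<^sub>F t in at_top. norm (ln (1 + f t)) \<le> c * norm (t powr lam)"
    using landau_o.bigE[OF assms(3)] by blast
  then obtain T where T: "\<And>t. t \<ge> T \<Longrightarrow> norm (ln (1 + f t)) \<le> c * norm (t powr lam)"
    unfolding eventually_at_top_linorder by blast
  have "compact (f ` {0..max T 0})"
    using assms(1) by (intro compact_continuous_image compact_Icc) (auto intro: continuous_on_subset)
  then have "bounded (f ` {0..max T 0})" by (rule compact_imp_bounded)
  then obtain B where B: "\<forall>t\<in>{0..max T 0}. norm (f t) \<le> B" unfolding bounded_iff ball_simps by blast
  define A where "A = max c B"
  have A: "A \<ge> 0" "c \<le> A" "B \<le> A" using c by (auto simp: A_def)
  have "f t \<le> exp (A * (1 + t powr lam))" if t: "t \<ge> 0" for t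
  proof (cases "t \<le> T")
    case True
    then have "f t \<le> A" using B t A by force
    also have "\<dots> \<le> A * (1 + t powr lam)" using A by (simp add: algebra_simps)
    also have "\<dots> \<le> exp (A * (1 + t powr lam))" using exp_ge_add_one_self[of "A * (1 + t powr lam)"] by linarith
    finally show ?thesis .
  next
    case False
    have f0: "f t \<ge> 0" using assms(2) t by blast
    have "ln (1 + f t) \<le> c * t powr lam" using T[of t] False by simp
    also have "\<dots> \<le> A * (1 + t powr lam)" using A c by (intro mult_mono) auto
    finally have "1 + f t \<le> exp (A * (1 + t powr lam))" using f0 by (metis add_pos_nonneg exp_le_cancel_iff exp_ln zero_less_one)
    then show ?thesis by simp
  qed
  then show ?thesis using A(1) by blast
qed

theorem theorem1p16:
  fixes m :: nat and lam :: real and f :: "real \<Rightarrow> real" and v :: "real^'n \<Rightarrow> real"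
  assumes "odd m" and "m \<ge> 3" and "CARD('n) = 2 * m"
    and "continuous_on {0..} f" and "\<forall>t\<ge>0. f t \<ge> 0"
    and "0 < lam" and "lam < 1"
    and "(\<lambda>t. ln (1 + f t)) \<in> O[at_top](\<lambda>t. t powr lam)"
    and "Ck_on (2 * m) {y. norm y > 1/2} v"
    and "\<forall>y. norm y > 1/2 \<longrightarrow> v y \<ge> 0"
    and "\<forall>y. norm y > 1/2 \<longrightarrow> 0 \<le> - iter_laplacian m v y \<and> - iter_laplacian m v y \<le> f (v y)"
  shows "v \<in> o[at_infinity](\<lambda>y. norm y powr ((real (2 * m) - 2) / (1 - lam)))"
proof -
  interpret exterior m v
    by unfold_locales (use assms in blast)+
  obtain A0 where A0: "A0 \<ge> 0" "\<And>t. t \<ge> 0 \<Longrightarrow> f t \<le> exp (A0 * (1 + t powr lam))"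
    using exp_growth_bound[OF assms(4,5,8)] by blast
  have g_exp: "g x \<le> exp (A0 * (1 + v x powr lam))" if "x \<in> {y. norm y > 1/2}" for x
    using assms(10,11) A0(2)[of "v x"] that unfolding g_def by force
  \<comment> \<open>Reconciles subtraction of naturals with that of reals; harmless since
    \<open>2 * m \<ge> 2\<close>.\<close>
  have ex: "real (2 * m - 2) = real (2 * m) - 2" using assms(2) by simp
  show ?thesis
  proof (rule landau_o.smallI)
    fix c :: real assume "c > 0"
    then obtain Y where Y: "\<And>y. Y \<le> norm y \<Longrightarrow> v y \<le> c * norm y powr (real (2 * m - 2) / (1 - lam))"
      using growth_bound[OF assms(6,7) A0(1) g_exp] by blast
    \<comment> \<open>The bound \<open>1 \<le> norm y\<close> places \<open>y\<close> in the
      exterior region, where \<open>v y\<close> is nonnegative and equals its norm.\<close>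
    have "norm (v y) \<le> c * norm (norm y powr ((real (2 * m) - 2) / (1 - lam)))" if "max Y 1 \<le> norm y" for y
      using Y[of y] assms(10) that ex by simp
    then show "\<forall>\<^sub>F y in at_infinity. norm (v y) \<le> c * norm (norm y powr ((real (2 * m) - 2) / (1 - lam)))"
      unfolding eventually_at_infinity by blast
  qed
qed

end
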